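(* Let $\Bbbk$ be a field. The category $\mathscr{C}at_{dgwu}(\Bbbk)$ of small weakly unital dg categories over $\Bbbk$ is small complete and small cocomplete.
   Context: Complexes are cohomologically graded over the field $\Bbbk$. A non-unital dg category is a dg category without required identity morphisms. For a non-unital dg category $A$, let $\Bbbk_A$ have the same objects, $\Bbbk_A(X,X)=\Bbbk\cdot 1_X$, $\Bbbk_A(X,Y)=0$ for $X\neq Y$. Let $A\oplus\Bbbk_A$ be the unital dg category with the same objects, $(A\oplus \Bbbk_A)(X,Y)=A(X,Y)$ for $X\ne Y$ and $A(X,X)\oplus\Bbbk 1_X$ for $X=Y$, where $1_X$ is the strict identity of $X$; let $i\colon A\to A\oplus\Bbbk_A$ be the inclusion. A *weakly unital dg category* is a non-unital dg category $A$ with, for each object $X$, an element $\mathrm{id}_X\in A(X,X)^0$ with $d(\mathrm{id}_X)=0$, $\mathrm{id}_X\circ\mathrm{id}_X=\mathrm{id}_X$, and with an $A_\infty$ functor $p=p^A\colon A\oplus\Bbbk_A\to A$ (part of the structure; components $p_n$, $n\ge 1$, of degree $1-n$), identity on objects, such that $p\circ i=\mathrm{id}_A$ (that is, $p_1(f)=f$ for $f$ in $A$, and $p_n(f_1,\dots,f_n)=0$ for $n\ge2$ if all $f_i$ are in $A$), $p_1(1_X)=\mathrm{id}_X$ and $p_n(1_X,\dots,1_X)=0$ for $n\ge 2$. A *weakly unital dg functor* $F\colon C\to D$ is a dg functor of non-unital dg categories with $F\circ p^C=p^D\circ(F\oplus\mathrm{id})$, i.e. $F(p^C_n(f_1,\dots,f_n))=p^D_n(F(f_1),\dots,F(f_n))$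 for all $n$ and all $f_i$ in $C\oplus \Bbbk_C$ (with $F(1_X)=1_{F(X)}$). Small weakly unital dg categories and these functors form the category $\mathscr{C}at_{dgwu}(\Bbbk)$. *)

theory Defs
  imports "HOL-Algebra.Module"
begin

unbundle cardinal_syntax

section \<open>Categories, limits and colimits\<close>

text \<open>
  \<open>Comp C X Y Z g f\<close> is the composite of \<open>f : X \<rightarrow> Y\<close> followed by \<open>g : Y \<rightarrow> Z\<close>.
\<close>

record ('o, 'a) category_data =
  Obj :: "'o set"
  Mor :: "'o \<Rightarrow> 'o \<Rightarrow> 'a set"
  Id :: "'o \<Rightarrow> 'a"
  Comp :: "'o \<Rightarrow> 'o \<Rightarrow> 'o \<Rightarrow> 'a \<Rightarrow> 'a \<Rightarrow> 'a"

locale category =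
  fixes C :: "('o, 'a) category_data"
  assumes Id_in: "X \<in> Obj C \<Longrightarrow> Id C X \<in> Mor C X X"
    and Comp_in: "\<lbrakk>X \<in> Obj C; Y \<in> Obj C; Z \<in> Obj C; g \<in> Mor C Y Z; f \<in> Mor C X Y\<rbrakk>
      \<Longrightarrow> Comp C X Y Z g f \<in> Mor C X Z"
    and Comp_Id: "\<lbrakk>X \<in> Obj C; Y \<in> Obj C; f \<in> Mor C X Y\<rbrakk> \<Longrightarrow> Comp C X X Y f (Id C X) = f"
    and Id_Comp: "\<lbrakk>X \<in> Obj C; Y \<in> Obj C; f \<in> Mor C X Y\<rbrakk> \<Longrightarrow> Comp C X Y Y (Id C Y) f = f"
    and Comp_assoc: "\<lbrakk>W \<in> Obj C; X \<in> Obj C; Y \<in> Obj C; Z \<in> Obj C;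
        h \<in> Mor C Y Z; g \<in> Mor C X Y; f \<in> Mor C W X\<rbrakk>
      \<Longrightarrow> Comp C W X Z (Comp C X Y Z h g) f = Comp C W Y Z h (Comp C W X Y g f)"

locale diagram = J: category J + C: category C
  for J :: "('j, 'b) category_data" and C :: "('o, 'a) category_data" +
  fixes Do :: "'j \<Rightarrow> 'o" and Dm :: "'j \<Rightarrow> 'j \<Rightarrow> 'b \<Rightarrow> 'a"
  assumes Do_in: "i \<in> Obj J \<Longrightarrow> Do i \<in> Obj C"
    and Dm_in: "\<lbrakk>i \<in> Obj J; j \<in> Obj J; u \<in> Mor J i j\<rbrakk> \<Longrightarrow> Dm i j u \<in> Mor C (Do i) (Do j)"
    and Dm_Id: "i \<in> Obj J \<Longrightarrow> Dm i i (Id J i) = Id C (Do i)"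
    and Dm_Comp: "\<lbrakk>i \<in> Obj J; j \<in> Obj J; k \<in> Obj J; v \<in> Mor J j k; u \<in> Mor J i j\<rbrakk>
      \<Longrightarrow> Dm i k (Comp J i j k v u) = Comp C (Do i) (Do j) (Do k) (Dm j k v) (Dm i j u)"

definition is_cone ::
    "('j, 'b) category_data \<Rightarrow> ('o, 'a) category_data \<Rightarrow> ('j \<Rightarrow> 'o) \<Rightarrow> ('j \<Rightarrow> 'j \<Rightarrow> 'b \<Rightarrow> 'a)
      \<Rightarrow> 'o \<Rightarrow> ('j \<Rightarrow> 'a) \<Rightarrow> bool" where
  "is_cone J C Do Dm L \<pi> \<longleftrightarrow> L \<in> Obj C \<and> (\<forall>j\<in>Obj J. \<pi> j \<in> Mor C L (Do j)) \<and>
    (\<forall>i\<in>Obj J. \<forall>j\<in>Obj J. \<forall>u\<in>Mor J i j. Comp C L (Do i) (Do j) (Dm i j u) (\<pi> i) = \<pi> j)"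

definition is_limit ::
    "('j, 'b) category_data \<Rightarrow> ('o, 'a) category_data \<Rightarrow> ('j \<Rightarrow> 'o) \<Rightarrow> ('j \<Rightarrow> 'j \<Rightarrow> 'b \<Rightarrow> 'a)
      \<Rightarrow> 'o \<Rightarrow> ('j \<Rightarrow> 'a) \<Rightarrow> bool" where
  "is_limit J C Do Dm L \<pi> \<longleftrightarrow> is_cone J C Do Dm L \<pi> \<and>
    (\<forall>X \<xi>. is_cone J C Do Dm X \<xi> \<longrightarrow>
      (\<exists>!h. h \<in> Mor C X L \<and> (\<forall>j\<in>Obj J. Comp C X L (Do j) (\<pi> j) h = \<xi> j)))"

definition is_cocone ::
    "('j, 'b) category_data \<Rightarrow> ('o, 'a) category_data \<Rightarrow> ('j \<Rightarrow> 'o) \<Rightarrow> ('j \<Rightarrow> 'j \<Rightarrow> 'b \<Rightarrow> 'a)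
      \<Rightarrow> 'o \<Rightarrow> ('j \<Rightarrow> 'a) \<Rightarrow> bool" where
  "is_cocone J C Do Dm L \<iota> \<longleftrightarrow> L \<in> Obj C \<and> (\<forall>j\<in>Obj J. \<iota> j \<in> Mor C (Do j) L) \<and>
    (\<forall>i\<in>Obj J. \<forall>j\<in>Obj J. \<forall>u\<in>Mor J i j. Comp C (Do i) (Do j) L (\<iota> j) (Dm i j u) = \<iota> i)"

definition is_colimit ::
    "('j, 'b) category_data \<Rightarrow> ('o, 'a) category_data \<Rightarrow> ('j \<Rightarrow> 'o) \<Rightarrow> ('j \<Rightarrow> 'j \<Rightarrow> 'b \<Rightarrow> 'a)
      \<Rightarrow> 'o \<Rightarrow> ('j \<Rightarrow> 'a) \<Rightarrow> bool" where
  "is_colimit J C Do Dm L \<iota> \<longleftrightarrow> is_cocone J C Do Dm L \<iota> \<and>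
    (\<forall>X \<xi>. is_cocone J C Do Dm X \<xi> \<longrightarrow>
      (\<exists>!h. h \<in> Mor C L X \<and> (\<forall>j\<in>Obj J. Comp C (Do j) L X h (\<iota> j) = \<xi> j)))"


section \<open>Smallness\<close>

text \<open>
  The type \<open>'u\<close> plays the role of a universe: a set of elements of \<open>'u\<close> is small if its
  cardinality is strictly below that of the whole type.
\<close>

definition small :: "'u set \<Rightarrow> bool" where
  "small A \<longleftrightarrow> |A| <o |UNIV :: 'u set|"

text \<open>
  The small sets of \<open>'u\<close> are required to be closed under products indexed by small sets of
  \<open>'v\<close>.  For \<open>'v = 'u\<close> this says exactly that the cardinality of \<open>'u\<close> is strongly
  inaccessible (uncountable, regular, strong limit), so that the small sets are, up to
  bijection, the members of a Grothendieck universe.  Plain HOL does not prove that a type of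
  such a cardinality exists.  Keeping the size bound \<open>'v\<close> for index categories apart from
  the size bound \<open>'u\<close> for dg categories makes the condition satisfiable without a universe
  axiom as well: for any \<open>'v\<close>, take for \<open>'u\<close> a type whose cardinality is the successor
  of \<open>2 ^ max(|'v|, aleph_0)\<close>.
\<close>

definition universe :: "'v itself \<Rightarrow> 'u itself \<Rightarrow> bool" where
  "universe V U \<longleftrightarrow> natLeq <o |UNIV :: 'u set| \<and> regularCard |UNIV :: 'u set| \<and>
    (\<forall>(A :: 'u set) (B :: 'v set). small A \<longrightarrow> small B \<longrightarrow> |Func B A| <o |UNIV :: 'u set| )"

definition small_category :: "('v, 'v) category_data \<Rightarrow> bool" where
  "small_category J \<longleftrightarrow> category J \<and> small (Obj J) \<and>
    (\<forall>i\<in>Obj J. \<forall>j\<in>Obj J. small (Mor J i j))"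

definition small_complete :: "'v itself \<Rightarrow> ('o, 'a) category_data \<Rightarrow> bool" where
  "small_complete V C \<longleftrightarrow> category C \<and> (\<forall>(J :: ('v, 'v) category_data) Do Dm.
    small_category J \<and> diagram J C Do Dm \<longrightarrow> (\<exists>L \<pi>. is_limit J C Do Dm L \<pi>))"

definition small_cocomplete :: "'v itself \<Rightarrow> ('o, 'a) category_data \<Rightarrow> bool" where
  "small_cocomplete V C \<longleftrightarrow> category C \<and> (\<forall>(J :: ('v, 'v) category_data) Do Dm.
    small_category J \<and> diagram J C Do Dm \<longrightarrow> (\<exists>L \<iota>. is_colimit J C Do Dm L \<iota>))"


section \<open>Non-unital dg categories\<close>

definition linear_map ::
    "('k, 'r) ring_scheme \<Rightarrow> ('k, 'm, 'x) module_scheme \<Rightarrow> ('k, 'n, 'y) module_scheme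
      \<Rightarrow> ('m \<Rightarrow> 'n) \<Rightarrow> bool" where
  "linear_map K M N \<phi> \<longleftrightarrow> \<phi> \<in> carrier M \<rightarrow> carrier N \<and>
    (\<forall>x\<in>carrier M. \<forall>y\<in>carrier M. \<phi> (x \<oplus>\<^bsub>M\<^esub> y) = \<phi> x \<oplus>\<^bsub>N\<^esub> \<phi> y) \<and>
    (\<forall>a\<in>carrier K. \<forall>x\<in>carrier M. \<phi> (a \<odot>\<^bsub>M\<^esub> x) = a \<odot>\<^bsub>N\<^esub> \<phi> x)"

text \<open>\<open>sgn_mult M n x\<close> is \<open>(-1)^n x\<close>.\<close>

definition sgn_mult :: "('k, 'm, 'x) module_scheme \<Rightarrow> int \<Rightarrow> 'm \<Rightarrow> 'm" where
  "sgn_mult M n x = (if even n then x else \<ominus>\<^bsub>M\<^esub> x)"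

text \<open>
  A complex is given by its homogeneous components: \<open>dghom A X Y n\<close> is the vector space
  \<open>A(X,Y)^n\<close> (the multiplicative part of the record is irrelevant), \<open>dgdiff A X Y n\<close> is
  the differential \<open>A(X,Y)^n \<rightarrow> A(X,Y)^(n+1)\<close>, and \<open>dgcomp A X Y Z m n\<close> is the
  composition \<open>A(Y,Z)^m \<times> A(X,Y)^n \<rightarrow> A(X,Z)^(m+n)\<close>.
\<close>

record ('o, 'm, 'k) dg_data =
  dgobj :: "'o set"
  dghom :: "'o \<Rightarrow> 'o \<Rightarrow> int \<Rightarrow> ('k, 'm) module"
  dgdiff :: "'o \<Rightarrow> 'o \<Rightarrow> int \<Rightarrow> 'm \<Rightarrow> 'm"
  dgcomp :: "'o \<Rightarrow> 'o \<Rightarrow> 'o \<Rightarrow> int \<Rightarrow> int \<Rightarrow> 'm \<Rightarrow> 'm \<Rightarrow> 'm"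

locale nonunital_dg_category = field K
  for K :: "('k, 'r) ring_scheme" (structure) +
  fixes A :: "('o, 'm, 'k, 'z) dg_data_scheme"
  assumes hom_module: "\<lbrakk>X \<in> dgobj A; Y \<in> dgobj A\<rbrakk> \<Longrightarrow> module K (dghom A X Y n)"
    and diff_linear: "\<lbrakk>X \<in> dgobj A; Y \<in> dgobj A\<rbrakk>
      \<Longrightarrow> linear_map K (dghom A X Y n) (dghom A X Y (n + 1)) (dgdiff A X Y n)"
    and diff_diff: "\<lbrakk>X \<in> dgobj A; Y \<in> dgobj A; f \<in> carrier (dghom A X Y n)\<rbrakk>
      \<Longrightarrow> dgdiff A X Y (n + 1) (dgdiff A X Y n f) = \<zero>\<^bsub>dghom A X Y (n + 2)\<^esub>"
    and comp_linear_left: "\<lbrakk>X \<in> dgobj A; Y \<in> dgobj A; Z \<in> dgobj A; g \<in> carrier (dghom A X Y n)\<rbrakk>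
      \<Longrightarrow> linear_map K (dghom A Y Z m) (dghom A X Z (m + n)) (\<lambda>f. dgcomp A X Y Z m n f g)"
    and comp_linear_right: "\<lbrakk>X \<in> dgobj A; Y \<in> dgobj A; Z \<in> dgobj A; f \<in> carrier (dghom A Y Z m)\<rbrakk>
      \<Longrightarrow> linear_map K (dghom A X Y n) (dghom A X Z (m + n)) (\<lambda>g. dgcomp A X Y Z m n f g)"
    and comp_assoc: "\<lbrakk>W \<in> dgobj A; X \<in> dgobj A; Y \<in> dgobj A; Z \<in> dgobj A;
        f \<in> carrier (dghom A Y Z l); g \<in> carrier (dghom A X Y m); h \<in> carrier (dghom A W X n)\<rbrakk>
      \<Longrightarrow> dgcomp A W X Z (l + m) n (dgcomp A X Y Z l m f g) h
        = dgcomp A W Y Z l (m + n) f (dgcomp A W X Y m n g h)"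
    and leibniz: "\<lbrakk>X \<in> dgobj A; Y \<in> dgobj A; Z \<in> dgobj A;
        f \<in> carrier (dghom A Y Z m); g \<in> carrier (dghom A X Y n)\<rbrakk>
      \<Longrightarrow> dgdiff A X Z (m + n) (dgcomp A X Y Z m n f g)
        = dgcomp A X Y Z (m + 1) n (dgdiff A Y Z m f) g
          \<oplus>\<^bsub>dghom A X Z (m + n + 1)\<^esub>
          sgn_mult (dghom A X Z (m + n + 1)) m (dgcomp A X Y Z m (n + 1) f (dgdiff A X Y n g))"

text \<open>
  The dg category obtained from \<open>A\<close> by adjoining strict identities \<open>1\<^sub>X\<close>: the pair
  \<open>(f, c)\<close> stands for \<open>f + c 1\<^sub>X\<close>, where \<open>c = 0\<close> except in degree \<open>0\<close> of an endomorphism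
  complex.  The case distinctions in the composition are needed because \<open>c g\<close> lies in the
  target space only if the factor \<open>c 1\<^sub>Y\<close> is an endomorphism of degree \<open>0\<close>; otherwise
  \<open>c = 0\<close> and the term vanishes.
\<close>

definition aug_hom ::
    "('k, 'r) ring_scheme \<Rightarrow> ('o, 'm, 'k, 'z) dg_data_scheme \<Rightarrow> 'o \<Rightarrow> 'o \<Rightarrow> int
      \<Rightarrow> ('k, 'm \<times> 'k) module" where
  "aug_hom K A X Y n = (let M = dghom A X Y n in
    \<lparr>carrier = {(f, c). f \<in> carrier M \<and> c \<in> carrier K \<and> (X = Y \<and> n = 0 \<or> c = \<zero>\<^bsub>K\<^esub>)},
     mult = undefined, one = undefined,
     zero = (\<zero>\<^bsub>M\<^esub>, \<zero>\<^bsub>K\<^esub>),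
     add = (\<lambda>(f, c) (g, e). (f \<oplus>\<^bsub>M\<^esub> g, c \<oplus>\<^bsub>K\<^esub> e)),
     smult = (\<lambda>a (f, c). (a \<odot>\<^bsub>M\<^esub> f, a \<otimes>\<^bsub>K\<^esub> c))\<rparr>)"

definition augment ::
    "('k, 'r) ring_scheme \<Rightarrow> ('o, 'm, 'k, 'z) dg_data_scheme \<Rightarrow> ('o, 'm \<times> 'k, 'k) dg_data" where
  "augment K A =
    \<lparr>dgobj = dgobj A,
     dghom = aug_hom K A,
     dgdiff = (\<lambda>X Y n (f, c). (dgdiff A X Y n f, \<zero>\<^bsub>K\<^esub>)),
     dgcomp = (\<lambda>X Y Z m n (f, c) (g, e). let M = dghom A X Z (m + n) in
       (dgcomp A X Y Z m n f g
          \<oplus>\<^bsub>M\<^esub> (if Y = Z \<and> m = 0 then c \<odot>\<^bsub>M\<^esub> g else \<zero>\<^bsub>M\<^esub>)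
          \<oplus>\<^bsub>M\<^esub> (if X = Y \<and> n = 0 then e \<odot>\<^bsub>M\<^esub> f else \<zero>\<^bsub>M\<^esub>),
        c \<otimes>\<^bsub>K\<^esub> e))\<rparr>"


section \<open>\<open>A\<^sub>\<infinity>\<close> functors between dg categories\<close>

text \<open>
  \<open>composable B Xs ds fs\<close>: the lists \<open>Xs = [X\<^sub>0, \<dots>, X\<^sub>n]\<close>, \<open>ds = [d\<^sub>1, \<dots>, d\<^sub>n]\<close>,
  \<open>fs = [f\<^sub>1, \<dots>, f\<^sub>n]\<close> describe a string of \<open>n \<ge> 1\<close> composable morphisms
  \<open>f\<^sub>i \<in> B(X\<^sub>i, X\<^bsub>i-1\<^esub>)\<close> of degree \<open>d\<^sub>i\<close>, with composite \<open>f\<^sub>1 \<circ> \<dots> \<circ> f\<^sub>n \<in> B(X\<^sub>n, X\<^sub>0)\<close>.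
  (List positions start at \<open>0\<close>, so \<open>f\<^sub>i\<close> is \<open>fs ! (i - 1)\<close>.)
\<close>

definition composable ::
    "('o, 'm, 'k, 'z) dg_data_scheme \<Rightarrow> 'o list \<Rightarrow> int list \<Rightarrow> 'm list \<Rightarrow> bool" where
  "composable B Xs ds fs \<longleftrightarrow> fs \<noteq> [] \<and> length Xs = Suc (length fs) \<and> length ds = length fs \<and>
    set Xs \<subseteq> dgobj B \<and>
    (\<forall>i<length fs. fs ! i \<in> carrier (dghom B (Xs ! Suc i) (Xs ! i) (ds ! i)))"

text \<open>
  The components of an \<open>A\<^sub>\<infinity>\<close> functor are \<open>F\<^sub>n(f\<^sub>1, \<dots>, f\<^sub>n) = Fm Xs ds fs\<close>.  They are
  multilinear of degree \<open>1 - n\<close> and satisfy, for each \<open>n \<ge> 1\<close>,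

    \<open>\<Sum>\<^bsub>r+1+t=n\<^esub> (-1)^(r+t) F\<^sub>n (1^r \<otimes> d \<otimes> 1^t) + \<Sum>\<^bsub>r+2+t=n\<^esub> (-1)^r F\<^bsub>n-1\<^esub> (1^r \<otimes> m \<otimes> 1^t)
       = d F\<^sub>n + \<Sum>\<^bsub>i+j=n\<^esub> (-1)^(i-1) m (F\<^sub>i \<otimes> F\<^sub>j)\<close>

  with \<open>m\<close> the composition.  This is the usual relation, in Keller's sign convention,
  specialised to vanishing higher products.  Evaluating it on elements introduces Koszul
  signs, since \<open>d\<close> (of degree \<open>1\<close>) and \<open>F\<^sub>j\<close> (of degree \<open>1 - j\<close>) move past the arguments on
  their left.
\<close>

locale a_inf_functor =
  B: nonunital_dg_category K B + A: nonunital_dg_category K A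
  for K :: "('k, 'r) ring_scheme" (structure)
    and B :: "('p, 'n, 'k, 'y) dg_data_scheme" and A :: "('o, 'm, 'k, 'z) dg_data_scheme" +
  fixes Fo :: "'p \<Rightarrow> 'o" and Fm :: "'p list \<Rightarrow> int list \<Rightarrow> 'n list \<Rightarrow> 'm"
  assumes Fo_in: "X \<in> dgobj B \<Longrightarrow> Fo X \<in> dgobj A"
    and Fm_multilinear: "\<lbrakk>composable B Xs ds fs; i < length fs\<rbrakk> \<Longrightarrow>
      linear_map K (dghom B (Xs ! Suc i) (Xs ! i) (ds ! i))
        (dghom A (Fo (last Xs)) (Fo (hd Xs)) (sum_list ds + 1 - int (length fs)))
        (\<lambda>v. Fm Xs ds (fs[i := v]))"
    and Fm_relation: "\<lbrakk>composable B Xs ds fs; n = length fs;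
        M = dghom A (Fo (last Xs)) (Fo (hd Xs)) (sum_list ds + 2 - int n)\<rbrakk> \<Longrightarrow>
      (\<Oplus>\<^bsub>M\<^esub> i\<in>{..<n}. sgn_mult M (int (n - 1) + sum_list (take i ds))
          (Fm Xs (ds[i := ds ! i + 1])
            (fs[i := dgdiff B (Xs ! Suc i) (Xs ! i) (ds ! i) (fs ! i)])))
      \<oplus>\<^bsub>M\<^esub>
      (\<Oplus>\<^bsub>M\<^esub> i\<in>{..<n - 1}. sgn_mult M (int i)
          (Fm (take (Suc i) Xs @ drop (i + 2) Xs)
            (take i ds @ (ds ! i + ds ! Suc i) # drop (i + 2) ds)
            (take i fs
              @ dgcomp B (Xs ! (i + 2)) (Xs ! Suc i) (Xs ! i) (ds ! i) (ds ! Suc i)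
                  (fs ! i) (fs ! Suc i)
              # drop (i + 2) fs)))
      = dgdiff A (Fo (last Xs)) (Fo (hd Xs)) (sum_list ds + 1 - int n) (Fm Xs ds fs)
      \<oplus>\<^bsub>M\<^esub>
      (\<Oplus>\<^bsub>M\<^esub> i\<in>{1..<n}.
          sgn_mult M (int (i - 1) + (1 - int (n - i)) * sum_list (take i ds))
          (dgcomp A (Fo (last Xs)) (Fo (Xs ! i)) (Fo (hd Xs))
            (sum_list (take i ds) + 1 - int i) (sum_list (drop i ds) + 1 - int (n - i))
            (Fm (take (Suc i) Xs) (take i ds) (take i fs))
            (Fm (drop i Xs) (drop i ds) (drop i fs))))"


section \<open>Weakly unital dg categories\<close>

record ('o, 'm, 'k) wudg_data = "('o, 'm, 'k) dg_data" +
  wuid :: "'o \<Rightarrow> 'm"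
  wup :: "'o list \<Rightarrow> int list \<Rightarrow> ('m \<times> 'k) list \<Rightarrow> 'm"

locale weakly_unital_dg_category = nonunital_dg_category K A
  for K :: "('k, 'r) ring_scheme" (structure) and A :: "('o, 'm, 'k) wudg_data" +
  assumes id_in: "X \<in> dgobj A \<Longrightarrow> wuid A X \<in> carrier (dghom A X X 0)"
    and diff_id: "X \<in> dgobj A \<Longrightarrow> dgdiff A X X 0 (wuid A X) = \<zero>\<^bsub>dghom A X X 1\<^esub>"
    and id_id: "X \<in> dgobj A \<Longrightarrow> dgcomp A X X X 0 0 (wuid A X) (wuid A X) = wuid A X"
    and p_a_inf_functor: "a_inf_functor K (augment K A) A (\<lambda>X. X) (wup A)"
    and p_incl_1: "\<lbrakk>X \<in> dgobj A; Y \<in> dgobj A; f \<in> carrier (dghom A X Y n)\<rbrakk>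
      \<Longrightarrow> wup A [Y, X] [n] [(f, \<zero>)] = f"
    and p_incl: "\<lbrakk>composable A Xs ds fs; 2 \<le> length fs\<rbrakk>
      \<Longrightarrow> wup A Xs ds (map (\<lambda>f. (f, \<zero>)) fs)
        = \<zero>\<^bsub>dghom A (last Xs) (hd Xs) (sum_list ds + 1 - int (length fs))\<^esub>"
    and p_one_1: "X \<in> dgobj A \<Longrightarrow> wup A [X, X] [0] [(\<zero>\<^bsub>dghom A X X 0\<^esub>, \<one>)] = wuid A X"
    and p_one: "\<lbrakk>X \<in> dgobj A; 2 \<le> r\<rbrakk>
      \<Longrightarrow> wup A (replicate (Suc r) X) (replicate r 0) (replicate r (\<zero>\<^bsub>dghom A X X 0\<^esub>, \<one>))
        = \<zero>\<^bsub>dghom A X X (1 - int r)\<^esub>"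

text \<open>
  A functor \<open>F\<close> is the pair of its object map and its maps \<open>C(X,Y)^n \<rightarrow> D(F X, F Y)^n\<close>.
  Both are required to be \<open>undefined\<close> outside their domains, so that equality of functors
  is equality in HOL.
\<close>

type_synonym ('o, 'm) dg_fun = "('o \<Rightarrow> 'o) \<times> ('o \<Rightarrow> 'o \<Rightarrow> int \<Rightarrow> 'm \<Rightarrow> 'm)"

definition dg_fun_restrict ::
    "('o, 'm, 'k, 'z) dg_data_scheme \<Rightarrow> ('o, 'm) dg_fun \<Rightarrow> ('o, 'm) dg_fun" where
  "dg_fun_restrict C F = (restrict (fst F) (dgobj C),
    \<lambda>X Y n f. if X \<in> dgobj C \<and> Y \<in> dgobj C \<and> f \<in> carrier (dghom C X Y n)
      then snd F X Y n f else undefined)"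

locale weakly_unital_dg_functor =
  C: weakly_unital_dg_category K C + D: weakly_unital_dg_category K D
  for K :: "('k, 'r) ring_scheme" (structure)
    and C :: "('o, 'm, 'k) wudg_data" and D :: "('o, 'm, 'k) wudg_data" +
  fixes F :: "('o, 'm) dg_fun"
  assumes F_restrict: "dg_fun_restrict C F = F"
    and F_obj: "X \<in> dgobj C \<Longrightarrow> fst F X \<in> dgobj D"
    and F_linear: "\<lbrakk>X \<in> dgobj C; Y \<in> dgobj C\<rbrakk>
      \<Longrightarrow> linear_map K (dghom C X Y n) (dghom D (fst F X) (fst F Y) n) (snd F X Y n)"
    and F_diff: "\<lbrakk>X \<in> dgobj C; Y \<in> dgobj C; f \<in> carrier (dghom C X Y n)\<rbrakk>
      \<Longrightarrow> snd F X Y (n + 1) (dgdiff C X Y n f) = dgdiff D (fst F X) (fst F Y) n (snd F X Y n f)"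
    and F_comp: "\<lbrakk>X \<in> dgobj C; Y \<in> dgobj C; Z \<in> dgobj C;
        f \<in> carrier (dghom C Y Z m); g \<in> carrier (dghom C X Y n)\<rbrakk>
      \<Longrightarrow> snd F X Z (m + n) (dgcomp C X Y Z m n f g)
        = dgcomp D (fst F X) (fst F Y) (fst F Z) m n (snd F Y Z m f) (snd F X Y n g)"
    and F_p: "composable (augment K C) Xs ds fs
      \<Longrightarrow> snd F (last Xs) (hd Xs) (sum_list ds + 1 - int (length fs)) (wup C Xs ds fs)
        = wup D (map (fst F) Xs) ds
            (map (\<lambda>i. map_prod (snd F (Xs ! Suc i) (Xs ! i) (ds ! i)) id (fs ! i))
              [0..<length fs])"

definition small_wudg :: "('u, 'u, 'k) wudg_data \<Rightarrow> bool" where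
  "small_wudg A \<longleftrightarrow> small (dgobj A) \<and>
    (\<forall>X\<in>dgobj A. \<forall>Y\<in>dgobj A. \<forall>n. small (carrier (dghom A X Y n)))"

definition Cat_dgwu ::
    "('k, 'r) ring_scheme \<Rightarrow> (('u, 'u, 'k) wudg_data, ('u, 'u) dg_fun) category_data" where
  "Cat_dgwu K =
    \<lparr>Obj = {A. weakly_unital_dg_category K A \<and> small_wudg A},
     Mor = (\<lambda>A B. {F. weakly_unital_dg_functor K A B F}),
     Id = (\<lambda>A. dg_fun_restrict A (\<lambda>X. X, \<lambda>X Y n f. f)),
     Comp = (\<lambda>A B C G F. dg_fun_restrict A
       (\<lambda>X. fst G (fst F X),
        \<lambda>X Y n f. snd G (fst F X) (fst F Y) n (snd F X Y n f)))\<rparr>"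

end

(*
  Every axiom of a weakly unital dg category is an identity between operations, so a subset of a
  product of weakly unital dg categories that is closed under all operations is again one, because
  the projections are jointly faithful.  The limit of a diagram is the set of compatible families
  in the product of its vertices.  The colimit is the substructure generated by the images of the
  vertices in the product of all cocones: the index set of this product is not small, but the
  substructure is, since it is generated by a small set under finitary operations.  Both are
  transported to the universe type along injections.
*)

theory Submission
  imports Defs "HOL-Library.Countable_Set"
begin

text \<open>The delicate operation is \<open>wup\<close>: its arguments live in the augmented
  category, whose composition asks whether two objects coincide. A functor may identify distinct
  objects, so the case distinctions on the two sides of a preservation law can differ; they are
  reconciled by the scalar being zero wherever they do. The A-infinity relation contains finite sums
  and signs, which behave well only in modules. The axioms are therefore reflected in stages: module
  laws, dg laws, then the relation and the unit laws. The full product is never made an object,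
  since it need not be small; only chosen sets of families occur. Quantifying over all cocones
  replaces an explicit construction by coproducts and quotients. This is possible because all
  vertices have the same type, so the cocones form a set, and each cocone factors through its own
  coordinate. Generation by the vertices then gives uniqueness as well as smallness.\<close>

lemma linear_mapD:
  assumes "linear_map K M N \<phi>"
  shows "x \<in> carrier M \<Longrightarrow> \<phi> x \<in> carrier N"
    and "\<lbrakk>x \<in> carrier M; y \<in> carrier M\<rbrakk> \<Longrightarrow> \<phi> (x \<oplus>\<^bsub>M\<^esub> y) = \<phi> x \<oplus>\<^bsub>N\<^esub> \<phi> y"
    and "\<lbrakk>a \<in> carrier K; x \<in> carrier M\<rbrakk> \<Longrightarrow> \<phi> (a \<odot>\<^bsub>M\<^esub> x) = a \<odot>\<^bsub>N\<^esub> \<phi> x"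
  using assms by (auto simp: linear_map_def)

text \<open>The definition of \<open>linear_map\<close> does not mention zero; it is reached as the
  multiple of zero by the scalar zero.\<close>

lemma linear_map_zero:
  assumes "module K M" "module K N" "linear_map K M N \<phi>"
  shows "\<phi> \<zero>\<^bsub>M\<^esub> = \<zero>\<^bsub>N\<^esub>"
proof -
  interpret M: module K M by fact
  interpret N: module K N by fact
  have "\<phi> (\<zero>\<^bsub>K\<^esub> \<odot>\<^bsub>M\<^esub> \<zero>\<^bsub>M\<^esub>) = \<zero>\<^bsub>K\<^esub> \<odot>\<^bsub>N\<^esub> \<phi> \<zero>\<^bsub>M\<^esub>"
    by (rule linear_mapD(3)[OF assms(3)]) auto
  then show ?thesis
    using linear_mapD(1)[OF assms(3), of "\<zero>\<^bsub>M\<^esub>"] by simp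
qed

lemma linear_map_a_inv:
  assumes "module K M" "module K N" "linear_map K M N \<phi>" "x \<in> carrier M"
  shows "\<phi> (\<ominus>\<^bsub>M\<^esub> x) = \<ominus>\<^bsub>N\<^esub> \<phi> x"
proof -
  interpret M: module K M by fact
  interpret N: module K N by fact
  note \<phi> = linear_mapD[OF assms(3)]
  have "\<phi> (\<ominus>\<^bsub>M\<^esub> x) \<oplus>\<^bsub>N\<^esub> \<phi> x = \<phi> (\<ominus>\<^bsub>M\<^esub> x \<oplus>\<^bsub>M\<^esub> x)"
    using assms(4) by (simp add: \<phi>)
  also have "\<dots> = \<zero>\<^bsub>N\<^esub>"
    using assms(4) linear_map_zero[OF assms(1-3)] by (simp add: M.l_neg)
  finally show ?thesis
    using assms(4) \<phi>(1) by (metis M.a_inv_closed N.minus_equality)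
qed

lemma linear_map_sgn_mult:
  assumes "module K M" "module K N" "linear_map K M N \<phi>" "x \<in> carrier M"
  shows "\<phi> (sgn_mult M n x) = sgn_mult N n (\<phi> x)"
  using linear_map_a_inv[OF assms] by (simp add: sgn_mult_def)

lemma linear_map_finsum:
  assumes "module K M" "module K N" "linear_map K M N \<phi>" "finite S" "g \<in> S \<rightarrow> carrier M"
  shows "\<phi> (finsum M g S) = finsum N (\<lambda>s. \<phi> (g s)) S"
proof -
  interpret M: module K M by fact
  interpret N: module K N by fact
  note \<phi> = linear_mapD[OF assms(3)]
  from assms(4,5) show ?thesis
  proof (induction S)
    case empty
    then show ?case using linear_map_zero[OF assms(1-3)] by simp
  next
    case (insert s S)
    then have "(\<lambda>s. \<phi> (g s)) \<in> S \<rightarrow> carrier N" "\<phi> (g s) \<in> carrier N" "finsum M g S \<in> carrier M"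
      using \<phi>(1) by (auto intro: M.finsum_closed)
    with insert show ?case
      by (auto simp: M.finsum_insert N.finsum_insert \<phi>(2))
  qed
qed

lemma (in module) sgn_mult_closed:
  "x \<in> carrier M \<Longrightarrow> sgn_mult M n x \<in> carrier M"
  by (simp add: sgn_mult_def)

section \<open>Adjoining strict identities\<close>

lemma aug_hom_simps:
  "(f, c) \<in> carrier (aug_hom K A X Y n) \<longleftrightarrow>
    f \<in> carrier (dghom A X Y n) \<and> c \<in> carrier K \<and> (X = Y \<and> n = 0 \<or> c = \<zero>\<^bsub>K\<^esub>)"
  "\<zero>\<^bsub>aug_hom K A X Y n\<^esub> = (\<zero>\<^bsub>dghom A X Y n\<^esub>, \<zero>\<^bsub>K\<^esub>)"
  "(f, c) \<oplus>\<^bsub>aug_hom K A X Y n\<^esub> (g, e) = (f \<oplus>\<^bsub>dghom A X Y n\<^esub> g, c \<oplus>\<^bsub>K\<^esub> e)"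
  "a \<odot>\<^bsub>aug_hom K A X Y n\<^esub> (f, c) = (a \<odot>\<^bsub>dghom A X Y n\<^esub> f, a \<otimes>\<^bsub>K\<^esub> c)"
  by (simp_all add: aug_hom_def Let_def)

text \<open>
  In the composition of the augmented category, the scalar \<open>c\<close> vanishes whenever the condition
  \<open>P\<close> fails, and the value \<open>c x\<close> is well-typed only if \<open>P\<close> holds.  The lemmas on \<open>cond_smult\<close>
  confine these case distinctions.
\<close>

definition cond_smult ::
    "('k, 'm, 'x) module_scheme \<Rightarrow> bool \<Rightarrow> 'k \<Rightarrow> 'm \<Rightarrow> 'm" where
  "cond_smult M P c x = (if P then c \<odot>\<^bsub>M\<^esub> x else \<zero>\<^bsub>M\<^esub>)"

lemma cond_smult_closed:
  assumes "module K M" "c \<in> carrier K" "P \<Longrightarrow> x \<in> carrier M"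
  shows "cond_smult M P c x \<in> carrier M"
proof -
  interpret module K M by fact
  show ?thesis using assms(2,3) by (simp add: cond_smult_def)
qed

text \<open>The space \<open>N\<close> is unrelated to \<open>M\<close> unless \<open>P\<close>
  holds: where \<open>P\<close> fails the map is constantly zero and hence linear from any
  \<open>N\<close>. A factor of a composite usually lives in another hom space than the composite,
  and this form covers both situations.\<close>

lemma cond_smult_linear:
  assumes "module K M" "c \<in> carrier K" "P \<Longrightarrow> N = M"
  shows "linear_map K N M (cond_smult M P c)"
proof -
  interpret module K M by fact
  have "c \<odot>\<^bsub>M\<^esub> (a \<odot>\<^bsub>M\<^esub> x) = a \<odot>\<^bsub>M\<^esub> (c \<odot>\<^bsub>M\<^esub> x)"
    if "a \<in> carrier K" "x \<in> carrier M" for a x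
    using that assms(2) by (metis smult_assoc1 R.m_comm)
  then show ?thesis
    using assms(2,3) by (auto simp: linear_map_def cond_smult_def smult_r_distr)
qed

lemma cond_smult_scalar:
  assumes "module K M" "P \<Longrightarrow> x \<in> carrier M" "a \<in> carrier K" "b \<in> carrier K"
  shows "cond_smult M P (a \<oplus>\<^bsub>K\<^esub> b) x = cond_smult M P a x \<oplus>\<^bsub>M\<^esub> cond_smult M P b x"
    and "cond_smult M P (a \<otimes>\<^bsub>K\<^esub> b) x = a \<odot>\<^bsub>M\<^esub> cond_smult M P b x"
proof -
  interpret module K M by fact
  show "cond_smult M P (a \<oplus>\<^bsub>K\<^esub> b) x = cond_smult M P a x \<oplus>\<^bsub>M\<^esub> cond_smult M P b x"
    "cond_smult M P (a \<otimes>\<^bsub>K\<^esub> b) x = a \<odot>\<^bsub>M\<^esub> cond_smult M P b x"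
    using assms(2-4) by (simp_all add: cond_smult_def smult_l_distr smult_assoc1)
qed

lemma augment_simps:
  "dgobj (augment K A) = dgobj A"
  "dghom (augment K A) = aug_hom K A"
  "dgdiff (augment K A) X Y n (f, c) = (dgdiff A X Y n f, \<zero>\<^bsub>K\<^esub>)"
  "dgcomp (augment K A) X Y Z m n (f, c) (g, e) =
    (dgcomp A X Y Z m n f g
      \<oplus>\<^bsub>dghom A X Z (m + n)\<^esub> cond_smult (dghom A X Z (m + n)) (Y = Z \<and> m = 0) c g
      \<oplus>\<^bsub>dghom A X Z (m + n)\<^esub> cond_smult (dghom A X Z (m + n)) (X = Y \<and> n = 0) e f,
     c \<otimes>\<^bsub>K\<^esub> e)"
  by (simp_all add: augment_def Let_def cond_smult_def)

lemma aug_hom_module: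
  assumes "module K (dghom A X Y n)"
  shows "module K (aug_hom K A X Y n)"
proof -
  let ?M = "dghom A X Y n"
  interpret M: module K ?M by fact
  show ?thesis
  proof (rule moduleI)
    show "cring K" by (rule M.R.is_cring)
    show "abelian_group (aug_hom K A X Y n)"
    proof (rule abelian_groupI)
      fix x assume "x \<in> carrier (aug_hom K A X Y n)"
      then show "\<exists>y\<in>carrier (aug_hom K A X Y n).
          y \<oplus>\<^bsub>aug_hom K A X Y n\<^esub> x = \<zero>\<^bsub>aug_hom K A X Y n\<^esub>"
        \<comment> \<open>The componentwise negative respects the constraint on the scalar, because
          the negative of zero is zero.\<close>
        by (cases x; intro bexI[of _ "(\<ominus>\<^bsub>?M\<^esub> fst x, \<ominus>\<^bsub>K\<^esub> snd x)"])
          (auto simp: aug_hom_simps M.l_neg M.R.l_neg)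
    qed (auto simp: aug_hom_simps M.a_ac M.R.a_ac)
  qed (auto simp: aug_hom_simps M.smult_l_distr M.smult_r_distr M.smult_assoc1
        M.R.l_distr M.R.r_distr M.R.m_assoc)
qed

lemma aug_hom_a_inv:
  assumes "module K (dghom A X Y n)" "(f, c) \<in> carrier (aug_hom K A X Y n)"
  shows "\<ominus>\<^bsub>aug_hom K A X Y n\<^esub> (f, c) = (\<ominus>\<^bsub>dghom A X Y n\<^esub> f, \<ominus>\<^bsub>K\<^esub> c)"
proof -
  interpret M: module K "dghom A X Y n" by fact
  interpret H: module K "aug_hom K A X Y n" by (rule aug_hom_module) fact
  show ?thesis
    by (rule H.minus_equality)
      (use assms(2) in \<open>auto simp: aug_hom_simps M.l_neg M.R.l_neg\<close>)
qed

text \<open>Scalar part zero is the case that occurs: in the Leibniz rule the sign stands before a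
  product with a differential, and differentials have scalar part zero.\<close>

lemma aug_hom_sgn_mult:
  assumes "module K (dghom A X Y n)" "(f, \<zero>\<^bsub>K\<^esub>) \<in> carrier (aug_hom K A X Y n)"
  shows "sgn_mult (aug_hom K A X Y n) k (f, \<zero>\<^bsub>K\<^esub>) = (sgn_mult (dghom A X Y n) k f, \<zero>\<^bsub>K\<^esub>)"
proof -
  interpret M: module K "dghom A X Y n" by fact
  show ?thesis by (simp add: sgn_mult_def aug_hom_a_inv[OF assms])
qed

section \<open>Bilinearity of composition and the dg axioms of the augmented category\<close>

context nonunital_dg_category
begin

lemma diff_closed:
  "\<lbrakk>X \<in> dgobj A; Y \<in> dgobj A; f \<in> carrier (dghom A X Y n)\<rbrakk>
    \<Longrightarrow> dgdiff A X Y n f \<in> carrier (dghom A X Y (n + 1))"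
  by (rule linear_mapD(1)[OF diff_linear])

lemma comp_closed:
  "\<lbrakk>X \<in> dgobj A; Y \<in> dgobj A; Z \<in> dgobj A;
    f \<in> carrier (dghom A Y Z m); g \<in> carrier (dghom A X Y n)\<rbrakk>
    \<Longrightarrow> dgcomp A X Y Z m n f g \<in> carrier (dghom A X Z (m + n))"
  by (rule linear_mapD(1)[OF comp_linear_left])

text \<open>Hom spaces are indexed by degrees, and a result in degree \<open>m + n\<close> is often
  needed in a degree written differently. The variants with suffix \<open>_eq\<close> leave that
  equation as a premise.\<close>

lemma comp_closed_eq:
  "\<lbrakk>X \<in> dgobj A; Y \<in> dgobj A; Z \<in> dgobj A;
    f \<in> carrier (dghom A Y Z m); g \<in> carrier (dghom A X Y n); m + n = k\<rbrakk>
    \<Longrightarrow> dgcomp A X Y Z m n f g \<in> carrier (dghom A X Z k)"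
  using comp_closed by blast

lemma diff_closed_eq:
  "\<lbrakk>X \<in> dgobj A; Y \<in> dgobj A; f \<in> carrier (dghom A X Y n); n + 1 = k\<rbrakk>
    \<Longrightarrow> dgdiff A X Y n f \<in> carrier (dghom A X Y k)"
  using diff_closed by blast

lemma comp_bilinear:
  assumes "X \<in> dgobj A" "Y \<in> dgobj A" "Z \<in> dgobj A"
  shows "\<lbrakk>f \<in> carrier (dghom A Y Z m); f' \<in> carrier (dghom A Y Z m);
      g \<in> carrier (dghom A X Y n)\<rbrakk>
      \<Longrightarrow> dgcomp A X Y Z m n (f \<oplus>\<^bsub>dghom A Y Z m\<^esub> f') g
        = dgcomp A X Y Z m n f g \<oplus>\<^bsub>dghom A X Z (m + n)\<^esub> dgcomp A X Y Z m n f' g"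
    and "\<lbrakk>f \<in> carrier (dghom A Y Z m); g \<in> carrier (dghom A X Y n);
      g' \<in> carrier (dghom A X Y n)\<rbrakk>
      \<Longrightarrow> dgcomp A X Y Z m n f (g \<oplus>\<^bsub>dghom A X Y n\<^esub> g')
        = dgcomp A X Y Z m n f g \<oplus>\<^bsub>dghom A X Z (m + n)\<^esub> dgcomp A X Y Z m n f g'"
    and "\<lbrakk>a \<in> carrier K; f \<in> carrier (dghom A Y Z m); g \<in> carrier (dghom A X Y n)\<rbrakk>
      \<Longrightarrow> dgcomp A X Y Z m n (a \<odot>\<^bsub>dghom A Y Z m\<^esub> f) g
        = a \<odot>\<^bsub>dghom A X Z (m + n)\<^esub> dgcomp A X Y Z m n f g"
    and "\<lbrakk>a \<in> carrier K; f \<in> carrier (dghom A Y Z m); g \<in> carrier (dghom A X Y n)\<rbrakk>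
      \<Longrightarrow> dgcomp A X Y Z m n f (a \<odot>\<^bsub>dghom A X Y n\<^esub> g)
        = a \<odot>\<^bsub>dghom A X Z (m + n)\<^esub> dgcomp A X Y Z m n f g"
    and "f \<in> carrier (dghom A Y Z m)
      \<Longrightarrow> dgcomp A X Y Z m n f \<zero>\<^bsub>dghom A X Y n\<^esub> = \<zero>\<^bsub>dghom A X Z (m + n)\<^esub>"
    and "g \<in> carrier (dghom A X Y n)
      \<Longrightarrow> dgcomp A X Y Z m n \<zero>\<^bsub>dghom A Y Z m\<^esub> g = \<zero>\<^bsub>dghom A X Z (m + n)\<^esub>"
  using linear_mapD[OF comp_linear_left[OF assms]] linear_mapD[OF comp_linear_right[OF assms]]
    linear_map_zero[OF hom_module hom_module comp_linear_left] assms
    linear_map_zero[OF hom_module hom_module comp_linear_right]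
  by simp_all

lemma diff_simps:
  assumes "X \<in> dgobj A" "Y \<in> dgobj A"
  shows "\<lbrakk>f \<in> carrier (dghom A X Y n); g \<in> carrier (dghom A X Y n)\<rbrakk>
      \<Longrightarrow> dgdiff A X Y n (f \<oplus>\<^bsub>dghom A X Y n\<^esub> g)
        = dgdiff A X Y n f \<oplus>\<^bsub>dghom A X Y (n + 1)\<^esub> dgdiff A X Y n g"
    and "\<lbrakk>a \<in> carrier K; f \<in> carrier (dghom A X Y n)\<rbrakk>
      \<Longrightarrow> dgdiff A X Y n (a \<odot>\<^bsub>dghom A X Y n\<^esub> f) = a \<odot>\<^bsub>dghom A X Y (n + 1)\<^esub> dgdiff A X Y n f"
    and "dgdiff A X Y n \<zero>\<^bsub>dghom A X Y n\<^esub> = \<zero>\<^bsub>dghom A X Y (n + 1)\<^esub>"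
  using linear_mapD[OF diff_linear[OF assms]]
    linear_map_zero[OF hom_module hom_module diff_linear] assms
  by simp_all

lemma hom_abelian_group:
  "\<lbrakk>X \<in> dgobj A; Y \<in> dgobj A\<rbrakk> \<Longrightarrow> abelian_group (dghom A X Y n)"
  by (rule module.axioms(2)[OF hom_module])

lemma hom_abelian_monoid:
  "\<lbrakk>X \<in> dgobj A; Y \<in> dgobj A\<rbrakk> \<Longrightarrow> abelian_monoid (dghom A X Y n)"
  by (rule abelian_group.axioms(1)[OF hom_abelian_group])

lemma hom_smult_lcomm:
  assumes "X \<in> dgobj A" "Y \<in> dgobj A" "a \<in> carrier K" "b \<in> carrier K" "f \<in> carrier (dghom A X Y n)"
  shows "a \<odot>\<^bsub>dghom A X Y n\<^esub> (b \<odot>\<^bsub>dghom A X Y n\<^esub> f)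
    = b \<odot>\<^bsub>dghom A X Y n\<^esub> (a \<odot>\<^bsub>dghom A X Y n\<^esub> f)"
  using module.smult_assoc1[OF hom_module] assms m_comm by metis

lemmas hom_simps =
  abelian_monoid.zero_closed[OF hom_abelian_monoid]
  abelian_monoid.a_closed[OF hom_abelian_monoid]
  abelian_group.a_inv_closed[OF hom_abelian_group]
  abelian_group.minus_add[OF hom_abelian_group]
  abelian_monoid.l_zero[OF hom_abelian_monoid]
  abelian_monoid.r_zero[OF hom_abelian_monoid]
  abelian_monoid.a_assoc[OF hom_abelian_monoid]
  abelian_monoid.a_lcomm[OF hom_abelian_monoid]
  abelian_monoid.a_comm[OF hom_abelian_monoid]
  module.smult_closed[OF hom_module]
  module.smult_r_distr[OF hom_module]
  module.smult_l_distr[OF hom_module]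
  module.smult_assoc1[OF hom_module]
  module.smult_l_null[OF hom_module]
  module.smult_r_null[OF hom_module]
  hom_smult_lcomm

text \<open>Expanding \<open>(f + c 1)(g + e 1)(h + k 1)\<close> with either bracketing gives seven
  morphism terms and the scalar \<open>c e k\<close>. One auxiliary fact below matches each of them;
  the rest is additivity and reordering of sums.\<close>

lemma augment_comp_assoc:
  assumes o: "W \<in> dgobj A" "X \<in> dgobj A" "Y \<in> dgobj A" "Z \<in> dgobj A"
    and u: "u \<in> carrier (aug_hom K A Y Z l)" and v: "v \<in> carrier (aug_hom K A X Y m)"
    and w: "w \<in> carrier (aug_hom K A W X n)"
  shows "dgcomp (augment K A) W X Z (l + m) n (dgcomp (augment K A) X Y Z l m u v) w
    = dgcomp (augment K A) W Y Z l (m + n) u (dgcomp (augment K A) W X Y m n v w)"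
proof -
  obtain f c g e h k where eq: "u = (f, c)" "v = (g, e)" "w = (h, k)"
    by (metis surj_pair)
  have f: "f \<in> carrier (dghom A Y Z l)" and g: "g \<in> carrier (dghom A X Y m)"
    and h: "h \<in> carrier (dghom A W X n)"
    and cK: "c \<in> carrier K" "e \<in> carrier K" "k \<in> carrier K"
    and c: "Y = Z \<and> l = 0 \<or> c = \<zero>" and e: "X = Y \<and> m = 0 \<or> e = \<zero>"
    and k: "W = X \<and> n = 0 \<or> k = \<zero>"
    using u v w by (auto simp: eq aug_hom_simps)
  let ?P = "Y = Z \<and> l = 0" and ?Q = "X = Y \<and> m = 0" and ?R = "W = X \<and> n = 0"
  let ?WZ = "dghom A W Z (l + (m + n))" and ?WY = "dghom A W Y (m + n)"
    and ?XZ = "dghom A X Z (l + m)"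
  interpret WZ: module K ?WZ using hom_module o by simp
  interpret WY: module K ?WY using hom_module o by simp
  interpret XZ: module K ?XZ using hom_module o by simp
  have lmn: "l + (m + n) = n" if "l + m = 0" using that by simp
  \<comment> \<open>The guards differ: on the left only the composite of the two units must be an
    endomorphism of degree 0, on the right each unit separately. If the left guard holds without the
    right one, then \<open>c\<close> or \<open>e\<close> is zero.\<close>
  have ce_h: "cond_smult ?WZ (X = Z \<and> l + m = 0) (c \<otimes> e) h
      = cond_smult ?WZ ?P c (cond_smult ?WY ?Q e h)"
    using c e h cK o by (auto simp: cond_smult_def hom_simps lmn)
  have ek_f: "cond_smult ?WZ (W = Y \<and> m + n = 0) (e \<otimes> k) f
      = cond_smult ?WZ ?R k (cond_smult ?XZ ?Q e f)"
    using e k f cK o by (auto simp: cond_smult_def hom_simps)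
  have cg_h: "dgcomp A W X Z (l + m) n (cond_smult ?XZ ?P c g) h
      = cond_smult ?WZ ?P c (dgcomp A W X Y m n g h)"
    using g h cK o by (auto simp: cond_smult_def comp_bilinear add.assoc)
  have ef_h: "dgcomp A W X Z (l + m) n (cond_smult ?XZ ?Q e f) h
      = dgcomp A W Y Z l (m + n) f (cond_smult ?WY ?Q e h)"
    using f h cK o by (auto simp: cond_smult_def comp_bilinear add.assoc)
  have k_fg: "cond_smult ?WZ ?R k (dgcomp A X Y Z l m f g)
      = dgcomp A W Y Z l (m + n) f (cond_smult ?WY ?R k g)"
    using f g cK o by (auto simp: cond_smult_def comp_bilinear)
  have k_cg: "cond_smult ?WZ ?R k (cond_smult ?XZ ?P c g)
      = cond_smult ?WZ ?P c (cond_smult ?WY ?R k g)"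
    using g cK o by (auto simp: cond_smult_def hom_simps)
  have cl: "cond_smult ?XZ ?P c g \<in> carrier ?XZ" "cond_smult ?XZ ?Q e f \<in> carrier ?XZ"
      "cond_smult ?WY ?Q e h \<in> carrier ?WY" "cond_smult ?WY ?R k g \<in> carrier ?WY"
    using f g h cK o by (auto simp: cond_smult_def hom_simps)
  have cl': "dgcomp A X Y Z l m f g \<in> carrier ?XZ" "dgcomp A W X Y m n g h \<in> carrier ?WY"
    using f g h o by (simp_all add: comp_closed)
  have cl'': "cond_smult ?WZ ?P c x \<in> carrier ?WZ" if "x \<in> carrier ?WY" for x
    using that cK o by (auto simp: cond_smult_def hom_simps)
  have dgcomp_cl: "dgcomp A W Y Z l (m + n) f x \<in> carrier ?WZ" if "x \<in> carrier ?WY" for x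
    using that f o by (simp add: comp_closed)
  have cond_cl: "cond_smult ?WZ ?R k x \<in> carrier ?WZ" if "x \<in> carrier ?XZ" for x
    using that cK o by (auto simp: cond_smult_def hom_simps)
  have add_l: "cond_smult ?WZ ?P c (x \<oplus>\<^bsub>?WY\<^esub> y)
      = cond_smult ?WZ ?P c x \<oplus>\<^bsub>?WZ\<^esub> cond_smult ?WZ ?P c y"
    if "x \<in> carrier ?WY" "y \<in> carrier ?WY" for x y
    by (rule linear_mapD(2)[OF cond_smult_linear[OF WZ.module_axioms] that]) (use cK in auto)
  have add_r: "cond_smult ?WZ ?R k (x \<oplus>\<^bsub>?XZ\<^esub> y)
      = cond_smult ?WZ ?R k x \<oplus>\<^bsub>?WZ\<^esub> cond_smult ?WZ ?R k y"
    if "x \<in> carrier ?XZ" "y \<in> carrier ?XZ" for x y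
    by (rule linear_mapD(2)[OF cond_smult_linear[OF WZ.module_axioms] that]) (use cK in auto)
  have as: "dgcomp A W X Z (l + m) n (dgcomp A X Y Z l m f g) h
      = dgcomp A W Y Z l (m + n) f (dgcomp A W X Y m n g h)"
    by (rule comp_assoc[OF o f g h])
  have comp_add: "dgcomp A W X Z (l + m) n (x \<oplus>\<^bsub>?XZ\<^esub> y) h
      = dgcomp A W X Z (l + m) n x h \<oplus>\<^bsub>?WZ\<^esub> dgcomp A W X Z (l + m) n y h"
    if "x \<in> carrier ?XZ" "y \<in> carrier ?XZ" for x y
    using comp_bilinear(1)[OF o(1,2,4) that h] by (simp add: add.assoc)
  have ek: "c \<otimes> e \<otimes> k = c \<otimes> (e \<otimes> k)"
    using cK by (simp add: m_assoc)
  show ?thesis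
    unfolding eq augment_simps prod.inject add.assoc
    using cl cl' f o
    by (simp add: ce_h ek_f ek add_l add_r comp_add comp_bilinear(2) as cg_h ef_h k_fg k_cg
        cl'' dgcomp_cl cond_cl WZ.a_ac)
qed

text \<open>Units are closed, so both sides expand to \<open>(df) g\<close>, the signed
  \<open>f (dg)\<close>, \<open>c dg\<close> and \<open>e df\<close>. The other products contain the
  scalar part of a differential and vanish.\<close>

lemma augment_leibniz:
  assumes o: "X \<in> dgobj A" "Y \<in> dgobj A" "Z \<in> dgobj A"
    and u: "u \<in> carrier (aug_hom K A Y Z m)" and v: "v \<in> carrier (aug_hom K A X Y n)"
  shows "dgdiff (augment K A) X Z (m + n) (dgcomp (augment K A) X Y Z m n u v)
    = dgcomp (augment K A) X Y Z (m + 1) n (dgdiff (augment K A) Y Z m u) v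
      \<oplus>\<^bsub>aug_hom K A X Z (m + n + 1)\<^esub>
      sgn_mult (aug_hom K A X Z (m + n + 1)) m
        (dgcomp (augment K A) X Y Z m (n + 1) u (dgdiff (augment K A) X Y n v))"
proof -
  obtain f c g e where eq: "u = (f, c)" "v = (g, e)"
    by (metis surj_pair)
  have f: "f \<in> carrier (dghom A Y Z m)" and g: "g \<in> carrier (dghom A X Y n)"
    and cK: "c \<in> carrier K" "e \<in> carrier K"
    and c: "Y = Z \<and> m = 0 \<or> c = \<zero>" and e: "X = Y \<and> n = 0 \<or> e = \<zero>"
    using u v by (auto simp: eq aug_hom_simps)
  let ?P = "Y = Z \<and> m = 0" and ?Q = "X = Y \<and> n = 0"
  let ?M = "dghom A X Z (m + n)" and ?N = "dghom A X Z (m + n + 1)"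
  interpret M: module K ?M using hom_module o by simp
  interpret N: module K ?N using hom_module o by simp
  have deg: "m + n + 1 = n" if "m + 1 = 0"
    using that by simp
  have deg_n: "m + n + 1 = m" if "n + 1 = 0"
    using that by simp
  have fg: "dgcomp A X Y Z m n f g \<in> carrier ?M"
      "dgcomp A X Y Z (m + 1) n (dgdiff A Y Z m f) g \<in> carrier ?N"
      "dgcomp A X Y Z m (n + 1) f (dgdiff A X Y n g) \<in> carrier ?N"
    using f g o by (simp_all add: comp_closed_eq diff_closed)
  have cl: "cond_smult ?M ?P c g \<in> carrier ?M" "cond_smult ?M ?Q e f \<in> carrier ?M"
      "cond_smult ?N ?P c (dgdiff A X Y n g) \<in> carrier ?N"
      "cond_smult ?N ?Q e (dgdiff A Y Z m f) \<in> carrier ?N"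
    using f g cK o by (auto simp: cond_smult_def hom_simps diff_closed)
  have d_cg: "dgdiff A X Z (m + n) (cond_smult ?M ?P c g) = cond_smult ?N ?P c (dgdiff A X Y n g)"
    using g cK o by (auto simp: cond_smult_def diff_simps)
  have d_ef: "dgdiff A X Z (m + n) (cond_smult ?M ?Q e f) = cond_smult ?N ?Q e (dgdiff A Y Z m f)"
    using f cK o by (auto simp: cond_smult_def diff_simps)
  \<comment> \<open>Formally the product of \<open>df\<close> with \<open>g\<close> still has a
    summand \<open>0 g\<close>. It is zero in the target only if \<open>g\<close> lies there, which
    the equation \<open>deg\<close> ensures under the guard.\<close>
  have zero_g: "cond_smult ?N (Y = Z \<and> m + 1 = 0) \<zero> g = \<zero>\<^bsub>?N\<^esub>"
    using g o by (auto simp: cond_smult_def hom_simps deg)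
  have zero_f: "cond_smult ?N (X = Y \<and> n + 1 = 0) \<zero> f = \<zero>\<^bsub>?N\<^esub>"
    using f o by (auto simp: cond_smult_def hom_simps deg_n)
  \<comment> \<open>Where the guard holds, \<open>m = 0\<close> and the sign is trivial; elsewhere
    the term is zero.\<close>
  have sgn_cg: "sgn_mult ?N m (cond_smult ?N ?P c (dgdiff A X Y n g))
      = cond_smult ?N ?P c (dgdiff A X Y n g)"
    by (auto simp: cond_smult_def sgn_mult_def N.minus_equality)
  have sgn_add: "sgn_mult ?N m (x \<oplus>\<^bsub>?N\<^esub> y) = sgn_mult ?N m x \<oplus>\<^bsub>?N\<^esub> sgn_mult ?N m y"
    if "x \<in> carrier ?N" "y \<in> carrier ?N" for x y
    using that by (simp add: sgn_mult_def N.minus_add)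
  have aug: "(x, \<zero>) \<in> carrier (aug_hom K A X Z (m + n + 1))" if "x \<in> carrier ?N" for x
    using that by (simp add: aug_hom_simps)
  have deg': "m + (n + 1) = m + n + 1" "m + 1 + n = m + n + 1" by simp_all
  show ?thesis
    using f g cK o fg cl
    by (simp only: eq augment_simps deg' zero_g zero_f)
      (simp add: aug_hom_sgn_mult[OF hom_module] aug aug_hom_simps sgn_add sgn_cg diff_simps d_cg d_ef
        leibniz N.sgn_mult_closed N.a_ac)
qed

lemma augment_dg_category: "nonunital_dg_category K (augment K A)"
proof (rule nonunital_dg_category.intro[OF field_axioms nonunital_dg_category_axioms.intro];
    unfold augment_simps(1,2))
  fix X Y n assume o: "X \<in> dgobj A" "Y \<in> dgobj A"
  show "module K (aug_hom K A X Y n)"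
    by (rule aug_hom_module[OF hom_module[OF o]])
  show "linear_map K (aug_hom K A X Y n) (aug_hom K A X Y (n + 1)) (dgdiff (augment K A) X Y n)"
    using o by (auto simp: linear_map_def aug_hom_simps augment_simps diff_simps diff_closed_eq)
  fix u assume "u \<in> carrier (aug_hom K A X Y n)"
  then show "dgdiff (augment K A) X Y (n + 1) (dgdiff (augment K A) X Y n u)
      = \<zero>\<^bsub>aug_hom K A X Y (n + 2)\<^esub>"
    using o by (cases u) (auto simp: augment_simps aug_hom_simps diff_diff)
next
  fix X Y Z m n v
  assume o: "X \<in> dgobj A" "Y \<in> dgobj A" "Z \<in> dgobj A" and v: "v \<in> carrier (aug_hom K A X Y n)"
  obtain g e where g: "v = (g, e)" "g \<in> carrier (dghom A X Y n)" "e \<in> carrier K"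
      "X = Y \<and> n = 0 \<or> e = \<zero>"
    using v by (cases v) (auto simp: aug_hom_simps)
  interpret M: module K "dghom A X Z (m + n)" using hom_module o by simp
  have Pg: "g \<in> carrier (dghom A X Z (m + n))" if "Y = Z \<and> m = 0"
    using that g(2) by simp
  note L = linear_mapD[OF comp_linear_left[OF o g(2), of m]]
    linear_mapD[OF cond_smult_linear[where N = "dghom A Y Z m" and P = "X = Y \<and> n = 0",
      OF M.module_axioms g(3)]]
    cond_smult_closed[OF M.module_axioms _ Pg] cond_smult_scalar[OF M.module_axioms Pg]
  show "linear_map K (aug_hom K A Y Z m) (aug_hom K A X Z (m + n))
      (\<lambda>u. dgcomp (augment K A) X Y Z m n u v)"
    unfolding linear_map_def
  proof (intro conjI ballI funcsetI)
    fix u assume u: "u \<in> carrier (aug_hom K A Y Z m)"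
    \<comment> \<open>A nonzero scalar requires both factors to be endomorphisms of degree 0, and
      then so is the composite.\<close>
    then have "X = Z \<and> m + n = 0 \<or> snd u \<otimes> e = \<zero>"
      using g(3,4) by (cases u) (auto simp: aug_hom_simps)
    with u show "dgcomp (augment K A) X Y Z m n u v \<in> carrier (aug_hom K A X Z (m + n))"
      using g by (cases u) (simp add: aug_hom_simps augment_simps L)
  next
    fix u u' assume "u \<in> carrier (aug_hom K A Y Z m)" "u' \<in> carrier (aug_hom K A Y Z m)"
    then show "dgcomp (augment K A) X Y Z m n (u \<oplus>\<^bsub>aug_hom K A Y Z m\<^esub> u') v
        = dgcomp (augment K A) X Y Z m n u v
          \<oplus>\<^bsub>aug_hom K A X Z (m + n)\<^esub> dgcomp (augment K A) X Y Z m n u' v"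
      using g by (cases u; cases u') (simp add: aug_hom_simps augment_simps L l_distr M.a_ac)
  next
    fix a u assume "a \<in> carrier K" "u \<in> carrier (aug_hom K A Y Z m)"
    then show "dgcomp (augment K A) X Y Z m n (a \<odot>\<^bsub>aug_hom K A Y Z m\<^esub> u) v
        = a \<odot>\<^bsub>aug_hom K A X Z (m + n)\<^esub> dgcomp (augment K A) X Y Z m n u v"
      using g by (cases u) (simp add: aug_hom_simps augment_simps L M.smult_r_distr m_assoc)
  qed
next
  fix X Y Z m n u
  assume o: "X \<in> dgobj A" "Y \<in> dgobj A" "Z \<in> dgobj A" and u: "u \<in> carrier (aug_hom K A Y Z m)"
  obtain f c where f: "u = (f, c)" "f \<in> carrier (dghom A Y Z m)" "c \<in> carrier K"
      "Y = Z \<and> m = 0 \<or> c = \<zero>"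
    using u by (cases u) (auto simp: aug_hom_simps)
  interpret M: module K "dghom A X Z (m + n)" using hom_module o by simp
  have Pf: "f \<in> carrier (dghom A X Z (m + n))" if "X = Y \<and> n = 0"
    using that f(2) by simp
  note L = linear_mapD[OF comp_linear_right[OF o f(2), of n]]
    linear_mapD[OF cond_smult_linear[where N = "dghom A X Y n" and P = "Y = Z \<and> m = 0",
      OF M.module_axioms f(3)]]
    cond_smult_closed[OF M.module_axioms _ Pf] cond_smult_scalar[OF M.module_axioms Pf]
  show "linear_map K (aug_hom K A X Y n) (aug_hom K A X Z (m + n))
      (\<lambda>v. dgcomp (augment K A) X Y Z m n u v)"
    unfolding linear_map_def
  proof (intro conjI ballI funcsetI)
    fix v assume v: "v \<in> carrier (aug_hom K A X Y n)"
    then have "X = Z \<and> m + n = 0 \<or> c \<otimes> snd v = \<zero>"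
      using f(3,4) by (cases v) (auto simp: aug_hom_simps)
    with v show "dgcomp (augment K A) X Y Z m n u v \<in> carrier (aug_hom K A X Z (m + n))"
      using f by (cases v) (simp add: aug_hom_simps augment_simps L)
  next
    fix v v' assume "v \<in> carrier (aug_hom K A X Y n)" "v' \<in> carrier (aug_hom K A X Y n)"
    then show "dgcomp (augment K A) X Y Z m n u (v \<oplus>\<^bsub>aug_hom K A X Y n\<^esub> v')
        = dgcomp (augment K A) X Y Z m n u v
          \<oplus>\<^bsub>aug_hom K A X Z (m + n)\<^esub> dgcomp (augment K A) X Y Z m n u v'"
      using f by (cases v; cases v') (simp add: aug_hom_simps augment_simps L r_distr M.a_ac)
  next
    fix a v assume "a \<in> carrier K" "v \<in> carrier (aug_hom K A X Y n)"
    then show "dgcomp (augment K A) X Y Z m n u (a \<odot>\<^bsub>aug_hom K A X Y n\<^esub> v)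
        = a \<odot>\<^bsub>aug_hom K A X Z (m + n)\<^esub> dgcomp (augment K A) X Y Z m n u v"
      using f by (cases v) (simp add: aug_hom_simps augment_simps L M.smult_r_distr m_lcomm)
  qed
qed (fact augment_comp_assoc augment_leibniz)+

end

section \<open>Strings of composable morphisms\<close>

lemma composable_update:
  assumes "composable B Xs ds fs" "i < length fs"
    "v \<in> carrier (dghom B (Xs ! Suc i) (Xs ! i) d)"
  shows "composable B Xs (ds[i := d]) (fs[i := v])"
  using assms by (auto simp: composable_def nth_list_update)

lemma composable_take:
  assumes "composable B Xs ds fs" "0 < i" "i \<le> length fs"
  shows "composable B (take (Suc i) Xs) (take i ds) (take i fs)"
  using assms by (auto simp: composable_def dest: in_set_takeD)

lemma composable_drop:
  assumes "composable B Xs ds fs" "i < length fs"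
  shows "composable B (drop i Xs) (drop i ds) (drop i fs)"
  using assms by (auto simp: composable_def add.commute dest: in_set_dropD)

lemma composable_merge:
  assumes "composable B Xs ds fs" "Suc i < length fs"
    "v \<in> carrier (dghom B (Xs ! (i + 2)) (Xs ! i) d)"
  shows "composable B (take (Suc i) Xs @ drop (i + 2) Xs)
    (take i ds @ d # drop (i + 2) ds) (take i fs @ v # drop (i + 2) fs)"
proof -
  have "(take i fs @ v # drop (i + 2) fs) ! j \<in> carrier (dghom B
      ((take (Suc i) Xs @ drop (i + 2) Xs) ! Suc j) ((take (Suc i) Xs @ drop (i + 2) Xs) ! j)
      ((take i ds @ d # drop (i + 2) ds) ! j))" if "j < length fs - 1" for j
  proof -
    \<comment> \<open>Positions before, at and after the merged pair. After it, position
      \<open>i + 1 + k\<close> of the new list is position \<open>i + 2 + k\<close> of the old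
      one.\<close>
    consider "j < i" | "j = i" | k where "j = Suc (i + k)"
      by (metis less_iff_Suc_add nat_neq_iff)
    then show ?thesis
      using assms that by cases (auto simp: composable_def nth_append)
  qed
  then show ?thesis
    using assms by (auto simp: composable_def dest: in_set_takeD in_set_dropD)
qed

lemma composable_nth:
  "composable B Xs ds fs \<Longrightarrow> i < length fs \<Longrightarrow>
    fs ! i \<in> carrier (dghom B (Xs ! Suc i) (Xs ! i) (ds ! i))"
  "composable B Xs ds fs \<Longrightarrow> i \<le> length fs \<Longrightarrow> Xs ! i \<in> dgobj B"
  by (auto simp: composable_def)

lemma composable_ends:
  assumes "composable B Xs ds fs"
  shows "hd Xs = Xs ! 0" "last Xs = Xs ! length fs" "hd Xs \<in> dgobj B" "last Xs \<in> dgobj B"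
proof -
  have "Xs \<noteq> []" using assms by (auto simp: composable_def)
  then show "hd Xs = Xs ! 0" "last Xs = Xs ! length fs" "hd Xs \<in> dgobj B" "last Xs \<in> dgobj B"
    using assms by (auto simp: composable_def hd_conv_nth last_conv_nth)
qed

lemma composable_lengths:
  assumes "composable B Xs ds fs"
  shows "length Xs = Suc (length fs)" "length ds = length fs" "fs \<noteq> []" "Xs \<noteq> []"
  using assms by (auto simp: composable_def)

lemma merge_ends:
  assumes "length Xs = Suc n" "Suc i < n"
  shows "hd (take (Suc i) Xs @ drop (i + 2) Xs) = hd Xs"
    and "last (take (Suc i) Xs @ drop (i + 2) Xs) = last Xs"
  using assms by (cases Xs; auto simp: last_append)+

lemma sum_list_merge:
  fixes ds :: "int list"
  assumes "length ds = n" "Suc i < n"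
  shows "sum_list (take i ds @ (ds ! i + ds ! Suc i) # drop (i + 2) ds) = sum_list ds"
proof -
  have "ds = take i ds @ ds ! i # ds ! Suc i # drop (i + 2) ds"
    using assms by (simp add: Cons_nth_drop_Suc)
  then have "sum_list ds = sum_list (take i ds @ ds ! i # ds ! Suc i # drop (i + 2) ds)"
    by simp
  then show ?thesis by simp
qed

lemma sum_list_take_drop: "sum_list (take i ds) + sum_list (drop i ds) = sum_list (ds :: int list)"
  by (metis append_take_drop_id sum_list_append)

text \<open>This is \<open>F \<oplus> id\<close> on a string of the augmented category. Entry
  \<open>i\<close> runs from \<open>Xs ! Suc i\<close> to \<open>Xs ! i\<close>, so the object and
  degree lists select the component of \<open>F\<close> that applies to it.\<close>

definition map_string ::
    "('o \<Rightarrow> 'o \<Rightarrow> int \<Rightarrow> 'm \<Rightarrow> 'n) \<Rightarrow> 'o list \<Rightarrow> int list \<Rightarrow> ('m \<times> 'k) list \<Rightarrow> ('n \<times> 'k) list" where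
  "map_string F Xs ds fs =
    map (\<lambda>i. map_prod (F (Xs ! Suc i) (Xs ! i) (ds ! i)) id (fs ! i)) [0..<length fs]"

lemma length_map_string [simp]: "length (map_string F Xs ds fs) = length fs"
  by (simp add: map_string_def)

lemma nth_map_string [simp]:
  "i < length fs \<Longrightarrow>
    map_string F Xs ds fs ! i = map_prod (F (Xs ! Suc i) (Xs ! i) (ds ! i)) id (fs ! i)"
  by (simp add: map_string_def)

lemma map_string_Nil [simp]: "map_string F Xs ds fs = [] \<longleftrightarrow> fs = []"
  by (simp add: map_string_def)

lemma map_string_update:
  assumes "i < length fs" "length ds = length fs"
  shows "map_string F Xs (ds[i := d]) (fs[i := v])
    = (map_string F Xs ds fs)[i := map_prod (F (Xs ! Suc i) (Xs ! i) d) id v]"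
  using assms by (intro nth_equalityI) (auto simp: nth_list_update)

lemma map_string_take:
  assumes "i \<le> length fs" "length ds = length fs"
  shows "map_string F (take (Suc i) Xs) (take i ds) (take i fs) = take i (map_string F Xs ds fs)"
  using assms by (intro nth_equalityI) auto

lemma map_string_drop:
  assumes "i \<le> length fs" "length ds = length fs" "length Xs = Suc (length fs)"
  shows "map_string F (drop i Xs) (drop i ds) (drop i fs) = drop i (map_string F Xs ds fs)"
  using assms by (intro nth_equalityI) auto

lemma map_string_merge:
  assumes "Suc i < length fs" "length ds = length fs" "length Xs = Suc (length fs)"
  shows "map_string F (take (Suc i) Xs @ drop (i + 2) Xs)
      (take i ds @ d # drop (i + 2) ds) (take i fs @ v # drop (i + 2) fs)
    = take i (map_string F Xs ds fs) @ map_prod (F (Xs ! (i + 2)) (Xs ! i) d) id v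
      # drop (i + 2) (map_string F Xs ds fs)" (is "?l = ?r")
proof (rule nth_equalityI)
  show "length ?l = length ?r" using assms by simp
  fix j assume "j < length ?l"
  then have j: "j < length fs - 1" using assms by simp
  consider "j < i" | "j = i" | k where "j = Suc (i + k)"
    by (metis less_iff_Suc_add nat_neq_iff)
  then show "?l ! j = ?r ! j"
    using assms j by cases (auto simp: nth_append)
qed

section \<open>Structure-preserving maps\<close>

text \<open>
  Raw data closed under all operations; no identity is assumed yet.
\<close>

locale wudg_closed = field K
  for K :: "('k, 'r) ring_scheme" (structure) and C :: "('o, 'm, 'k) wudg_data" +
  assumes zero_in: "\<lbrakk>X \<in> dgobj C; Y \<in> dgobj C\<rbrakk> \<Longrightarrow> \<zero>\<^bsub>dghom C X Y n\<^esub> \<in> carrier (dghom C X Y n)"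
    and add_in: "\<lbrakk>X \<in> dgobj C; Y \<in> dgobj C; f \<in> carrier (dghom C X Y n);
        g \<in> carrier (dghom C X Y n)\<rbrakk> \<Longrightarrow> f \<oplus>\<^bsub>dghom C X Y n\<^esub> g \<in> carrier (dghom C X Y n)"
    and smult_in: "\<lbrakk>X \<in> dgobj C; Y \<in> dgobj C; a \<in> carrier K; f \<in> carrier (dghom C X Y n)\<rbrakk>
      \<Longrightarrow> a \<odot>\<^bsub>dghom C X Y n\<^esub> f \<in> carrier (dghom C X Y n)"
    and diff_in: "\<lbrakk>X \<in> dgobj C; Y \<in> dgobj C; f \<in> carrier (dghom C X Y n)\<rbrakk>
      \<Longrightarrow> dgdiff C X Y n f \<in> carrier (dghom C X Y (n + 1))"
    and comp_in: "\<lbrakk>X \<in> dgobj C; Y \<in> dgobj C; Z \<in> dgobj C;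
        f \<in> carrier (dghom C Y Z m); g \<in> carrier (dghom C X Y n)\<rbrakk>
      \<Longrightarrow> dgcomp C X Y Z m n f g \<in> carrier (dghom C X Z (m + n))"
    and wuid_in: "X \<in> dgobj C \<Longrightarrow> wuid C X \<in> carrier (dghom C X X 0)"
    and wup_in: "composable (augment K C) Xs ds fs
      \<Longrightarrow> wup C Xs ds fs \<in> carrier (dghom C (last Xs) (hd Xs) (sum_list ds + 1 - int (length fs)))"

context wudg_closed
begin

lemma diff_in_eq:
  "\<lbrakk>X \<in> dgobj C; Y \<in> dgobj C; f \<in> carrier (dghom C X Y n); n + 1 = k\<rbrakk>
    \<Longrightarrow> dgdiff C X Y n f \<in> carrier (dghom C X Y k)"
  using diff_in by blast

lemma comp_in_eq:
  "\<lbrakk>X \<in> dgobj C; Y \<in> dgobj C; Z \<in> dgobj C;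
    f \<in> carrier (dghom C Y Z m); g \<in> carrier (dghom C X Y n); m + n = k\<rbrakk>
    \<Longrightarrow> dgcomp C X Y Z m n f g \<in> carrier (dghom C X Z k)"
  using comp_in by blast

end

lemma (in weakly_unital_dg_category) wup_closed:
  assumes "composable (augment K A) Xs ds fs"
  shows "wup A Xs ds fs \<in> carrier (dghom A (last Xs) (hd Xs) (sum_list ds + 1 - int (length fs)))"
proof -
  interpret P: a_inf_functor K "augment K A" A "\<lambda>X. X" "wup A" by (rule p_a_inf_functor)
  have "0 < length fs" using assms by (simp add: composable_def)
  \<comment> \<open>Linearity in one argument includes that values land in the right hom space;
    inserting \<open>fs ! 0\<close> at its own position returns \<open>fs\<close>.\<close>
  from linear_mapD(1)[OF P.Fm_multilinear[OF assms this] composable_nth(1)[OF assms this]]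
  show ?thesis by (simp add: augment_simps)
qed

sublocale weakly_unital_dg_category \<subseteq> wudg_closed K A
  by unfold_locales (auto simp: hom_simps diff_closed comp_closed id_in wup_closed)

text \<open>A functor whose source is only closed raw data, so that projections of a candidate
  object qualify before its axioms are known. Source and target may have different types, and
  nothing is prescribed outside the domain. Zero and the elements \<open>wuid\<close> are listed
  because deriving their preservation would use axioms of the source.\<close>

locale dgwu_map = C: wudg_closed K C + D: weakly_unital_dg_category K D
  for K :: "('k, 'r) ring_scheme" (structure)
    and C :: "('o, 'm, 'k) wudg_data" and D :: "('p, 'n, 'k) wudg_data" +
  fixes Fo :: "'o \<Rightarrow> 'p" and Fm :: "'o \<Rightarrow> 'o \<Rightarrow> int \<Rightarrow> 'm \<Rightarrow> 'n"
  assumes Fo_in: "X \<in> dgobj C \<Longrightarrow> Fo X \<in> dgobj D"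
    and Fm_in: "\<lbrakk>X \<in> dgobj C; Y \<in> dgobj C; f \<in> carrier (dghom C X Y n)\<rbrakk>
      \<Longrightarrow> Fm X Y n f \<in> carrier (dghom D (Fo X) (Fo Y) n)"
    and Fm_zero: "\<lbrakk>X \<in> dgobj C; Y \<in> dgobj C\<rbrakk>
      \<Longrightarrow> Fm X Y n \<zero>\<^bsub>dghom C X Y n\<^esub> = \<zero>\<^bsub>dghom D (Fo X) (Fo Y) n\<^esub>"
    and Fm_add: "\<lbrakk>X \<in> dgobj C; Y \<in> dgobj C; f \<in> carrier (dghom C X Y n);
        g \<in> carrier (dghom C X Y n)\<rbrakk>
      \<Longrightarrow> Fm X Y n (f \<oplus>\<^bsub>dghom C X Y n\<^esub> g) = Fm X Y n f \<oplus>\<^bsub>dghom D (Fo X) (Fo Y) n\<^esub> Fm X Y n g"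
    and Fm_smult: "\<lbrakk>X \<in> dgobj C; Y \<in> dgobj C; a \<in> carrier K; f \<in> carrier (dghom C X Y n)\<rbrakk>
      \<Longrightarrow> Fm X Y n (a \<odot>\<^bsub>dghom C X Y n\<^esub> f) = a \<odot>\<^bsub>dghom D (Fo X) (Fo Y) n\<^esub> Fm X Y n f"
    and Fm_diff: "\<lbrakk>X \<in> dgobj C; Y \<in> dgobj C; f \<in> carrier (dghom C X Y n)\<rbrakk>
      \<Longrightarrow> Fm X Y (n + 1) (dgdiff C X Y n f) = dgdiff D (Fo X) (Fo Y) n (Fm X Y n f)"
    and Fm_comp: "\<lbrakk>X \<in> dgobj C; Y \<in> dgobj C; Z \<in> dgobj C;
        f \<in> carrier (dghom C Y Z m); g \<in> carrier (dghom C X Y n)\<rbrakk>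
      \<Longrightarrow> Fm X Z (m + n) (dgcomp C X Y Z m n f g)
        = dgcomp D (Fo X) (Fo Y) (Fo Z) m n (Fm Y Z m f) (Fm X Y n g)"
    and Fm_id: "X \<in> dgobj C \<Longrightarrow> Fm X X 0 (wuid C X) = wuid D (Fo X)"
    and Fm_p: "composable (augment K C) Xs ds fs
      \<Longrightarrow> Fm (last Xs) (hd Xs) (sum_list ds + 1 - int (length fs)) (wup C Xs ds fs)
        = wup D (map Fo Xs) ds (map_string Fm Xs ds fs)"
begin

lemma Fm_diff_eq:
  "\<lbrakk>X \<in> dgobj C; Y \<in> dgobj C; f \<in> carrier (dghom C X Y n); n + 1 = k\<rbrakk>
    \<Longrightarrow> Fm X Y k (dgdiff C X Y n f) = dgdiff D (Fo X) (Fo Y) n (Fm X Y n f)"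
  using Fm_diff by blast

lemma Fm_comp_eq:
  "\<lbrakk>X \<in> dgobj C; Y \<in> dgobj C; Z \<in> dgobj C;
    f \<in> carrier (dghom C Y Z m); g \<in> carrier (dghom C X Y n); m + n = k\<rbrakk>
    \<Longrightarrow> Fm X Z k (dgcomp C X Y Z m n f g)
      = dgcomp D (Fo X) (Fo Y) (Fo Z) m n (Fm Y Z m f) (Fm X Y n g)"
  using Fm_comp by blast

lemma aug_in:
  "\<lbrakk>X \<in> dgobj C; Y \<in> dgobj C; u \<in> carrier (aug_hom K C X Y n)\<rbrakk>
    \<Longrightarrow> map_prod (Fm X Y n) id u \<in> carrier (aug_hom K D (Fo X) (Fo Y) n)"
  by (cases u) (auto simp: aug_hom_simps Fm_in)

lemma aug_add:
  "\<lbrakk>X \<in> dgobj C; Y \<in> dgobj C; u \<in> carrier (aug_hom K C X Y n); v \<in> carrier (aug_hom K C X Y n)\<rbrakk>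
    \<Longrightarrow> map_prod (Fm X Y n) id (u \<oplus>\<^bsub>aug_hom K C X Y n\<^esub> v)
      = map_prod (Fm X Y n) id u \<oplus>\<^bsub>aug_hom K D (Fo X) (Fo Y) n\<^esub> map_prod (Fm X Y n) id v"
  by (cases u; cases v) (auto simp: aug_hom_simps Fm_add)

lemma aug_smult:
  "\<lbrakk>X \<in> dgobj C; Y \<in> dgobj C; a \<in> carrier K; u \<in> carrier (aug_hom K C X Y n)\<rbrakk>
    \<Longrightarrow> map_prod (Fm X Y n) id (a \<odot>\<^bsub>aug_hom K C X Y n\<^esub> u)
      = a \<odot>\<^bsub>aug_hom K D (Fo X) (Fo Y) n\<^esub> map_prod (Fm X Y n) id u"
  by (cases u) (auto simp: aug_hom_simps Fm_smult)

lemma aug_diff: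
  "\<lbrakk>X \<in> dgobj C; Y \<in> dgobj C; u \<in> carrier (aug_hom K C X Y n)\<rbrakk>
    \<Longrightarrow> map_prod (Fm X Y (n + 1)) id (dgdiff (augment K C) X Y n u)
      = dgdiff (augment K D) (Fo X) (Fo Y) n (map_prod (Fm X Y n) id u)"
  by (cases u) (auto simp: aug_hom_simps augment_simps Fm_diff)

text \<open>The object map need not be injective, so the guard \<open>Y = Z\<close> can fail while
  \<open>Fo Y = Fo Z\<close> holds. Then the source has no unit term but the target formula has one,
  and it is harmless because its scalar is zero.\<close>

lemma aug_comp:
  assumes o: "X \<in> dgobj C" "Y \<in> dgobj C" "Z \<in> dgobj C"
    and u: "u \<in> carrier (aug_hom K C Y Z m)" and v: "v \<in> carrier (aug_hom K C X Y n)"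
  shows "map_prod (Fm X Z (m + n)) id (dgcomp (augment K C) X Y Z m n u v)
    = dgcomp (augment K D) (Fo X) (Fo Y) (Fo Z) m n
        (map_prod (Fm Y Z m) id u) (map_prod (Fm X Y n) id v)"
proof -
  obtain f c g e where eq: "u = (f, c)" "v = (g, e)"
    by (metis surj_pair)
  have f: "f \<in> carrier (dghom C Y Z m)" and g: "g \<in> carrier (dghom C X Y n)"
    and cK: "c \<in> carrier K" "e \<in> carrier K"
    and c: "Y = Z \<and> m = 0 \<or> c = \<zero>" and e: "X = Y \<and> n = 0 \<or> e = \<zero>"
    using u v by (auto simp: eq aug_hom_simps)
  let ?P = "Y = Z \<and> m = 0" and ?Q = "X = Y \<and> n = 0"
  let ?M = "dghom C X Z (m + n)" and ?N = "dghom D (Fo X) (Fo Z) (m + n)"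
  have fg: "dgcomp C X Y Z m n f g \<in> carrier ?M"
    using f g o by (simp add: C.comp_in)
  have cl: "cond_smult ?M ?P c g \<in> carrier ?M" "cond_smult ?M ?Q e f \<in> carrier ?M"
    using f g cK o by (auto simp: cond_smult_def C.smult_in C.zero_in)
  have Fc: "Fm X Z (m + n) (cond_smult ?M ?P c g) = cond_smult ?N (Fo Y = Fo Z \<and> m = 0) c (Fm X Y n g)"
  proof (cases "?P \<or> \<not> (Fo Y = Fo Z \<and> m = 0)")
    case True
    then show ?thesis using g cK o by (auto simp: cond_smult_def Fm_smult Fm_zero)
  next
    \<comment> \<open>The objects become equal only after applying \<open>Fo\<close>. The constraint
      on \<open>u\<close> forces \<open>c = 0\<close>, and \<open>Fm X Y n g\<close> lies in the
      target because of the identification, so the extra term is zero.\<close>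
    case False
    have "Fm X Y n g \<in> carrier (dghom D (Fo X) (Fo Z) n)"
      using False Fm_in[OF o(1,2) g] by simp
    moreover have "m = 0" "Y \<noteq> Z" "c = \<zero>" using False c by auto
    ultimately show ?thesis
      using o False by (simp add: cond_smult_def Fm_zero D.hom_simps Fo_in)
  qed
  have Fe: "Fm X Z (m + n) (cond_smult ?M ?Q e f) = cond_smult ?N (Fo X = Fo Y \<and> n = 0) e (Fm Y Z m f)"
  proof (cases "?Q \<or> \<not> (Fo X = Fo Y \<and> n = 0)")
    case True
    then show ?thesis using f cK o by (auto simp: cond_smult_def Fm_smult Fm_zero)
  next
    case False
    have "Fm Y Z m f \<in> carrier (dghom D (Fo X) (Fo Z) m)"
      using False Fm_in[OF o(2,3) f] by simp
    moreover have "n = 0" "X \<noteq> Y" "e = \<zero>" using False e by auto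
    ultimately show ?thesis
      using o False by (simp add: cond_smult_def Fm_zero D.hom_simps Fo_in)
  qed
  show ?thesis
    using f g o fg cl by (simp add: eq augment_simps Fm_add Fm_comp Fc Fe C.add_in)
qed

lemma composable_map_string:
  assumes "composable (augment K C) Xs ds fs"
  shows "composable (augment K D) (map Fo Xs) ds (map_string Fm Xs ds fs)"
  using assms aug_in by (auto simp: composable_def augment_simps Fo_in subset_iff)

end

section \<open>Jointly faithful families\<close>

text \<open>The two sides of \<open>Fm_relation\<close> for \<open>wup C\<close> and the identity on
  objects. Named for raw data, they can be projected and compared before the relation is known to
  hold in \<open>C\<close>.\<close>

definition relation_lhs ::
    "('k, 'r) ring_scheme \<Rightarrow> ('o, 'm, 'k) wudg_data \<Rightarrow> 'o list \<Rightarrow> int list \<Rightarrow> ('m \<times> 'k) list \<Rightarrow> 'm" where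
  "relation_lhs K C Xs ds fs = (let n = length fs; M = dghom C (last Xs) (hd Xs) (sum_list ds + 2 - int n) in
      (\<Oplus>\<^bsub>M\<^esub> i\<in>{..<n}. sgn_mult M (int (n - 1) + sum_list (take i ds))
          (wup C Xs (ds[i := ds ! i + 1])
            (fs[i := dgdiff (augment K C) (Xs ! Suc i) (Xs ! i) (ds ! i) (fs ! i)])))
      \<oplus>\<^bsub>M\<^esub>
      (\<Oplus>\<^bsub>M\<^esub> i\<in>{..<n - 1}. sgn_mult M (int i)
          (wup C (take (Suc i) Xs @ drop (i + 2) Xs)
            (take i ds @ (ds ! i + ds ! Suc i) # drop (i + 2) ds)
            (take i fs
              @ dgcomp (augment K C) (Xs ! (i + 2)) (Xs ! Suc i) (Xs ! i) (ds ! i) (ds ! Suc i)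
                  (fs ! i) (fs ! Suc i)
              # drop (i + 2) fs))))"

definition relation_rhs ::
    "('k, 'r) ring_scheme \<Rightarrow> ('o, 'm, 'k) wudg_data \<Rightarrow> 'o list \<Rightarrow> int list \<Rightarrow> ('m \<times> 'k) list \<Rightarrow> 'm" where
  "relation_rhs K C Xs ds fs = (let n = length fs; M = dghom C (last Xs) (hd Xs) (sum_list ds + 2 - int n) in
      dgdiff C (last Xs) (hd Xs) (sum_list ds + 1 - int n) (wup C Xs ds fs)
      \<oplus>\<^bsub>M\<^esub>
      (\<Oplus>\<^bsub>M\<^esub> i\<in>{1..<n}.
          sgn_mult M (int (i - 1) + (1 - int (n - i)) * sum_list (take i ds))
          (dgcomp C (last Xs) (Xs ! i) (hd Xs)
            (sum_list (take i ds) + 1 - int i) (sum_list (drop i ds) + 1 - int (n - i))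
            (wup C (take (Suc i) Xs) (take i ds) (take i fs))
            (wup C (drop i Xs) (drop i ds) (drop i fs)))))"

section \<open>Degrees and closure of the terms of the A-infinity relation\<close>

lemma (in weakly_unital_dg_category) relation:
  assumes "composable (augment K A) Xs ds fs"
  shows "relation_lhs K A Xs ds fs = relation_rhs K A Xs ds fs"
proof -
  interpret P: a_inf_functor K "augment K A" A "\<lambda>X. X" "wup A" by (rule p_a_inf_functor)
  show ?thesis
    using P.Fm_relation[OF assms refl refl] by (simp only: relation_lhs_def relation_rhs_def Let_def)
qed

lemma (in nonunital_dg_category) composable_diff:
  assumes "composable A Xs ds fs" "i < length fs"
  shows "composable A Xs (ds[i := ds ! i + 1])
    (fs[i := dgdiff A (Xs ! Suc i) (Xs ! i) (ds ! i) (fs ! i)])"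
  by (rule composable_update[OF assms diff_closed]) (use assms composable_nth[OF assms(1)] in auto)

lemma (in nonunital_dg_category) composable_comp:
  assumes "composable A Xs ds fs" "Suc i < length fs"
  shows "composable A (take (Suc i) Xs @ drop (i + 2) Xs)
    (take i ds @ (ds ! i + ds ! Suc i) # drop (i + 2) ds)
    (take i fs @ dgcomp A (Xs ! (i + 2)) (Xs ! Suc i) (Xs ! i) (ds ! i) (ds ! Suc i)
                  (fs ! i) (fs ! Suc i) # drop (i + 2) fs)"
  by (rule composable_merge[OF assms comp_closed]) (use assms composable_nth[OF assms(1)] in auto)

lemma sum_list_update_int:
  "i < length ds \<Longrightarrow> sum_list (ds[i := x]) = sum_list ds + x - (ds ! i :: int)"
  by (induction ds arbitrary: i) (auto split: nat.split)

text \<open>The intermediate stage in which the dg axioms hold but nothing is known about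
  \<open>wup\<close> beyond closure. The dg axioms make the sums in the relation meaningful and give
  the augmented category, whose composition enters the left side.\<close>

locale wudg_closed_dg = wudg_closed K C + nonunital_dg_category K C
  for K :: "('k, 'r) ring_scheme" (structure) and C :: "('o, 'm, 'k) wudg_data"
begin

sublocale aug: nonunital_dg_category K "augment K C"
  by (rule augment_dg_category)

context
  fixes Xs ds fs n M
  assumes comp: "composable (augment K C) Xs ds fs"
    and n: "n = length fs"
    and M: "M = dghom C (last Xs) (hd Xs) (sum_list ds + 2 - int n)"
begin

lemma ends_module: "last Xs \<in> dgobj C" "hd Xs \<in> dgobj C" "module K M"
  using composable_ends[OF comp] by (auto simp: M augment_simps intro!: hom_module)

text \<open>Every term of the relation has degree \<open>2 - n\<close> relative to its inputs: a
  differential adds 1 to the degree \<open>1 - n\<close> of \<open>p_n\<close>, a merged string uses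
  \<open>p_(n-1)\<close>, and in a product \<open>(1 - i) + (1 - (n - i)) = 2 - n\<close>. This
  lemma and the next two record the three cases.\<close>

lemma degree_diff:
  assumes "i < n"
  shows "sum_list (ds[i := ds ! i + 1]) + 1 - int n = sum_list ds + 2 - int n"
  using assms composable_lengths[OF comp] n by (simp add: sum_list_update_int)

lemma merged_string:
  assumes "i < n - 1"
  shows "hd (take (Suc i) Xs @ drop (i + 2) Xs) = hd Xs"
      "last (take (Suc i) Xs @ drop (i + 2) Xs) = last Xs"
      "sum_list (take i ds @ (ds ! i + ds ! Suc i) # drop (i + 2) ds) = sum_list ds"
      "length (take i fs @ x # drop (i + 2) fs) = n - 1"
      "sum_list ds + 1 - int (n - 1) = sum_list ds + 2 - int n"
  using merge_ends[of Xs n i] sum_list_merge[of ds n i] assms n composable_lengths[OF comp] by auto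

lemma split_string:
  assumes "0 < i" "i < n"
  shows "hd (take (Suc i) Xs) = hd Xs" "last (take (Suc i) Xs) = Xs ! i"
      "hd (drop i Xs) = Xs ! i" "last (drop i Xs) = last Xs"
      "length (take i fs) = i" "length (drop i fs) = n - i"
      "(sum_list (take i ds) + 1 - int i) + (sum_list (drop i ds) + 1 - int (n - i))
        = sum_list ds + 2 - int n"
  using assms n composable_lengths[OF comp] sum_list_take_drop[of i ds]
  by (auto simp: hd_drop_conv_nth take_Suc_conv_app_nth)

lemma diff_term_closed:
  assumes i: "i < n"
  shows "wup C Xs (ds[i := ds ! i + 1])
      (fs[i := dgdiff (augment K C) (Xs ! Suc i) (Xs ! i) (ds ! i) (fs ! i)]) \<in> carrier M"
  using wup_in[OF aug.composable_diff[OF comp i[unfolded n]]]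
  unfolding length_list_update n[symmetric] degree_diff[OF i] M[symmetric] .

lemma comp_term_closed:
  assumes i: "i < n - 1"
  shows "wup C (take (Suc i) Xs @ drop (i + 2) Xs)
      (take i ds @ (ds ! i + ds ! Suc i) # drop (i + 2) ds)
      (take i fs @ dgcomp (augment K C) (Xs ! (i + 2)) (Xs ! Suc i) (Xs ! i) (ds ! i) (ds ! Suc i)
          (fs ! i) (fs ! Suc i) # drop (i + 2) fs) \<in> carrier M"
proof -
  have "Suc i < length fs" using i n by simp
  from wup_in[OF aug.composable_comp[OF comp this]] show ?thesis
    unfolding merged_string[OF i] M[symmetric] .
qed

lemma product_term_closed:
  assumes i: "0 < i" "i < n"
  shows "dgcomp C (last Xs) (Xs ! i) (hd Xs)
      (sum_list (take i ds) + 1 - int i) (sum_list (drop i ds) + 1 - int (n - i))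
      (wup C (take (Suc i) Xs) (take i ds) (take i fs))
      (wup C (drop i Xs) (drop i ds) (drop i fs)) \<in> carrier M"
proof -
  have l: "i \<le> length fs" "i < length fs" using i n by auto
  have o: "Xs ! i \<in> dgobj C"
    using composable_nth(2)[OF comp l(1)] by (simp add: augment_simps)
  note w = wup_in[OF composable_take[OF comp i(1) l(1)], unfolded split_string[OF i]]
    wup_in[OF composable_drop[OF comp l(2)], unfolded split_string[OF i]]
  show ?thesis
    using comp_in[OF ends_module(1) o ends_module(2) w] unfolding split_string[OF i] M[symmetric] .
qed

lemma relation_closed:
  "relation_lhs K C Xs ds fs \<in> carrier M" "relation_rhs K C Xs ds fs \<in> carrier M"
proof -
  interpret M: module K M by (rule ends_module)
  have d: "dgdiff C (last Xs) (hd Xs) (sum_list ds + 1 - int n) (wup C Xs ds fs) \<in> carrier M"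
    unfolding M n by (rule diff_in_eq[OF ends_module(1,2) wup_in[OF comp]]) simp
  show "relation_lhs K C Xs ds fs \<in> carrier M"
    unfolding relation_lhs_def Let_def n[symmetric] M[symmetric]
    by (intro M.a_closed M.finsum_closed Pi_I M.sgn_mult_closed diff_term_closed comp_term_closed)
      simp_all
  show "relation_rhs K C Xs ds fs \<in> carrier M"
    unfolding relation_rhs_def Let_def n[symmetric] M[symmetric]
    by (intro M.a_closed M.finsum_closed Pi_I M.sgn_mult_closed d product_term_closed) simp_all
qed

end

end

section \<open>Structure-preserving maps carry both sides of the relation along\<close>

locale dgwu_map_dg = dgwu_map K C D Fo Fm + C: wudg_closed_dg K C
  for K :: "('k, 'r) ring_scheme" (structure)
    and C :: "('o, 'm, 'k) wudg_data" and D :: "('p, 'n, 'k) wudg_data" and Fo Fm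
begin

lemma Fm_linear:
  "\<lbrakk>X \<in> dgobj C; Y \<in> dgobj C\<rbrakk>
    \<Longrightarrow> linear_map K (dghom C X Y n) (dghom D (Fo X) (Fo Y) n) (Fm X Y n)"
  by (auto simp: linear_map_def Fm_in Fm_add Fm_smult)

context
  fixes Xs ds fs n M N
  assumes comp: "composable (augment K C) Xs ds fs"
    and n: "n = length fs"
    and M: "M = dghom C (last Xs) (hd Xs) (sum_list ds + 2 - int n)"
    and N: "N = dghom D (Fo (last Xs)) (Fo (hd Xs)) (sum_list ds + 2 - int n)"
begin

abbreviation "gs \<equiv> map_string Fm Xs ds fs"

lemma ends_linear:
  "module K N" "linear_map K M N (Fm (last Xs) (hd Xs) (sum_list ds + 2 - int n))"
  using C.ends_module(1,2)[OF comp n M]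
  by (auto simp: M N intro!: D.hom_module Fm_linear Fo_in)

text \<open>By \<open>Fm_p\<close> the image of a value of \<open>wup\<close> is \<open>wup\<close>
  of the mapped string. What remains is that mapping a string commutes with differentiating one
  entry, which is \<open>aug_diff\<close>; the next lemma does the same for composing two neighbours
  by \<open>aug_comp\<close>.\<close>

lemma diff_term:
  assumes i: "i < n"
  shows "Fm (last Xs) (hd Xs) (sum_list ds + 2 - int n) (wup C Xs (ds[i := ds ! i + 1])
        (fs[i := dgdiff (augment K C) (Xs ! Suc i) (Xs ! i) (ds ! i) (fs ! i)]))
    = wup D (map Fo Xs) (ds[i := ds ! i + 1])
        (gs[i := dgdiff (augment K D) (map Fo Xs ! Suc i) (map Fo Xs ! i) (ds ! i) (gs ! i)])"
proof -
  note lens = composable_lengths[OF comp]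
  have o: "Xs ! i \<in> dgobj C" "Xs ! Suc i \<in> dgobj C"
    using composable_nth(2)[OF comp] i n by (auto simp: augment_simps)
  have u: "fs ! i \<in> carrier (aug_hom K C (Xs ! Suc i) (Xs ! i) (ds ! i))"
    using composable_nth(1)[OF comp] i n by (auto simp: augment_simps)
  have ms: "map_string Fm Xs (ds[i := ds ! i + 1])
        (fs[i := dgdiff (augment K C) (Xs ! Suc i) (Xs ! i) (ds ! i) (fs ! i)])
      = gs[i := dgdiff (augment K D) (map Fo Xs ! Suc i) (map Fo Xs ! i) (ds ! i) (gs ! i)]"
    using n i lens aug_diff[OF o(2,1) u] by (simp add: map_string_update)
  show ?thesis
    using Fm_p[OF C.aug.composable_diff[OF comp i[unfolded n]]]
    unfolding length_list_update n[symmetric] C.degree_diff[OF comp n M i] ms .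
qed

lemma comp_term:
  assumes i: "i < n - 1"
  shows "Fm (last Xs) (hd Xs) (sum_list ds + 2 - int n)
      (wup C (take (Suc i) Xs @ drop (i + 2) Xs)
        (take i ds @ (ds ! i + ds ! Suc i) # drop (i + 2) ds)
        (take i fs @ dgcomp (augment K C) (Xs ! (i + 2)) (Xs ! Suc i) (Xs ! i) (ds ! i) (ds ! Suc i)
            (fs ! i) (fs ! Suc i) # drop (i + 2) fs))
    = wup D (take (Suc i) (map Fo Xs) @ drop (i + 2) (map Fo Xs))
        (take i ds @ (ds ! i + ds ! Suc i) # drop (i + 2) ds)
        (take i gs @ dgcomp (augment K D) (map Fo Xs ! (i + 2)) (map Fo Xs ! Suc i) (map Fo Xs ! i)
            (ds ! i) (ds ! Suc i) (gs ! i) (gs ! Suc i) # drop (i + 2) gs)"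
proof -
  note lens = composable_lengths[OF comp]
  have l: "Suc i < length fs" using i n by simp
  have o: "Xs ! i \<in> dgobj C" "Xs ! Suc i \<in> dgobj C" "Xs ! Suc (Suc i) \<in> dgobj C"
    using composable_nth(2)[OF comp] l by (auto simp: augment_simps)
  have u: "fs ! i \<in> carrier (aug_hom K C (Xs ! Suc i) (Xs ! i) (ds ! i))"
      "fs ! Suc i \<in> carrier (aug_hom K C (Xs ! Suc (Suc i)) (Xs ! Suc i) (ds ! Suc i))"
    using composable_nth(1)[OF comp] l by (auto simp: augment_simps)
  have ms: "map_string Fm (take (Suc i) Xs @ drop (i + 2) Xs)
      (take i ds @ (ds ! i + ds ! Suc i) # drop (i + 2) ds)
      (take i fs @ dgcomp (augment K C) (Xs ! (i + 2)) (Xs ! Suc i) (Xs ! i) (ds ! i) (ds ! Suc i)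
            (fs ! i) (fs ! Suc i) # drop (i + 2) fs)
    = take i gs @ dgcomp (augment K D) (map Fo Xs ! (i + 2)) (map Fo Xs ! Suc i) (map Fo Xs ! i)
            (ds ! i) (ds ! Suc i) (gs ! i) (gs ! Suc i) # drop (i + 2) gs"
    using n i lens aug_comp[OF o(3,2,1) u] by (subst map_string_merge) auto
  show ?thesis
    using Fm_p[OF C.aug.composable_comp[OF comp l]] unfolding C.merged_string[OF comp n M i] ms
    by (simp add: take_map drop_map)
qed

text \<open>Here \<open>Fm_comp\<close> separates the two factors first, and \<open>Fm_p\<close>
  applies to the initial and the final segment of the string.\<close>

lemma product_term:
  assumes i: "0 < i" "i < n"
  shows "Fm (last Xs) (hd Xs) (sum_list ds + 2 - int n)
      (dgcomp C (last Xs) (Xs ! i) (hd Xs)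
        (sum_list (take i ds) + 1 - int i) (sum_list (drop i ds) + 1 - int (n - i))
        (wup C (take (Suc i) Xs) (take i ds) (take i fs))
        (wup C (drop i Xs) (drop i ds) (drop i fs)))
    = dgcomp D (Fo (last Xs)) (map Fo Xs ! i) (Fo (hd Xs))
        (sum_list (take i ds) + 1 - int i) (sum_list (drop i ds) + 1 - int (n - i))
        (wup D (take (Suc i) (map Fo Xs)) (take i ds) (take i gs))
        (wup D (drop i (map Fo Xs)) (drop i ds) (drop i gs))"
proof -
  note lens = composable_lengths[OF comp]
  have l: "i \<le> length fs" "i < length fs" using i n by auto
  note c = composable_take[OF comp i(1) l(1)] composable_drop[OF comp l(2)]
  note split = C.split_string[OF comp n M i]
  have o: "Xs ! i \<in> dgobj C"
    using composable_nth(2)[OF comp l(1)] by (simp add: augment_simps)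
  note w = C.wup_in[OF c(1), unfolded split] C.wup_in[OF c(2), unfolded split]
  show ?thesis
    using Fm_comp[OF C.ends_module(1)[OF comp n M] o C.ends_module(2)[OF comp n M] w]
      Fm_p[OF c(1)] Fm_p[OF c(2)] i n lens
    unfolding split
    by (simp add: map_string_take map_string_drop take_map drop_map)
qed

lemma map_relation:
  "Fm (last Xs) (hd Xs) (sum_list ds + 2 - int n) (relation_lhs K C Xs ds fs)
    = relation_lhs K D (map Fo Xs) ds gs"
  "Fm (last Xs) (hd Xs) (sum_list ds + 2 - int n) (relation_rhs K C Xs ds fs)
    = relation_rhs K D (map Fo Xs) ds gs"
proof -
  note ends_module = C.ends_module[OF comp n M]
  interpret M: module K M by (rule ends_module)
  interpret N: module K N by (rule ends_linear)
  let ?F = "Fm (last Xs) (hd Xs) (sum_list ds + 2 - int n)"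
  note F = linear_mapD[OF ends_linear(2)]
  \<comment> \<open>The common shape of the three sums. Signs and index sets agree in source and
    target because they depend only on degrees and lengths, which mapping leaves alone.\<close>
  have F_sum: "?F (\<Oplus>\<^bsub>M\<^esub>i\<in>S. sgn_mult M (s i) (t i)) = (\<Oplus>\<^bsub>N\<^esub>i\<in>S. sgn_mult N (s i) (u i))"
    "(\<Oplus>\<^bsub>M\<^esub>i\<in>S. sgn_mult M (s i) (t i)) \<in> carrier M"
    if "finite S" "\<And>i. i \<in> S \<Longrightarrow> t i \<in> carrier M" "\<And>i. i \<in> S \<Longrightarrow> ?F (t i) = u i"
    for S :: "nat set" and s t u
  proof -
    have "?F (\<Oplus>\<^bsub>M\<^esub>i\<in>S. sgn_mult M (s i) (t i)) = (\<Oplus>\<^bsub>N\<^esub>i\<in>S. ?F (sgn_mult M (s i) (t i)))"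
      by (rule linear_map_finsum[OF ends_module(3) ends_linear that(1)])
        (use that(2) M.sgn_mult_closed in auto)
    also have "\<dots> = (\<Oplus>\<^bsub>N\<^esub>i\<in>S. sgn_mult N (s i) (u i))"
      using that(2,3) F(1)[OF that(2)]
      by (intro N.finsum_cong' refl Pi_I)
        (auto simp: linear_map_sgn_mult[OF ends_module(3) ends_linear] N.sgn_mult_closed)
    finally show "?F (\<Oplus>\<^bsub>M\<^esub>i\<in>S. sgn_mult M (s i) (t i)) = (\<Oplus>\<^bsub>N\<^esub>i\<in>S. sgn_mult N (s i) (u i))" .
    show "(\<Oplus>\<^bsub>M\<^esub>i\<in>S. sgn_mult M (s i) (t i)) \<in> carrier M"
      using that(2) by (intro M.finsum_closed Pi_I M.sgn_mult_closed)
  qed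
  note cl = C.diff_term_closed[OF comp n M] C.comp_term_closed[OF comp n M]
    C.product_term_closed[OF comp n M]
  have ends: "hd (map Fo Xs) = Fo (hd Xs)" "last (map Fo Xs) = Fo (last Xs)" "length gs = n"
    using composable_lengths[OF comp] n by (simp_all add: hd_map last_map)
  have i1: "i < n" if "i \<in> {..<n}" for i using that by simp
  have i2: "i < n - 1" if "i \<in> {..<n - 1}" for i using that by simp
  have i3: "0 < i" "i < n" if "i \<in> {1..<n}" for i using that by simp_all
  have d: "dgdiff C (last Xs) (hd Xs) (sum_list ds + 1 - int n) (wup C Xs ds fs) \<in> carrier M"
    unfolding M n by (rule C.diff_in_eq[OF ends_module(1,2) C.wup_in[OF comp]]) simp
  have Fd: "?F (dgdiff C (last Xs) (hd Xs) (sum_list ds + 1 - int n) (wup C Xs ds fs))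
      = dgdiff D (Fo (last Xs)) (Fo (hd Xs)) (sum_list ds + 1 - int n) (wup D (map Fo Xs) ds gs)"
    unfolding n Fm_p[OF comp, symmetric]
    by (rule Fm_diff_eq[OF ends_module(1,2) C.wup_in[OF comp]]) simp
  note sum1 = F_sum[OF finite_lessThan cl(1)[OF i1] diff_term[OF i1]]
    and sum2 = F_sum[OF finite_lessThan cl(2)[OF i2] comp_term[OF i2]]
    and sum3 = F_sum[OF finite_atLeastLessThan cl(3)[OF i3] product_term[OF i3]]
  show "?F (relation_lhs K C Xs ds fs) = relation_lhs K D (map Fo Xs) ds gs"
    unfolding relation_lhs_def Let_def n[symmetric] M[symmetric] ends N[symmetric]
    by (subst F(2)[OF sum1(2) sum2(2)]) (assumption | rule arg_cong2[where f = "add N", OF sum1(1) sum2(1)])+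
  show "?F (relation_rhs K C Xs ds fs) = relation_rhs K D (map Fo Xs) ds gs"
    unfolding relation_rhs_def Let_def n[symmetric] M[symmetric] ends N[symmetric]
    by (subst F(2)[OF d sum3(2)]) (assumption | rule arg_cong2[where f = "add N", OF Fd sum3(1)])+
qed

end

end

text \<open>Faithfulness concerns morphisms only, since every axiom equates parallel morphisms and
  never two objects. The index set \<open>I\<close> carries no size restriction, which later allows
  all cocones as indices.\<close>

locale jointly_faithful = C: wudg_closed K C
  for K :: "('k, 'r) ring_scheme" (structure) and C :: "('o, 'm, 'k) wudg_data" +
  fixes I :: "'i set" and A :: "'i \<Rightarrow> ('p, 'n, 'k) wudg_data"
    and Po :: "'i \<Rightarrow> 'o \<Rightarrow> 'p" and Pm :: "'i \<Rightarrow> 'o \<Rightarrow> 'o \<Rightarrow> int \<Rightarrow> 'm \<Rightarrow> 'n"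
  assumes maps: "i \<in> I \<Longrightarrow> dgwu_map K C (A i) (Po i) (Pm i)"
    and faithful: "\<lbrakk>X \<in> dgobj C; Y \<in> dgobj C; f \<in> carrier (dghom C X Y n);
        g \<in> carrier (dghom C X Y n); \<And>i. i \<in> I \<Longrightarrow> Pm i X Y n f = Pm i X Y n g\<rbrakk> \<Longrightarrow> f = g"
begin

lemma hom_module:
  assumes o: "X \<in> dgobj C" "Y \<in> dgobj C"
  shows "module K (dghom C X Y n)"
proof -
  note cl = C.zero_in[OF o] C.add_in[OF o] C.smult_in[OF o]
  have Pm: "module K (dghom (A i) (Po i X) (Po i Y) n)"
    "\<And>f. f \<in> carrier (dghom C X Y n) \<Longrightarrow> Pm i X Y n f \<in> carrier (dghom (A i) (Po i X) (Po i Y) n)"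
    "Pm i X Y n \<zero>\<^bsub>dghom C X Y n\<^esub> = \<zero>\<^bsub>dghom (A i) (Po i X) (Po i Y) n\<^esub>"
    "\<And>f g. \<lbrakk>f \<in> carrier (dghom C X Y n); g \<in> carrier (dghom C X Y n)\<rbrakk>
      \<Longrightarrow> Pm i X Y n (f \<oplus>\<^bsub>dghom C X Y n\<^esub> g)
        = Pm i X Y n f \<oplus>\<^bsub>dghom (A i) (Po i X) (Po i Y) n\<^esub> Pm i X Y n g"
    "\<And>a f. \<lbrakk>a \<in> carrier K; f \<in> carrier (dghom C X Y n)\<rbrakk>
      \<Longrightarrow> Pm i X Y n (a \<odot>\<^bsub>dghom C X Y n\<^esub> f) = a \<odot>\<^bsub>dghom (A i) (Po i X) (Po i Y) n\<^esub> Pm i X Y n f"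
    if "i \<in> I" for i
  proof -
    interpret P: dgwu_map K C "A i" "Po i" "Pm i" by (rule maps) fact
    show "module K (dghom (A i) (Po i X) (Po i Y) n)"
      by (rule P.D.hom_module) (use o P.Fo_in in auto)
  qed (use that o maps in \<open>auto intro: dgwu_map.Fm_in dgwu_map.Fm_zero dgwu_map.Fm_add dgwu_map.Fm_smult\<close>)
  note eqI = faithful[OF o]
  show ?thesis
  proof (rule moduleI)
    show "cring K" by (rule C.is_cring)
    show "abelian_group (dghom C X Y n)"
    proof (rule abelian_groupI)
      fix f g h
      assume f: "f \<in> carrier (dghom C X Y n)"
      show "\<exists>g\<in>carrier (dghom C X Y n). g \<oplus>\<^bsub>dghom C X Y n\<^esub> f = \<zero>\<^bsub>dghom C X Y n\<^esub>"
      proof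
        \<comment> \<open>Negation is not one of the operations under which \<open>C\<close> is
          closed, so the inverse is built as the multiple by -1.\<close>
        show "(\<ominus> \<one>) \<odot>\<^bsub>dghom C X Y n\<^esub> f \<in> carrier (dghom C X Y n)"
          using f by (simp add: cl)
        show "(\<ominus> \<one>) \<odot>\<^bsub>dghom C X Y n\<^esub> f \<oplus>\<^bsub>dghom C X Y n\<^esub> f = \<zero>\<^bsub>dghom C X Y n\<^esub>"
        proof (rule eqI)
          fix i assume i: "i \<in> I"
          interpret M: module K "dghom (A i) (Po i X) (Po i Y) n" by (rule Pm) fact
          show "Pm i X Y n ((\<ominus> \<one>) \<odot>\<^bsub>dghom C X Y n\<^esub> f \<oplus>\<^bsub>dghom C X Y n\<^esub> f)
              = Pm i X Y n \<zero>\<^bsub>dghom C X Y n\<^esub>"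
            using f i by (simp add: cl Pm M.smult_l_minus M.l_neg)
        qed (use f in \<open>auto simp: cl\<close>)
      qed
      assume g: "g \<in> carrier (dghom C X Y n)"
      show "f \<oplus>\<^bsub>dghom C X Y n\<^esub> g = g \<oplus>\<^bsub>dghom C X Y n\<^esub> f"
      proof (rule eqI)
        fix i assume i: "i \<in> I"
        interpret M: module K "dghom (A i) (Po i X) (Po i Y) n" by (rule Pm) fact
        show "Pm i X Y n (f \<oplus>\<^bsub>dghom C X Y n\<^esub> g) = Pm i X Y n (g \<oplus>\<^bsub>dghom C X Y n\<^esub> f)"
          using f g i by (simp add: Pm M.a_comm)
      qed (use f g in \<open>auto simp: cl\<close>)
      assume h: "h \<in> carrier (dghom C X Y n)"
      show "f \<oplus>\<^bsub>dghom C X Y n\<^esub> g \<oplus>\<^bsub>dghom C X Y n\<^esub> h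
          = f \<oplus>\<^bsub>dghom C X Y n\<^esub> (g \<oplus>\<^bsub>dghom C X Y n\<^esub> h)"
      proof (rule eqI)
        fix i assume i: "i \<in> I"
        interpret M: module K "dghom (A i) (Po i X) (Po i Y) n" by (rule Pm) fact
        show "Pm i X Y n (f \<oplus>\<^bsub>dghom C X Y n\<^esub> g \<oplus>\<^bsub>dghom C X Y n\<^esub> h)
            = Pm i X Y n (f \<oplus>\<^bsub>dghom C X Y n\<^esub> (g \<oplus>\<^bsub>dghom C X Y n\<^esub> h))"
          using f g h i by (simp add: cl Pm M.a_assoc)
      qed (use f g h in \<open>auto simp: cl\<close>)
    next
      fix f assume f: "f \<in> carrier (dghom C X Y n)"
      show "\<zero>\<^bsub>dghom C X Y n\<^esub> \<oplus>\<^bsub>dghom C X Y n\<^esub> f = f"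
      proof (rule eqI)
        fix i assume i: "i \<in> I"
        interpret M: module K "dghom (A i) (Po i X) (Po i Y) n" by (rule Pm) fact
        show "Pm i X Y n (\<zero>\<^bsub>dghom C X Y n\<^esub> \<oplus>\<^bsub>dghom C X Y n\<^esub> f) = Pm i X Y n f"
          using f i by (simp add: cl Pm)
      qed (use f in \<open>auto simp: cl\<close>)
    qed (auto simp: cl)
  next
    fix a b f g
    assume a: "a \<in> carrier K"
    assume f: "f \<in> carrier (dghom C X Y n)"
    show "a \<odot>\<^bsub>dghom C X Y n\<^esub> f \<in> carrier (dghom C X Y n)"
      using a f by (simp add: cl)
    show "a \<odot>\<^bsub>dghom C X Y n\<^esub> (f \<oplus>\<^bsub>dghom C X Y n\<^esub> g)
        = a \<odot>\<^bsub>dghom C X Y n\<^esub> f \<oplus>\<^bsub>dghom C X Y n\<^esub> a \<odot>\<^bsub>dghom C X Y n\<^esub> g"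
      if g: "g \<in> carrier (dghom C X Y n)"
    proof (rule eqI)
      fix i assume i: "i \<in> I"
      interpret M: module K "dghom (A i) (Po i X) (Po i Y) n" by (rule Pm) fact
      show "Pm i X Y n (a \<odot>\<^bsub>dghom C X Y n\<^esub> (f \<oplus>\<^bsub>dghom C X Y n\<^esub> g))
          = Pm i X Y n (a \<odot>\<^bsub>dghom C X Y n\<^esub> f \<oplus>\<^bsub>dghom C X Y n\<^esub> a \<odot>\<^bsub>dghom C X Y n\<^esub> g)"
        using a f g i by (simp add: cl Pm M.smult_r_distr)
    qed (use a f g in \<open>auto simp: cl\<close>)
    assume b: "b \<in> carrier K"
    show "(a \<oplus> b) \<odot>\<^bsub>dghom C X Y n\<^esub> f
        = a \<odot>\<^bsub>dghom C X Y n\<^esub> f \<oplus>\<^bsub>dghom C X Y n\<^esub> b \<odot>\<^bsub>dghom C X Y n\<^esub> f"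
    proof (rule eqI)
      fix i assume i: "i \<in> I"
      interpret M: module K "dghom (A i) (Po i X) (Po i Y) n" by (rule Pm) fact
      show "Pm i X Y n ((a \<oplus> b) \<odot>\<^bsub>dghom C X Y n\<^esub> f)
          = Pm i X Y n (a \<odot>\<^bsub>dghom C X Y n\<^esub> f \<oplus>\<^bsub>dghom C X Y n\<^esub> b \<odot>\<^bsub>dghom C X Y n\<^esub> f)"
        using a b f i by (simp add: cl Pm M.smult_l_distr)
    qed (use a b f in \<open>auto simp: cl\<close>)
    show "(a \<otimes> b) \<odot>\<^bsub>dghom C X Y n\<^esub> f
        = a \<odot>\<^bsub>dghom C X Y n\<^esub> (b \<odot>\<^bsub>dghom C X Y n\<^esub> f)"
    proof (rule eqI)
      fix i assume i: "i \<in> I"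
      interpret M: module K "dghom (A i) (Po i X) (Po i Y) n" by (rule Pm) fact
      show "Pm i X Y n ((a \<otimes> b) \<odot>\<^bsub>dghom C X Y n\<^esub> f)
          = Pm i X Y n (a \<odot>\<^bsub>dghom C X Y n\<^esub> (b \<odot>\<^bsub>dghom C X Y n\<^esub> f))"
        using a b f i by (simp add: cl Pm M.smult_assoc1)
    qed (use a b f in \<open>auto simp: cl\<close>)
  next
    fix f assume f: "f \<in> carrier (dghom C X Y n)"
    show "\<one> \<odot>\<^bsub>dghom C X Y n\<^esub> f = f"
    proof (rule eqI)
      fix i assume i: "i \<in> I"
      interpret M: module K "dghom (A i) (Po i X) (Po i Y) n" by (rule Pm) fact
      show "Pm i X Y n (\<one> \<odot>\<^bsub>dghom C X Y n\<^esub> f) = Pm i X Y n f"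
        using f i by (simp add: cl Pm)
    qed (use f in \<open>auto simp: cl\<close>)
  qed
qed

lemma nonunital: "nonunital_dg_category K C"
proof (rule nonunital_dg_category.intro[OF C.field_axioms nonunital_dg_category_axioms.intro])
  fix X Y n assume o: "X \<in> dgobj C" "Y \<in> dgobj C"
  show "module K (dghom C X Y n)" by (rule hom_module[OF o])
  have "dgdiff C X Y n (f \<oplus>\<^bsub>dghom C X Y n\<^esub> g)
      = dgdiff C X Y n f \<oplus>\<^bsub>dghom C X Y (n + 1)\<^esub> dgdiff C X Y n g"
    if f: "f \<in> carrier (dghom C X Y n)" and g: "g \<in> carrier (dghom C X Y n)" for f g
  proof (rule faithful[OF o])
    fix i assume "i \<in> I"
    interpret P: dgwu_map K C "A i" "Po i" "Pm i" by (rule maps) fact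
    show "Pm i X Y (n + 1) (dgdiff C X Y n (f \<oplus>\<^bsub>dghom C X Y n\<^esub> g))
        = Pm i X Y (n + 1) (dgdiff C X Y n f \<oplus>\<^bsub>dghom C X Y (n + 1)\<^esub> dgdiff C X Y n g)"
      using o f g by (simp add: C.add_in C.diff_in P.Fm_add P.Fm_diff P.Fm_in P.Fo_in P.D.diff_simps)
  qed (use o f g in \<open>auto simp: C.add_in C.diff_in\<close>)
  moreover have "dgdiff C X Y n (a \<odot>\<^bsub>dghom C X Y n\<^esub> f)
      = a \<odot>\<^bsub>dghom C X Y (n + 1)\<^esub> dgdiff C X Y n f"
    if a: "a \<in> carrier K" and f: "f \<in> carrier (dghom C X Y n)" for a f
  proof (rule faithful[OF o])
    fix i assume "i \<in> I"
    interpret P: dgwu_map K C "A i" "Po i" "Pm i" by (rule maps) fact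
    show "Pm i X Y (n + 1) (dgdiff C X Y n (a \<odot>\<^bsub>dghom C X Y n\<^esub> f))
        = Pm i X Y (n + 1) (a \<odot>\<^bsub>dghom C X Y (n + 1)\<^esub> dgdiff C X Y n f)"
      using o a f by (simp add: C.smult_in C.diff_in P.Fm_smult P.Fm_diff P.Fm_in P.Fo_in P.D.diff_simps)
  qed (use o a f in \<open>auto simp: C.smult_in C.diff_in\<close>)
  ultimately show "linear_map K (dghom C X Y n) (dghom C X Y (n + 1)) (dgdiff C X Y n)"
    using o by (simp add: linear_map_def C.diff_in)
  fix f assume f: "f \<in> carrier (dghom C X Y n)"
  show "dgdiff C X Y (n + 1) (dgdiff C X Y n f) = \<zero>\<^bsub>dghom C X Y (n + 2)\<^esub>"
  proof (rule faithful[OF o])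
    fix i assume "i \<in> I"
    interpret P: dgwu_map K C "A i" "Po i" "Pm i" by (rule maps) fact
    show "Pm i X Y (n + 2) (dgdiff C X Y (n + 1) (dgdiff C X Y n f))
        = Pm i X Y (n + 2) \<zero>\<^bsub>dghom C X Y (n + 2)\<^esub>"
      using o f by (simp add: C.diff_in P.Fm_diff_eq P.Fm_in P.Fo_in P.Fm_zero P.D.diff_diff)
  qed (use o f in \<open>auto simp: C.diff_in_eq C.zero_in\<close>)
next
  fix X Y Z m n g
  assume o: "X \<in> dgobj C" "Y \<in> dgobj C" "Z \<in> dgobj C" and g: "g \<in> carrier (dghom C X Y n)"
  have "dgcomp C X Y Z m n (f \<oplus>\<^bsub>dghom C Y Z m\<^esub> f') g
      = dgcomp C X Y Z m n f g \<oplus>\<^bsub>dghom C X Z (m + n)\<^esub> dgcomp C X Y Z m n f' g"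
    if f: "f \<in> carrier (dghom C Y Z m)" "f' \<in> carrier (dghom C Y Z m)" for f f'
  proof (rule faithful[OF o(1,3)])
    fix i assume "i \<in> I"
    interpret P: dgwu_map K C "A i" "Po i" "Pm i" by (rule maps) fact
    show "Pm i X Z (m + n) (dgcomp C X Y Z m n (f \<oplus>\<^bsub>dghom C Y Z m\<^esub> f') g)
        = Pm i X Z (m + n) (dgcomp C X Y Z m n f g \<oplus>\<^bsub>dghom C X Z (m + n)\<^esub> dgcomp C X Y Z m n f' g)"
      using o f g by (simp add: C.add_in C.comp_in P.Fm_add P.Fm_comp P.Fm_in P.Fo_in P.D.comp_bilinear)
  qed (use o f g in \<open>auto simp: C.add_in C.comp_in\<close>)
  moreover have "dgcomp C X Y Z m n (a \<odot>\<^bsub>dghom C Y Z m\<^esub> f) g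
      = a \<odot>\<^bsub>dghom C X Z (m + n)\<^esub> dgcomp C X Y Z m n f g"
    if f: "a \<in> carrier K" "f \<in> carrier (dghom C Y Z m)" for a f
  proof (rule faithful[OF o(1,3)])
    fix i assume "i \<in> I"
    interpret P: dgwu_map K C "A i" "Po i" "Pm i" by (rule maps) fact
    show "Pm i X Z (m + n) (dgcomp C X Y Z m n (a \<odot>\<^bsub>dghom C Y Z m\<^esub> f) g)
        = Pm i X Z (m + n) (a \<odot>\<^bsub>dghom C X Z (m + n)\<^esub> dgcomp C X Y Z m n f g)"
      using o f g by (simp add: C.smult_in C.comp_in P.Fm_smult P.Fm_comp P.Fm_in P.Fo_in P.D.comp_bilinear)
  qed (use o f g in \<open>auto simp: C.smult_in C.comp_in\<close>)
  ultimately show "linear_map K (dghom C Y Z m) (dghom C X Z (m + n)) (\<lambda>f. dgcomp C X Y Z m n f g)"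
    using o g by (simp add: linear_map_def C.comp_in)
next
  fix X Y Z m n f
  assume o: "X \<in> dgobj C" "Y \<in> dgobj C" "Z \<in> dgobj C" and f: "f \<in> carrier (dghom C Y Z m)"
  have "dgcomp C X Y Z m n f (g \<oplus>\<^bsub>dghom C X Y n\<^esub> g')
      = dgcomp C X Y Z m n f g \<oplus>\<^bsub>dghom C X Z (m + n)\<^esub> dgcomp C X Y Z m n f g'"
    if g: "g \<in> carrier (dghom C X Y n)" "g' \<in> carrier (dghom C X Y n)" for g g'
  proof (rule faithful[OF o(1,3)])
    fix i assume "i \<in> I"
    interpret P: dgwu_map K C "A i" "Po i" "Pm i" by (rule maps) fact
    show "Pm i X Z (m + n) (dgcomp C X Y Z m n f (g \<oplus>\<^bsub>dghom C X Y n\<^esub> g'))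
        = Pm i X Z (m + n) (dgcomp C X Y Z m n f g \<oplus>\<^bsub>dghom C X Z (m + n)\<^esub> dgcomp C X Y Z m n f g')"
      using o f g by (simp add: C.add_in C.comp_in P.Fm_add P.Fm_comp P.Fm_in P.Fo_in P.D.comp_bilinear)
  qed (use o f g in \<open>auto simp: C.add_in C.comp_in\<close>)
  moreover have "dgcomp C X Y Z m n f (a \<odot>\<^bsub>dghom C X Y n\<^esub> g)
      = a \<odot>\<^bsub>dghom C X Z (m + n)\<^esub> dgcomp C X Y Z m n f g"
    if g: "a \<in> carrier K" "g \<in> carrier (dghom C X Y n)" for a g
  proof (rule faithful[OF o(1,3)])
    fix i assume "i \<in> I"
    interpret P: dgwu_map K C "A i" "Po i" "Pm i" by (rule maps) fact
    show "Pm i X Z (m + n) (dgcomp C X Y Z m n f (a \<odot>\<^bsub>dghom C X Y n\<^esub> g))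
        = Pm i X Z (m + n) (a \<odot>\<^bsub>dghom C X Z (m + n)\<^esub> dgcomp C X Y Z m n f g)"
      using o f g by (simp add: C.smult_in C.comp_in P.Fm_smult P.Fm_comp P.Fm_in P.Fo_in P.D.comp_bilinear)
  qed (use o f g in \<open>auto simp: C.smult_in C.comp_in\<close>)
  ultimately show "linear_map K (dghom C X Y n) (dghom C X Z (m + n)) (\<lambda>g. dgcomp C X Y Z m n f g)"
    using o f by (simp add: linear_map_def C.comp_in)
next
  fix W X Y Z l m n f g h
  assume o: "W \<in> dgobj C" "X \<in> dgobj C" "Y \<in> dgobj C" "Z \<in> dgobj C"
    and f: "f \<in> carrier (dghom C Y Z l)" and g: "g \<in> carrier (dghom C X Y m)"
    and h: "h \<in> carrier (dghom C W X n)"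
  show "dgcomp C W X Z (l + m) n (dgcomp C X Y Z l m f g) h
      = dgcomp C W Y Z l (m + n) f (dgcomp C W X Y m n g h)"
  proof (rule faithful[OF o(1,4)])
    fix i assume "i \<in> I"
    interpret P: dgwu_map K C "A i" "Po i" "Pm i" by (rule maps) fact
    show "Pm i W Z (l + m + n) (dgcomp C W X Z (l + m) n (dgcomp C X Y Z l m f g) h)
        = Pm i W Z (l + m + n) (dgcomp C W Y Z l (m + n) f (dgcomp C W X Y m n g h))"
      using o f g h by (simp add: C.comp_in P.Fm_comp_eq P.Fm_in P.Fo_in P.D.comp_assoc)
  qed (use o f g h in \<open>auto simp: C.comp_in_eq\<close>)
next
  fix X Y Z m n f g
  assume o: "X \<in> dgobj C" "Y \<in> dgobj C" "Z \<in> dgobj C"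
    and f: "f \<in> carrier (dghom C Y Z m)" and g: "g \<in> carrier (dghom C X Y n)"
  let ?M = "dghom C X Z (m + n + 1)"
  have deg: "m + (n + 1) = m + n + 1" "m + 1 + n = m + n + 1" by simp_all
  note cl = C.diff_in[OF o(1,3) C.comp_in[OF o f g]]
    C.comp_in[OF o C.diff_in[OF o(2,3) f] g, unfolded deg]
    C.comp_in[OF o f C.diff_in[OF o(1,2) g], unfolded deg]
  \<comment> \<open>The sign in the Leibniz rule is an additive inverse. Projections preserve it
    because they are linear maps between modules, so the module structure of \<open>C\<close> has to
    be available at this point.\<close>
  interpret M: module K ?M by (rule hom_module) fact+
  show "dgdiff C X Z (m + n) (dgcomp C X Y Z m n f g)
      = dgcomp C X Y Z (m + 1) n (dgdiff C Y Z m f) g \<oplus>\<^bsub>?M\<^esub>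
        sgn_mult ?M m (dgcomp C X Y Z m (n + 1) f (dgdiff C X Y n g))"
  proof (rule faithful[OF o(1,3)])
    fix i assume "i \<in> I"
    interpret P: dgwu_map K C "A i" "Po i" "Pm i" by (rule maps) fact
    have lin: "linear_map K ?M (dghom (A i) (Po i X) (Po i Z) (m + n + 1)) (Pm i X Z (m + n + 1))"
      using o by (auto simp: linear_map_def P.Fm_in P.Fm_add P.Fm_smult)
    have sg: "Pm i X Z (m + n + 1) (sgn_mult ?M m x)
        = sgn_mult (dghom (A i) (Po i X) (Po i Z) (m + n + 1)) m (Pm i X Z (m + n + 1) x)"
      if "x \<in> carrier ?M" for x
      using linear_map_sgn_mult[OF hom_module P.D.hom_module lin that] o P.Fo_in by blast
    show "Pm i X Z (m + n + 1) (dgdiff C X Z (m + n) (dgcomp C X Y Z m n f g))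
        = Pm i X Z (m + n + 1) (dgcomp C X Y Z (m + 1) n (dgdiff C Y Z m f) g \<oplus>\<^bsub>?M\<^esub>
            sgn_mult ?M m (dgcomp C X Y Z m (n + 1) f (dgdiff C X Y n g)))"
      unfolding linear_mapD(2)[OF lin cl(2) M.sgn_mult_closed[OF cl(3)]] sg[OF cl(3)]
      using o f g
      by (simp only: P.Fm_diff_eq P.Fm_comp_eq C.comp_in C.diff_in deg P.D.leibniz P.Fm_in P.Fo_in)
  qed (use cl in \<open>auto simp: M.sgn_mult_closed\<close>)
qed

end

section \<open>Reflecting the A-infinity relation and the unit axioms\<close>

lemma composable_incl:
  assumes "composable A Xs ds fs" "field K"
  shows "composable (augment K A) Xs ds (map (\<lambda>f. (f, \<zero>\<^bsub>K\<^esub>)) fs)"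
proof -
  interpret field K by fact
  show ?thesis
    using assms(1) by (auto simp: composable_def augment_simps aug_hom_simps)
qed

context jointly_faithful
begin

text \<open>Multilinearity is reflected one argument at a time with the others frozen; the relation
  is reflected as a whole, by projecting its two sides with \<open>map_relation\<close>.\<close>

lemma wup_a_inf_functor: "a_inf_functor K (augment K C) C (\<lambda>X. X) (wup C)"
proof (intro a_inf_functor.intro a_inf_functor_axioms.intro)
  interpret N: nonunital_dg_category K C by (rule nonunital)
  interpret Cd: wudg_closed_dg K C ..
  show "nonunital_dg_category K (augment K C)" by (rule N.augment_dg_category)
  show "nonunital_dg_category K C" by (rule nonunital)
  fix Xs ds and fs :: "('m \<times> 'k) list"
  assume c: "composable (augment K C) Xs ds fs"
  note ends = composable_ends[OF c, unfolded augment_simps]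
  {
    fix j assume j: "j < length fs"
    let ?X = "Xs ! Suc j" and ?Y = "Xs ! j" and ?d = "ds ! j"
    let ?n = "sum_list ds + 1 - int (length fs)"
    have o: "?X \<in> dgobj C" "?Y \<in> dgobj C"
      using composable_nth(2)[OF c] j by (auto simp: augment_simps)
    have cu: "composable (augment K C) Xs ds (fs[j := v])" if "v \<in> carrier (aug_hom K C ?X ?Y ?d)" for v
      using composable_update[OF c j, of v ?d] that by (simp add: augment_simps)
    have wu: "wup C Xs ds (fs[j := v]) \<in> carrier (dghom C (last Xs) (hd Xs) ?n)"
      if "v \<in> carrier (aug_hom K C ?X ?Y ?d)" for v
      using C.wup_in[OF cu[OF that]] by simp
    \<comment> \<open>Projecting after replacing entry \<open>j\<close> equals replacing entry
      \<open>j\<close> of the projected string by the projected vector. Linearity in that entry thus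
      reduces to linearity in the factor \<open>A i\<close>.\<close>
    have PW: "Pm i (last Xs) (hd Xs) ?n (wup C Xs ds (fs[j := v]))
        = wup (A i) (map (Po i) Xs) ds ((map_string (Pm i) Xs ds fs)[j := map_prod (Pm i ?X ?Y ?d) id v])"
      if "i \<in> I" "v \<in> carrier (aug_hom K C ?X ?Y ?d)" for i v
    proof -
      interpret P: dgwu_map K C "A i" "Po i" "Pm i" by (rule maps) fact
      show ?thesis
        using P.Fm_p[OF cu[OF that(2)]] map_string_update[of j fs ds "Pm i" Xs ?d v]
          composable_lengths[OF c] j by simp
    qed
    have lin: "linear_map K (aug_hom K (A i) (Po i ?X) (Po i ?Y) ?d)
        (dghom (A i) (Po i (last Xs)) (Po i (hd Xs)) ?n)
        (\<lambda>v. wup (A i) (map (Po i) Xs) ds ((map_string (Pm i) Xs ds fs)[j := v]))"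
      if "i \<in> I" for i
    proof -
      interpret P: dgwu_map K C "A i" "Po i" "Pm i" by (rule maps) fact
      interpret F: a_inf_functor K "augment K (A i)" "A i" "\<lambda>X. X" "wup (A i)"
        by (rule P.D.p_a_inf_functor)
      show ?thesis
        using F.Fm_multilinear[OF P.composable_map_string[OF c], of j] j composable_lengths[OF c]
        by (simp add: augment_simps hd_map last_map)
    qed
    have AH: "u \<oplus>\<^bsub>aug_hom K C ?X ?Y ?d\<^esub> v \<in> carrier (aug_hom K C ?X ?Y ?d)"
      "a \<in> carrier K \<Longrightarrow> a \<odot>\<^bsub>aug_hom K C ?X ?Y ?d\<^esub> v \<in> carrier (aug_hom K C ?X ?Y ?d)"
      if "u \<in> carrier (aug_hom K C ?X ?Y ?d)" "v \<in> carrier (aug_hom K C ?X ?Y ?d)" for u v a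
    proof -
      interpret AH: module K "aug_hom K C ?X ?Y ?d" by (rule aug_hom_module[OF hom_module[OF o]])
      show "u \<oplus>\<^bsub>aug_hom K C ?X ?Y ?d\<^esub> v \<in> carrier (aug_hom K C ?X ?Y ?d)"
        "a \<in> carrier K \<Longrightarrow> a \<odot>\<^bsub>aug_hom K C ?X ?Y ?d\<^esub> v \<in> carrier (aug_hom K C ?X ?Y ?d)"
        using that by auto
    qed
    have "wup C Xs ds (fs[j := u \<oplus>\<^bsub>aug_hom K C ?X ?Y ?d\<^esub> v])
        = wup C Xs ds (fs[j := u]) \<oplus>\<^bsub>dghom C (last Xs) (hd Xs) ?n\<^esub> wup C Xs ds (fs[j := v])"
      if u: "u \<in> carrier (aug_hom K C ?X ?Y ?d)" and v: "v \<in> carrier (aug_hom K C ?X ?Y ?d)" for u v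
    proof (rule faithful[OF ends(4,3)])
      fix i assume i: "i \<in> I"
      interpret P: dgwu_map K C "A i" "Po i" "Pm i" by (rule maps) fact
      show "Pm i (last Xs) (hd Xs) ?n (wup C Xs ds (fs[j := u \<oplus>\<^bsub>aug_hom K C ?X ?Y ?d\<^esub> v]))
          = Pm i (last Xs) (hd Xs) ?n (wup C Xs ds (fs[j := u])
            \<oplus>\<^bsub>dghom C (last Xs) (hd Xs) ?n\<^esub> wup C Xs ds (fs[j := v]))"
        by (simp only: P.Fm_add[OF ends(4,3) wu[OF u] wu[OF v]] PW[OF i AH(1)[OF u v]] PW[OF i u]
            PW[OF i v] P.aug_add[OF o u v] linear_mapD(2)[OF lin[OF i] P.aug_in[OF o u] P.aug_in[OF o v]])
    qed (use wu AH u v ends C.add_in in auto)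
    moreover have "wup C Xs ds (fs[j := a \<odot>\<^bsub>aug_hom K C ?X ?Y ?d\<^esub> v])
        = a \<odot>\<^bsub>dghom C (last Xs) (hd Xs) ?n\<^esub> wup C Xs ds (fs[j := v])"
      if a: "a \<in> carrier K" and v: "v \<in> carrier (aug_hom K C ?X ?Y ?d)" for a v
    proof (rule faithful[OF ends(4,3)])
      fix i assume i: "i \<in> I"
      interpret P: dgwu_map K C "A i" "Po i" "Pm i" by (rule maps) fact
      show "Pm i (last Xs) (hd Xs) ?n (wup C Xs ds (fs[j := a \<odot>\<^bsub>aug_hom K C ?X ?Y ?d\<^esub> v]))
          = Pm i (last Xs) (hd Xs) ?n (a \<odot>\<^bsub>dghom C (last Xs) (hd Xs) ?n\<^esub> wup C Xs ds (fs[j := v]))"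
        by (simp only: P.Fm_smult[OF ends(4,3) a wu[OF v]] PW[OF i AH(2)[OF v v a]]
            PW[OF i v] P.aug_smult[OF o a v] linear_mapD(3)[OF lin[OF i] a P.aug_in[OF o v]])
    qed (use wu AH a v ends C.smult_in in auto)
    ultimately show "linear_map K (dghom (augment K C) ?X ?Y ?d)
        (dghom C (last Xs) (hd Xs) ?n) (\<lambda>v. wup C Xs ds (fs[j := v]))"
      using wu by (simp add: linear_map_def augment_simps)
  }
  have rel: "relation_lhs K C Xs ds fs = relation_rhs K C Xs ds fs"
  proof (rule faithful[OF ends(4,3), of _ "sum_list ds + 2 - int (length fs)"])
    fix i assume i: "i \<in> I"
    interpret P: dgwu_map K C "A i" "Po i" "Pm i" by (rule maps) fact
    interpret P: dgwu_map_dg K C "A i" "Po i" "Pm i" ..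
    show "Pm i (last Xs) (hd Xs) (sum_list ds + 2 - int (length fs)) (relation_lhs K C Xs ds fs)
        = Pm i (last Xs) (hd Xs) (sum_list ds + 2 - int (length fs)) (relation_rhs K C Xs ds fs)"
      unfolding P.map_relation[OF c refl refl refl]
      by (rule P.D.relation[OF P.composable_map_string[OF c]])
  qed (fact Cd.relation_closed[OF c refl refl])+
  fix n M
  assume "n = length fs" "M = dghom C (last Xs) (hd Xs) (sum_list ds + 2 - int n)"
  with rel show "(\<Oplus>\<^bsub>M\<^esub> i\<in>{..<n}. sgn_mult M (int (n - 1) + sum_list (take i ds))
          (wup C Xs (ds[i := ds ! i + 1])
            (fs[i := dgdiff (augment K C) (Xs ! Suc i) (Xs ! i) (ds ! i) (fs ! i)])))
      \<oplus>\<^bsub>M\<^esub>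
      (\<Oplus>\<^bsub>M\<^esub> i\<in>{..<n - 1}. sgn_mult M (int i)
          (wup C (take (Suc i) Xs @ drop (i + 2) Xs)
            (take i ds @ (ds ! i + ds ! Suc i) # drop (i + 2) ds)
            (take i fs
              @ dgcomp (augment K C) (Xs ! (i + 2)) (Xs ! Suc i) (Xs ! i) (ds ! i) (ds ! Suc i)
                  (fs ! i) (fs ! Suc i)
              # drop (i + 2) fs)))
      = dgdiff C (last Xs) (hd Xs) (sum_list ds + 1 - int n) (wup C Xs ds fs)
      \<oplus>\<^bsub>M\<^esub>
      (\<Oplus>\<^bsub>M\<^esub> i\<in>{1..<n}.
          sgn_mult M (int (i - 1) + (1 - int (n - i)) * sum_list (take i ds))
          (dgcomp C (last Xs) (Xs ! i) (hd Xs)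
            (sum_list (take i ds) + 1 - int i) (sum_list (drop i ds) + 1 - int (n - i))
            (wup C (take (Suc i) Xs) (take i ds) (take i fs))
            (wup C (drop i Xs) (drop i ds) (drop i fs))))"
    by (simp only: relation_lhs_def relation_rhs_def Let_def)
qed (simp_all add: augment_simps)

lemma weakly_unital: "weakly_unital_dg_category K C"
proof (rule weakly_unital_dg_category.intro[OF nonunital weakly_unital_dg_category_axioms.intro])
  show "a_inf_functor K (augment K C) C (\<lambda>X. X) (wup C)" by (rule wup_a_inf_functor)
next
  fix X assume o: "X \<in> dgobj C"
  show "wuid C X \<in> carrier (dghom C X X 0)" by (rule C.wuid_in[OF o])
  show "dgdiff C X X 0 (wuid C X) = \<zero>\<^bsub>dghom C X X 1\<^esub>"
  proof (rule faithful[OF o o])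
    fix i assume "i \<in> I"
    interpret P: dgwu_map K C "A i" "Po i" "Pm i" by (rule maps) fact
    show "Pm i X X 1 (dgdiff C X X 0 (wuid C X)) = Pm i X X 1 \<zero>\<^bsub>dghom C X X 1\<^esub>"
      using o by (simp add: P.Fm_diff_eq C.wuid_in P.Fm_id P.Fm_zero P.D.diff_id P.Fo_in)
  qed (use o in \<open>auto simp: C.diff_in_eq C.wuid_in C.zero_in\<close>)
  show "dgcomp C X X X 0 0 (wuid C X) (wuid C X) = wuid C X"
  proof (rule faithful[OF o o])
    fix i assume "i \<in> I"
    interpret P: dgwu_map K C "A i" "Po i" "Pm i" by (rule maps) fact
    show "Pm i X X 0 (dgcomp C X X X 0 0 (wuid C X) (wuid C X)) = Pm i X X 0 (wuid C X)"
      using o by (simp add: P.Fm_comp_eq C.wuid_in P.Fm_id P.D.id_id P.Fo_in)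
  qed (use o in \<open>auto simp: C.comp_in_eq C.wuid_in\<close>)
  have c: "composable (augment K C) (replicate (Suc r) X) (replicate r 0)
      (replicate r (\<zero>\<^bsub>dghom C X X 0\<^esub>, \<one>))" if "1 \<le> r" for r
    using that o by (auto simp: composable_def augment_simps aug_hom_simps C.zero_in nth_Cons' simp flip: replicate_Suc)
  \<comment> \<open>A strict identity is the pair of zero and one. Its image is again a strict
    identity, because projections preserve zero and leave scalars alone.\<close>
  have Pp: "Pm i X X (1 - int r) (wup C (replicate (Suc r) X) (replicate r 0)
        (replicate r (\<zero>\<^bsub>dghom C X X 0\<^esub>, \<one>)))
      = wup (A i) (replicate (Suc r) (Po i X)) (replicate r 0)
        (replicate r (\<zero>\<^bsub>dghom (A i) (Po i X) (Po i X) 0\<^esub>, \<one>))"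
    if "i \<in> I" "1 \<le> r" for i r
  proof -
    interpret P: dgwu_map K C "A i" "Po i" "Pm i" by (rule maps) fact
    have ms: "map_string (Pm i) (replicate (Suc r) X) (replicate r 0) (replicate r (\<zero>\<^bsub>dghom C X X 0\<^esub>, \<one>))
        = replicate r (\<zero>\<^bsub>dghom (A i) (Po i X) (Po i X) 0\<^esub>, \<one>)"
      using o by (intro nth_equalityI) (auto simp: P.Fm_zero nth_Cons' simp flip: replicate_Suc)
    show ?thesis
      using P.Fm_p[OF c[OF that(2)], unfolded ms]
      by (simp add: sum_list_replicate last_replicate del: replicate_Suc)
  qed
  have w: "wup C (replicate (Suc r) X) (replicate r 0) (replicate r (\<zero>\<^bsub>dghom C X X 0\<^esub>, \<one>))
      \<in> carrier (dghom C X X (1 - int r))" if "1 \<le> r" for r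
    using C.wup_in[OF c[OF that]] by (simp add: sum_list_replicate last_replicate del: replicate_Suc)
  show "wup C [X, X] [0] [(\<zero>\<^bsub>dghom C X X 0\<^esub>, \<one>)] = wuid C X"
  proof (rule faithful[OF o o])
    fix i assume i: "i \<in> I"
    interpret P: dgwu_map K C "A i" "Po i" "Pm i" by (rule maps) fact
    show "Pm i X X 0 (wup C [X, X] [0] [(\<zero>\<^bsub>dghom C X X 0\<^esub>, \<one>)]) = Pm i X X 0 (wuid C X)"
      using Pp[OF i, of 1] o by (simp add: P.Fm_id P.D.p_one_1 P.Fo_in)
  qed (use o w[of 1] in \<open>auto simp: C.wuid_in\<close>)
  fix r :: nat assume r: "2 \<le> r"
  show "wup C (replicate (Suc r) X) (replicate r 0) (replicate r (\<zero>\<^bsub>dghom C X X 0\<^esub>, \<one>))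
      = \<zero>\<^bsub>dghom C X X (1 - int r)\<^esub>"
  proof (rule faithful[OF o o])
    fix i assume i: "i \<in> I"
    interpret P: dgwu_map K C "A i" "Po i" "Pm i" by (rule maps) fact
    show "Pm i X X (1 - int r) (wup C (replicate (Suc r) X) (replicate r 0)
          (replicate r (\<zero>\<^bsub>dghom C X X 0\<^esub>, \<one>)))
        = Pm i X X (1 - int r) \<zero>\<^bsub>dghom C X X (1 - int r)\<^esub>"
      using Pp[OF i, of r] o r by (simp only: P.Fm_zero P.D.p_one P.Fo_in)
  qed (use o w r C.zero_in in auto)
next
  fix X Y n f assume o: "X \<in> dgobj C" "Y \<in> dgobj C" and f: "f \<in> carrier (dghom C X Y n)"
  have c: "composable (augment K C) [Y, X] [n] [(f, \<zero>)]"
    using o f by (auto simp: composable_def augment_simps aug_hom_simps)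
  show "wup C [Y, X] [n] [(f, \<zero>)] = f"
  proof (rule faithful[OF o])
    fix i assume i: "i \<in> I"
    interpret P: dgwu_map K C "A i" "Po i" "Pm i" by (rule maps) fact
    show "Pm i X Y n (wup C [Y, X] [n] [(f, \<zero>)]) = Pm i X Y n f"
      using P.Fm_p[OF c] o f by (simp add: map_string_def P.D.p_incl_1 P.Fo_in P.Fm_in)
  qed (use C.wup_in[OF c] f in auto)
next
  fix Xs ds fs assume c: "composable C Xs ds fs" and l: "2 \<le> length fs"
  note ends = composable_ends[OF c]
  have c': "composable (augment K C) Xs ds (map (\<lambda>f. (f, \<zero>)) fs)"
    by (rule composable_incl[OF c C.field_axioms])
  show "wup C Xs ds (map (\<lambda>f. (f, \<zero>)) fs)
      = \<zero>\<^bsub>dghom C (last Xs) (hd Xs) (sum_list ds + 1 - int (length fs))\<^esub>"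
  proof (rule faithful[OF ends(4,3)])
    fix i assume i: "i \<in> I"
    interpret P: dgwu_map K C "A i" "Po i" "Pm i" by (rule maps) fact
    let ?gs = "map (\<lambda>j. Pm i (Xs ! Suc j) (Xs ! j) (ds ! j) (fs ! j)) [0..<length fs]"
    \<comment> \<open>Scalars are untouched, so a string without unit parts stays one and
      \<open>p_incl\<close> of the factor applies.\<close>
    have ms: "map_string (Pm i) Xs ds (map (\<lambda>f. (f, \<zero>)) fs) = map (\<lambda>f. (f, \<zero>)) ?gs"
      by (intro nth_equalityI) auto
    have "composable (A i) (map (Po i) Xs) ds ?gs"
      using c by (auto simp: composable_def P.Fo_in P.Fm_in subset_iff)
    from P.D.p_incl[OF this]
    show "Pm i (last Xs) (hd Xs) (sum_list ds + 1 - int (length fs)) (wup C Xs ds (map (\<lambda>f. (f, \<zero>)) fs))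
        = Pm i (last Xs) (hd Xs) (sum_list ds + 1 - int (length fs))
          \<zero>\<^bsub>dghom C (last Xs) (hd Xs) (sum_list ds + 1 - int (length fs))\<^esub>"
      using P.Fm_p[OF c', unfolded ms] l ends composable_lengths[OF c]
      by (simp add: P.Fm_zero hd_map last_map)
  qed (use C.wup_in[OF c'] ends C.zero_in in auto)
qed

text \<open>Preservation of an operation by \<open>Gm\<close> is again an equation of parallel
  morphisms of \<open>C\<close>, hence may be tested after each projection. All functors into a
  limit or colimit object are obtained from this.\<close>

lemma lift_map:
  assumes B: "wudg_closed K B"
    and Go: "\<And>X. X \<in> dgobj B \<Longrightarrow> Go X \<in> dgobj C"
    and Gm: "\<And>X Y n f. \<lbrakk>X \<in> dgobj B; Y \<in> dgobj B; f \<in> carrier (dghom B X Y n)\<rbrakk>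
      \<Longrightarrow> Gm X Y n f \<in> carrier (dghom C (Go X) (Go Y) n)"
    and G: "\<And>i. i \<in> I \<Longrightarrow> dgwu_map K B (A i) (\<lambda>X. Po i (Go X)) (\<lambda>X Y n f. Pm i (Go X) (Go Y) n (Gm X Y n f))"
  shows "dgwu_map K B C Go Gm"
proof (intro dgwu_map.intro dgwu_map_axioms.intro)
  interpret B: wudg_closed K B by fact
  show "wudg_closed K B" by fact
  show "weakly_unital_dg_category K C" by (rule weakly_unital)
  fix X assume X: "X \<in> dgobj B"
  show "Go X \<in> dgobj C" by (rule Go[OF X])
  show "Gm X X 0 (wuid B X) = wuid C (Go X)"
  proof (rule faithful)
    fix i assume i: "i \<in> I"
    interpret P: dgwu_map K C "A i" "Po i" "Pm i" by (rule maps) fact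
    interpret G: dgwu_map K B "A i" "\<lambda>X. Po i (Go X)" "\<lambda>X Y n f. Pm i (Go X) (Go Y) n (Gm X Y n f)"
      by (rule G) fact
    show "Pm i (Go X) (Go X) 0 (Gm X X 0 (wuid B X)) = Pm i (Go X) (Go X) 0 (wuid C (Go X))"
      using X Go by (simp add: G.Fm_id P.Fm_id)
  qed (use X Go Gm B.wuid_in C.wuid_in in auto)
next
  interpret B: wudg_closed K B by fact
  fix X Y n assume o: "X \<in> dgobj B" "Y \<in> dgobj B"
  note o' = Go[OF o(1)] Go[OF o(2)]
  show "Gm X Y n \<zero>\<^bsub>dghom B X Y n\<^esub> = \<zero>\<^bsub>dghom C (Go X) (Go Y) n\<^esub>"
  proof (rule faithful[OF o'])
    fix i assume i: "i \<in> I"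
    interpret P: dgwu_map K C "A i" "Po i" "Pm i" by (rule maps) fact
    interpret G: dgwu_map K B "A i" "\<lambda>X. Po i (Go X)" "\<lambda>X Y n f. Pm i (Go X) (Go Y) n (Gm X Y n f)"
      by (rule G) fact
    show "Pm i (Go X) (Go Y) n (Gm X Y n \<zero>\<^bsub>dghom B X Y n\<^esub>)
        = Pm i (Go X) (Go Y) n \<zero>\<^bsub>dghom C (Go X) (Go Y) n\<^esub>"
      using o o' by (simp add: G.Fm_zero P.Fm_zero)
  qed (use o o' Gm B.zero_in C.zero_in in auto)
  fix f g a assume f: "f \<in> carrier (dghom B X Y n)"
  show "Gm X Y n f \<in> carrier (dghom C (Go X) (Go Y) n)" by (rule Gm[OF o f])
  show "Gm X Y (n + 1) (dgdiff B X Y n f) = dgdiff C (Go X) (Go Y) n (Gm X Y n f)"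
  proof (rule faithful[OF o'])
    fix i assume i: "i \<in> I"
    interpret P: dgwu_map K C "A i" "Po i" "Pm i" by (rule maps) fact
    interpret G: dgwu_map K B "A i" "\<lambda>X. Po i (Go X)" "\<lambda>X Y n f. Pm i (Go X) (Go Y) n (Gm X Y n f)"
      by (rule G) fact
    show "Pm i (Go X) (Go Y) (n + 1) (Gm X Y (n + 1) (dgdiff B X Y n f))
        = Pm i (Go X) (Go Y) (n + 1) (dgdiff C (Go X) (Go Y) n (Gm X Y n f))"
      using o o' f Gm by (simp add: G.Fm_diff P.Fm_diff)
  qed (use o o' f Gm B.diff_in C.diff_in in auto)
  show "Gm X Y n (f \<oplus>\<^bsub>dghom B X Y n\<^esub> g) = Gm X Y n f \<oplus>\<^bsub>dghom C (Go X) (Go Y) n\<^esub> Gm X Y n g"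
    if g: "g \<in> carrier (dghom B X Y n)"
  proof (rule faithful[OF o'])
    fix i assume i: "i \<in> I"
    interpret P: dgwu_map K C "A i" "Po i" "Pm i" by (rule maps) fact
    interpret G: dgwu_map K B "A i" "\<lambda>X. Po i (Go X)" "\<lambda>X Y n f. Pm i (Go X) (Go Y) n (Gm X Y n f)"
      by (rule G) fact
    show "Pm i (Go X) (Go Y) n (Gm X Y n (f \<oplus>\<^bsub>dghom B X Y n\<^esub> g))
        = Pm i (Go X) (Go Y) n (Gm X Y n f \<oplus>\<^bsub>dghom C (Go X) (Go Y) n\<^esub> Gm X Y n g)"
      using o o' f g Gm by (simp add: G.Fm_add P.Fm_add)
  qed (use o o' f g Gm B.add_in C.add_in in auto)
  show "Gm X Y n (a \<odot>\<^bsub>dghom B X Y n\<^esub> f) = a \<odot>\<^bsub>dghom C (Go X) (Go Y) n\<^esub> Gm X Y n f"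
    if a: "a \<in> carrier K"
  proof (rule faithful[OF o'])
    fix i assume i: "i \<in> I"
    interpret P: dgwu_map K C "A i" "Po i" "Pm i" by (rule maps) fact
    interpret G: dgwu_map K B "A i" "\<lambda>X. Po i (Go X)" "\<lambda>X Y n f. Pm i (Go X) (Go Y) n (Gm X Y n f)"
      by (rule G) fact
    show "Pm i (Go X) (Go Y) n (Gm X Y n (a \<odot>\<^bsub>dghom B X Y n\<^esub> f))
        = Pm i (Go X) (Go Y) n (a \<odot>\<^bsub>dghom C (Go X) (Go Y) n\<^esub> Gm X Y n f)"
      using o o' f a Gm by (simp add: G.Fm_smult P.Fm_smult)
  qed (use o o' f a Gm B.smult_in C.smult_in in auto)
next
  interpret B: wudg_closed K B by fact
  fix X Y Z m n f g
  assume o: "X \<in> dgobj B" "Y \<in> dgobj B" "Z \<in> dgobj B"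
    and f: "f \<in> carrier (dghom B Y Z m)" and g: "g \<in> carrier (dghom B X Y n)"
  note o' = Go[OF o(1)] Go[OF o(2)] Go[OF o(3)]
  show "Gm X Z (m + n) (dgcomp B X Y Z m n f g) = dgcomp C (Go X) (Go Y) (Go Z) m n (Gm Y Z m f) (Gm X Y n g)"
  proof (rule faithful[OF o'(1,3)])
    fix i assume i: "i \<in> I"
    interpret P: dgwu_map K C "A i" "Po i" "Pm i" by (rule maps) fact
    interpret G: dgwu_map K B "A i" "\<lambda>X. Po i (Go X)" "\<lambda>X Y n f. Pm i (Go X) (Go Y) n (Gm X Y n f)"
      by (rule G) fact
    show "Pm i (Go X) (Go Z) (m + n) (Gm X Z (m + n) (dgcomp B X Y Z m n f g))
        = Pm i (Go X) (Go Z) (m + n) (dgcomp C (Go X) (Go Y) (Go Z) m n (Gm Y Z m f) (Gm X Y n g))"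
      using o o' f g Gm by (simp add: G.Fm_comp P.Fm_comp)
  qed (use o o' f g Gm B.comp_in C.comp_in in auto)
next
  interpret B: wudg_closed K B by fact
  fix Xs ds fs assume c: "composable (augment K B) Xs ds fs"
  note ends = composable_ends[OF c, unfolded augment_simps] and lens = composable_lengths[OF c]
  note o' = Go[OF ends(4)] Go[OF ends(3)]
  have "map_prod (Gm (Xs ! Suc j) (Xs ! j) (ds ! j)) id (fs ! j)
      \<in> carrier (aug_hom K C (Go (Xs ! Suc j)) (Go (Xs ! j)) (ds ! j))" if "j < length fs" for j
    using composable_nth(1)[OF c that] composable_nth(2)[OF c, of j]
      composable_nth(2)[OF c, of "Suc j"] that
    by (cases "fs ! j") (auto simp: augment_simps aug_hom_simps Gm)
  then have c': "composable (augment K C) (map Go Xs) ds (map_string Gm Xs ds fs)"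
    using c Go by (auto simp: composable_def augment_simps)
  have ends': "last (map Go Xs) = Go (last Xs)" "hd (map Go Xs) = Go (hd Xs)"
    using lens by (simp_all add: last_map hd_map)
  note w = C.wup_in[OF c', unfolded length_map_string ends']
  show "Gm (last Xs) (hd Xs) (sum_list ds + 1 - int (length fs)) (wup B Xs ds fs)
      = wup C (map Go Xs) ds (map_string Gm Xs ds fs)"
  proof (rule faithful[OF o'])
    fix i assume i: "i \<in> I"
    interpret P: dgwu_map K C "A i" "Po i" "Pm i" by (rule maps) fact
    interpret G: dgwu_map K B "A i" "\<lambda>X. Po i (Go X)" "\<lambda>X Y n f. Pm i (Go X) (Go Y) n (Gm X Y n f)"
      by (rule G) fact
    have ms: "map_string (Pm i) (map Go Xs) ds (map_string Gm Xs ds fs)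
        = map_string (\<lambda>X Y n f. Pm i (Go X) (Go Y) n (Gm X Y n f)) Xs ds fs"
      using lens by (intro nth_equalityI) (auto simp: map_prod_def split_beta)
    have mm: "map (Po i) (map Go Xs) = map (\<lambda>X. Po i (Go X)) Xs" by simp
    show "Pm i (Go (last Xs)) (Go (hd Xs)) (sum_list ds + 1 - int (length fs))
          (Gm (last Xs) (hd Xs) (sum_list ds + 1 - int (length fs)) (wup B Xs ds fs))
        = Pm i (Go (last Xs)) (Go (hd Xs)) (sum_list ds + 1 - int (length fs))
          (wup C (map Go Xs) ds (map_string Gm Xs ds fs))"
      using G.Fm_p[OF c] P.Fm_p[OF c', unfolded length_map_string ends' ms mm] by simp
  qed (use w Gm[OF ends(4,3) B.wup_in[OF c]] in auto)
qed

end

section \<open>The category of weakly unital dg categories\<close>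

lemma map_string_cong:
  assumes "composable (augment K C) Xs ds fs"
    and "\<And>X Y n f. \<lbrakk>X \<in> dgobj C; Y \<in> dgobj C; f \<in> carrier (dghom C X Y n)\<rbrakk> \<Longrightarrow> F X Y n f = G X Y n f"
  shows "map_string F Xs ds fs = map_string G Xs ds fs"
proof (rule nth_equalityI)
  fix j assume "j < length (map_string F Xs ds fs)"
  then have j: "j < length fs" by simp
  then have "map_prod (F (Xs ! Suc j) (Xs ! j) (ds ! j)) id (fs ! j)
      = map_prod (G (Xs ! Suc j) (Xs ! j) (ds ! j)) id (fs ! j)"
    using composable_nth(1)[OF assms(1) j] composable_nth(2)[OF assms(1), of j]
      composable_nth(2)[OF assms(1), of "Suc j"]
    by (cases "fs ! j") (auto simp: augment_simps aug_hom_simps assms(2))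
  with j show "map_string F Xs ds fs ! j = map_string G Xs ds fs ! j" by simp
qed simp

text \<open>The laws evaluate a map only inside its domain, so values elsewhere may be changed
  freely. This is the passage between functors normalised by \<open>dg_fun_restrict\<close> and
  plain formulas.\<close>

lemma dgwu_map_cong:
  assumes F: "dgwu_map K C D Fo Fm"
    and o: "\<And>X. X \<in> dgobj C \<Longrightarrow> Go X = Fo X"
    and m: "\<And>X Y n f. \<lbrakk>X \<in> dgobj C; Y \<in> dgobj C; f \<in> carrier (dghom C X Y n)\<rbrakk>
      \<Longrightarrow> Gm X Y n f = Fm X Y n f"
  shows "dgwu_map K C D Go Gm"
proof -
  interpret F: dgwu_map K C D Fo Fm by fact
  show ?thesis
  proof unfold_locales
    fix Xs ds fs assume c: "composable (augment K C) Xs ds fs"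
    have "map Go Xs = map Fo Xs"
      using c o by (auto simp: composable_def augment_simps)
    moreover note ends = composable_ends[OF c, unfolded augment_simps]
    moreover have "map_string Gm Xs ds fs = map_string Fm Xs ds fs"
      by (rule map_string_cong[OF c]) (rule m)
    ultimately show "Gm (last Xs) (hd Xs) (sum_list ds + 1 - int (length fs)) (wup C Xs ds fs)
        = wup D (map Go Xs) ds (map_string Gm Xs ds fs)"
      using F.Fm_p[OF c] m[OF ends(4,3) F.C.wup_in[OF c]] by (simp del: map_eq_conv)
  qed (simp_all add: o m F.Fo_in F.Fm_in F.Fm_zero F.Fm_add F.Fm_smult F.Fm_diff F.Fm_comp F.Fm_id
      F.C.zero_in F.C.add_in F.C.smult_in F.C.diff_in F.C.comp_in F.C.wuid_in)
qed

lemma dgwu_map_id: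
  assumes "weakly_unital_dg_category K C"
  shows "dgwu_map K C C (\<lambda>X. X) (\<lambda>X Y n f. f)"
proof -
  interpret weakly_unital_dg_category K C by fact
  have ms: "map_string (\<lambda>X Y n f. f) Xs ds fs = fs" for Xs ds fs
    by (intro nth_equalityI) (auto simp: prod_eq_iff)
  show ?thesis by unfold_locales (assumption | rule refl | simp only: ms list.map_ident)+
qed

lemma dgwu_map_comp:
  assumes "dgwu_map K B C Go Gm" "dgwu_map K C D Fo Fm"
  shows "dgwu_map K B D (\<lambda>X. Fo (Go X)) (\<lambda>X Y n f. Fm (Go X) (Go Y) n (Gm X Y n f))"
proof -
  interpret G: dgwu_map K B C Go Gm by fact
  interpret F: dgwu_map K C D Fo Fm by fact
  show ?thesis
  proof unfold_locales
    fix Xs ds fs assume c: "composable (augment K B) Xs ds fs"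
    have ms: "map_string Fm (map Go Xs) ds (map_string Gm Xs ds fs)
        = map_string (\<lambda>X Y n f. Fm (Go X) (Go Y) n (Gm X Y n f)) Xs ds fs"
      using composable_lengths[OF c] by (intro nth_equalityI) (auto simp: map_prod_def split_beta)
    have mm: "map Fo (map Go Xs) = map (\<lambda>X. Fo (Go X)) Xs" by simp
    show "Fm (Go (last Xs)) (Go (hd Xs)) (sum_list ds + 1 - int (length fs))
          (Gm (last Xs) (hd Xs) (sum_list ds + 1 - int (length fs)) (wup B Xs ds fs))
        = wup D (map (\<lambda>X. Fo (Go X)) Xs) ds (map_string (\<lambda>X Y n f. Fm (Go X) (Go Y) n (Gm X Y n f)) Xs ds fs)"
      using F.Fm_p[OF G.composable_map_string[OF c], unfolded length_map_string ms mm]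
        G.Fm_p[OF c] composable_lengths[OF c] by (simp add: last_map hd_map)
  qed (simp_all add: F.Fo_in F.Fm_in F.Fm_zero F.Fm_add F.Fm_smult F.Fm_diff F.Fm_comp F.Fm_id
      G.Fo_in G.Fm_in G.Fm_zero G.Fm_add G.Fm_smult G.Fm_diff G.Fm_comp G.Fm_id)
qed

text \<open>Preservation of \<open>wuid\<close> is not assumed of a functor: it is compatibility
  with \<open>p_1\<close> at the strict identity, since \<open>p_1(1_X) = id_X\<close> on both
  sides.\<close>

lemma functor_imp_dgwu_map:
  assumes "weakly_unital_dg_functor K C D F"
  shows "dgwu_map K C D (fst F) (snd F)"
proof -
  interpret F: weakly_unital_dg_functor K C D F by fact
  note lin = linear_mapD[OF F.F_linear]
  have zero: "snd F X Y n \<zero>\<^bsub>dghom C X Y n\<^esub> = \<zero>\<^bsub>dghom D (fst F X) (fst F Y) n\<^esub>"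
    if "X \<in> dgobj C" "Y \<in> dgobj C" for X Y n
    using linear_map_zero[OF F.C.hom_module F.D.hom_module F.F_linear] that F.F_obj by blast
  have p: "snd F (last Xs) (hd Xs) (sum_list ds + 1 - int (length fs)) (wup C Xs ds fs)
      = wup D (map (fst F) Xs) ds (map_string (snd F) Xs ds fs)"
    if "composable (augment K C) Xs ds fs" for Xs ds fs
    using F.F_p[OF that] by (simp add: map_string_def)
  show ?thesis
  proof unfold_locales
    fix X assume X: "X \<in> dgobj C"
    have "composable (augment K C) [X, X] [0] [(\<zero>\<^bsub>dghom C X X 0\<^esub>, \<one>\<^bsub>K\<^esub>)]"
      using X by (auto simp: composable_def augment_simps aug_hom_simps F.C.zero_in)
    from p[OF this] show "snd F X X 0 (wuid C X) = wuid D (fst F X)"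
      using X by (simp add: F.C.p_one_1 F.D.p_one_1 F.F_obj map_string_def zero)
  qed (simp_all add: lin F.F_obj F.F_diff F.F_comp zero p)
qed

section \<open>Normalised functors and the category laws\<close>

lemma dg_fun_restrict_simps:
  "X \<in> dgobj C \<Longrightarrow> fst (dg_fun_restrict C F) X = fst F X"
  "\<lbrakk>X \<in> dgobj C; Y \<in> dgobj C; f \<in> carrier (dghom C X Y n)\<rbrakk>
    \<Longrightarrow> snd (dg_fun_restrict C F) X Y n f = snd F X Y n f"
  by (simp_all add: dg_fun_restrict_def)

lemma dg_fun_restrict_cong:
  assumes "\<And>X. X \<in> dgobj C \<Longrightarrow> fst F X = fst G X"
    and "\<And>X Y n f. \<lbrakk>X \<in> dgobj C; Y \<in> dgobj C; f \<in> carrier (dghom C X Y n)\<rbrakk>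
      \<Longrightarrow> snd F X Y n f = snd G X Y n f"
  shows "dg_fun_restrict C F = dg_fun_restrict C G"
  using assms by (auto simp: dg_fun_restrict_def restrict_def fun_eq_iff)

lemma dg_fun_restrict_idem: "dg_fun_restrict C (dg_fun_restrict C F) = dg_fun_restrict C F"
  by (rule dg_fun_restrict_cong) (simp_all add: dg_fun_restrict_simps)

lemma dgwu_map_imp_functor:
  assumes "dgwu_map K C D Fo Fm" "weakly_unital_dg_category K C"
  shows "weakly_unital_dg_functor K C D (dg_fun_restrict C (Fo, Fm))"
proof -
  let ?F = "dg_fun_restrict C (Fo, Fm)"
  interpret C: weakly_unital_dg_category K C by fact
  interpret F: dgwu_map K C D "fst ?F" "snd ?F"
    by (rule dgwu_map_cong[OF assms(1)]) (simp_all add: dg_fun_restrict_simps)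
  show ?thesis
  proof unfold_locales
    show "dg_fun_restrict C ?F = ?F" by (rule dg_fun_restrict_idem)
    show "linear_map K (dghom C X Y n) (dghom D (fst ?F X) (fst ?F Y) n) (snd ?F X Y n)"
      if "X \<in> dgobj C" "Y \<in> dgobj C" for X Y n
      using that by (auto simp: linear_map_def F.Fm_in F.Fm_add F.Fm_smult)
  qed (simp_all add: F.Fo_in F.Fm_diff F.Fm_comp F.Fm_p flip: map_string_def)
qed

lemma Cat_dgwu_simps:
  "A \<in> Obj (Cat_dgwu K) \<longleftrightarrow> weakly_unital_dg_category K A \<and> small_wudg A"
  "F \<in> Mor (Cat_dgwu K) A B \<longleftrightarrow> weakly_unital_dg_functor K A B F"
  "Id (Cat_dgwu K) A = dg_fun_restrict A (\<lambda>X. X, \<lambda>X Y n f. f)"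
  "Comp (Cat_dgwu K) A B C G F = dg_fun_restrict A
     (\<lambda>X. fst G (fst F X), \<lambda>X Y n f. snd G (fst F X) (fst F Y) n (snd F X Y n f))"
  by (simp_all add: Cat_dgwu_def)

text \<open>Functors are \<open>undefined\<close> outside their domains, so agreement inside them is
  equality.\<close>

lemma functor_eqI:
  assumes "weakly_unital_dg_functor K C D F" "weakly_unital_dg_functor K C D G"
    and "\<And>X. X \<in> dgobj C \<Longrightarrow> fst F X = fst G X"
    and "\<And>X Y n f. \<lbrakk>X \<in> dgobj C; Y \<in> dgobj C; f \<in> carrier (dghom C X Y n)\<rbrakk>
      \<Longrightarrow> snd F X Y n f = snd G X Y n f"
  shows "F = G"
proof -
  have "F = dg_fun_restrict C F"
    using weakly_unital_dg_functor.F_restrict[OF assms(1)] by simp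
  also have "\<dots> = dg_fun_restrict C G"
    by (rule dg_fun_restrict_cong) (use assms(3,4) in auto)
  also have "\<dots> = G"
    using weakly_unital_dg_functor.F_restrict[OF assms(2)] .
  finally show ?thesis .
qed

lemma functor_comp:
  assumes "weakly_unital_dg_functor K A B F" "weakly_unital_dg_functor K B C G"
  shows "weakly_unital_dg_functor K A C (dg_fun_restrict A
     (\<lambda>X. fst G (fst F X), \<lambda>X Y n f. snd G (fst F X) (fst F Y) n (snd F X Y n f)))"
  by (rule dgwu_map_imp_functor[OF dgwu_map_comp[OF functor_imp_dgwu_map[OF assms(1)]
        functor_imp_dgwu_map[OF assms(2)]] weakly_unital_dg_functor.axioms(1)[OF assms(1)]])

lemma Cat_dgwu_category: "category (Cat_dgwu K)"
proof (unfold_locales, unfold Cat_dgwu_simps)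
  fix X :: "('a, 'a, 'b) wudg_data"
  assume "weakly_unital_dg_category K X \<and> small_wudg X"
  then show "weakly_unital_dg_functor K X X (dg_fun_restrict X (\<lambda>X. X, \<lambda>X Y n f. f))"
    by (intro dgwu_map_imp_functor dgwu_map_id) auto
next
  fix X Y Z :: "('a, 'a, 'b) wudg_data" and g f
  assume "weakly_unital_dg_functor K Y Z g" "weakly_unital_dg_functor K X Y f"
  then show "weakly_unital_dg_functor K X Z (dg_fun_restrict X
     (\<lambda>X. fst g (fst f X), \<lambda>X Y n fa. snd g (fst f X) (fst f Y) n (snd f X Y n fa)))"
    by (intro functor_comp)
next
  fix X Y :: "('a, 'a, 'b) wudg_data" and F
  assume "weakly_unital_dg_functor K X Y F"
  then interpret F: weakly_unital_dg_functor K X Y F .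
  have F_in: "\<lbrakk>U \<in> dgobj X; V \<in> dgobj X; f \<in> carrier (dghom X U V n)\<rbrakk>
      \<Longrightarrow> snd F U V n f \<in> carrier (dghom Y (fst F U) (fst F V) n)" for U V n f
    using linear_mapD(1)[OF F.F_linear] by blast
  show "dg_fun_restrict X
      (\<lambda>Xa. fst F (fst (dg_fun_restrict X (\<lambda>X. X, \<lambda>X Y n f. f)) Xa),
       \<lambda>Xa Ya n f. snd F (fst (dg_fun_restrict X (\<lambda>X. X, \<lambda>X Y n f. f)) Xa)
         (fst (dg_fun_restrict X (\<lambda>X. X, \<lambda>X Y n f. f)) Ya) n
         (snd (dg_fun_restrict X (\<lambda>X. X, \<lambda>X Y n f. f)) Xa Ya n f)) = F"
    by (rule trans[OF dg_fun_restrict_cong F.F_restrict])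
      (simp_all add: dg_fun_restrict_simps)
  show "dg_fun_restrict X
      (\<lambda>Xa. fst (dg_fun_restrict Y (\<lambda>X. X, \<lambda>X Y n f. f)) (fst F Xa),
       \<lambda>Xa Ya n f. snd (dg_fun_restrict Y (\<lambda>X. X, \<lambda>X Y n f. f)) (fst F Xa) (fst F Ya) n
         (snd F Xa Ya n f)) = F"
    by (rule trans[OF dg_fun_restrict_cong F.F_restrict])
      (simp_all add: dg_fun_restrict_simps F.F_obj F_in)
next
  fix W X Y Z :: "('a, 'a, 'b) wudg_data" and h g f
  assume "weakly_unital_dg_functor K X Y g" "weakly_unital_dg_functor K W X f"
  then interpret f: dgwu_map K W X "fst f" "snd f" + g: dgwu_map K X Y "fst g" "snd g"
    by (simp_all add: functor_imp_dgwu_map)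
  show "dg_fun_restrict W
      (\<lambda>Xa. fst (dg_fun_restrict X (\<lambda>X. fst h (fst g X), \<lambda>X Y n f. snd h (fst g X) (fst g Y) n (snd g X Y n f))) (fst f Xa),
       \<lambda>Xa Y n fa. snd (dg_fun_restrict X (\<lambda>X. fst h (fst g X), \<lambda>X Y n f. snd h (fst g X) (fst g Y) n (snd g X Y n f)))
         (fst f Xa) (fst f Y) n (snd f Xa Y n fa))
    = dg_fun_restrict W
      (\<lambda>X. fst h (fst (dg_fun_restrict W (\<lambda>X. fst g (fst f X), \<lambda>X Y n fa. snd g (fst f X) (fst f Y) n (snd f X Y n fa))) X),
       \<lambda>X Y n fa. snd h (fst (dg_fun_restrict W (\<lambda>X. fst g (fst f X), \<lambda>X Y n fa. snd g (fst f X) (fst f Y) n (snd f X Y n fa))) X)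
         (fst (dg_fun_restrict W (\<lambda>X. fst g (fst f X), \<lambda>X Y n fa. snd g (fst f X) (fst f Y) n (snd f X Y n fa))) Y) n
         (snd (dg_fun_restrict W (\<lambda>X. fst g (fst f X), \<lambda>X Y n fa. snd g (fst f X) (fst f Y) n (snd f X Y n fa))) X Y n fa))"
    by (rule dg_fun_restrict_cong) (simp_all add: dg_fun_restrict_simps f.Fo_in f.Fm_in)
qed

section \<open>Small substructures of products\<close>

text \<open>Only the morphism part has coordinates. The scalar is common to all of them, because a
  strict identity of the product is the strict identity in every factor with the same
  coefficient.\<close>

definition eval_at :: "'i \<Rightarrow> (('i \<Rightarrow> 'n) \<times> 'k) list \<Rightarrow> ('n \<times> 'k) list" where
  "eval_at i = map (map_prod (\<lambda>f. f i) id)"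

lemma length_eval_at [simp]: "length (eval_at i fs) = length fs"
  by (simp add: eval_at_def)

lemma nth_eval_at [simp]: "j < length fs \<Longrightarrow> eval_at i fs ! j = map_prod (\<lambda>f. f i) id (fs ! j)"
  by (simp add: eval_at_def)

text \<open>Composability in the augmented category, spelled out for bare carrier sets because the
  product is never assembled into a record. Objects are compared as whole families, so unit parts
  occur only where all coordinates of the endpoints agree.\<close>

definition aug_string ::
    "('k, 'r) ring_scheme \<Rightarrow> 'x set \<Rightarrow> ('x \<Rightarrow> 'x \<Rightarrow> int \<Rightarrow> 'f set) \<Rightarrow> 'x list \<Rightarrow> int list \<Rightarrow> ('f \<times> 'k) list \<Rightarrow> bool"
  where
  "aug_string K Ob H xs ds fs \<longleftrightarrow> fs \<noteq> [] \<and> length xs = Suc (length fs) \<and> length ds = length fs \<and>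
    set xs \<subseteq> Ob \<and> (\<forall>j<length fs. fst (fs ! j) \<in> H (xs ! Suc j) (xs ! j) (ds ! j) \<and>
      snd (fs ! j) \<in> carrier K \<and> (xs ! Suc j = xs ! j \<and> ds ! j = 0 \<or> snd (fs ! j) = \<zero>\<^bsub>K\<^esub>))"

text \<open>The maps \<open>eo\<close> and \<open>em\<close> rename families as elements of the
  target types. Hom sets may overlap, so \<open>em\<close> is required to be injective on their
  union: one decoding then serves for all endpoints and degrees. Extensionality makes a family
  determined by its coordinates in \<open>I\<close>.\<close>

locale subproduct = field K
  for K :: "('k, 'r) ring_scheme" (structure) +
  fixes I :: "'i set" and A :: "'i \<Rightarrow> ('p, 'n, 'k) wudg_data"
    and Ob :: "('i \<Rightarrow> 'p) set" and H :: "('i \<Rightarrow> 'p) \<Rightarrow> ('i \<Rightarrow> 'p) \<Rightarrow> int \<Rightarrow> ('i \<Rightarrow> 'n) set"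
    and eo :: "('i \<Rightarrow> 'p) \<Rightarrow> 'o" and em :: "('i \<Rightarrow> 'n) \<Rightarrow> 'm"
  assumes factors: "i \<in> I \<Longrightarrow> weakly_unital_dg_category K (A i)"
    and Ob: "\<lbrakk>x \<in> Ob; i \<in> I\<rbrakk> \<Longrightarrow> x i \<in> dgobj (A i)"
    and H: "\<lbrakk>x \<in> Ob; y \<in> Ob; f \<in> H x y n; i \<in> I\<rbrakk> \<Longrightarrow> f i \<in> carrier (dghom (A i) (x i) (y i) n)"
    and H_ext: "\<lbrakk>x \<in> Ob; y \<in> Ob; f \<in> H x y n\<rbrakk> \<Longrightarrow> f \<in> extensional I"
    and zero_H: "\<lbrakk>x \<in> Ob; y \<in> Ob\<rbrakk> \<Longrightarrow> (\<lambda>i\<in>I. \<zero>\<^bsub>dghom (A i) (x i) (y i) n\<^esub>) \<in> H x y n"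
    and add_H: "\<lbrakk>x \<in> Ob; y \<in> Ob; f \<in> H x y n; g \<in> H x y n\<rbrakk>
      \<Longrightarrow> (\<lambda>i\<in>I. f i \<oplus>\<^bsub>dghom (A i) (x i) (y i) n\<^esub> g i) \<in> H x y n"
    and smult_H: "\<lbrakk>x \<in> Ob; y \<in> Ob; a \<in> carrier K; f \<in> H x y n\<rbrakk>
      \<Longrightarrow> (\<lambda>i\<in>I. a \<odot>\<^bsub>dghom (A i) (x i) (y i) n\<^esub> f i) \<in> H x y n"
    and diff_H: "\<lbrakk>x \<in> Ob; y \<in> Ob; f \<in> H x y n\<rbrakk>
      \<Longrightarrow> (\<lambda>i\<in>I. dgdiff (A i) (x i) (y i) n (f i)) \<in> H x y (n + 1)"
    and comp_H: "\<lbrakk>x \<in> Ob; y \<in> Ob; z \<in> Ob; f \<in> H y z m; g \<in> H x y n\<rbrakk>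
      \<Longrightarrow> (\<lambda>i\<in>I. dgcomp (A i) (x i) (y i) (z i) m n (f i) (g i)) \<in> H x z (m + n)"
    and wuid_H: "x \<in> Ob \<Longrightarrow> (\<lambda>i\<in>I. wuid (A i) (x i)) \<in> H x x 0"
    and wup_H: "aug_string K Ob H xs ds fs
      \<Longrightarrow> (\<lambda>i\<in>I. wup (A i) (map (\<lambda>x. x i) xs) ds (eval_at i fs))
        \<in> H (last xs) (hd xs) (sum_list ds + 1 - int (length fs))"
    and eo: "inj_on eo Ob"
    and em: "inj_on em (\<Union>x\<in>Ob. \<Union>y\<in>Ob. \<Union>n. H x y n)"
begin

definition dob :: "'o \<Rightarrow> 'i \<Rightarrow> 'p" where "dob = inv_into Ob eo"
definition dmor :: "'m \<Rightarrow> 'i \<Rightarrow> 'n" where "dmor = inv_into (\<Union>x\<in>Ob. \<Union>y\<in>Ob. \<Union>n. H x y n) em"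

lemma dob_eo [simp]: "x \<in> Ob \<Longrightarrow> dob (eo x) = x"
  by (simp add: dob_def eo)

lemma dmor_em [simp]: "\<lbrakk>x \<in> Ob; y \<in> Ob; f \<in> H x y n\<rbrakk> \<Longrightarrow> dmor (em f) = f"
  unfolding dmor_def by (rule inv_into_f_f[OF em]) blast

text \<open>Transport of structure along the encodings: decode, operate in each coordinate,
  encode.\<close>

definition L :: "('o, 'm, 'k) wudg_data" where
  "L = \<lparr>dgobj = eo ` Ob,
    dghom = (\<lambda>X Y n. \<lparr>carrier = em ` H (dob X) (dob Y) n, mult = undefined, one = undefined,
      zero = em (\<lambda>i\<in>I. \<zero>\<^bsub>dghom (A i) (dob X i) (dob Y i) n\<^esub>),
      add = (\<lambda>f g. em (\<lambda>i\<in>I. dmor f i \<oplus>\<^bsub>dghom (A i) (dob X i) (dob Y i) n\<^esub> dmor g i)),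
      smult = (\<lambda>a f. em (\<lambda>i\<in>I. a \<odot>\<^bsub>dghom (A i) (dob X i) (dob Y i) n\<^esub> dmor f i))\<rparr>),
    dgdiff = (\<lambda>X Y n f. em (\<lambda>i\<in>I. dgdiff (A i) (dob X i) (dob Y i) n (dmor f i))),
    dgcomp = (\<lambda>X Y Z m n f g. em (\<lambda>i\<in>I.
      dgcomp (A i) (dob X i) (dob Y i) (dob Z i) m n (dmor f i) (dmor g i))),
    wuid = (\<lambda>X. em (\<lambda>i\<in>I. wuid (A i) (dob X i))),
    wup = (\<lambda>Xs ds fs. em (\<lambda>i\<in>I. wup (A i) (map (\<lambda>x. x i) (map dob Xs)) ds
      (eval_at i (map (map_prod dmor id) fs))))\<rparr>"

lemma L_simps:
  "dgobj L = eo ` Ob"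
  "carrier (dghom L X Y n) = em ` H (dob X) (dob Y) n"
  "\<zero>\<^bsub>dghom L X Y n\<^esub> = em (\<lambda>i\<in>I. \<zero>\<^bsub>dghom (A i) (dob X i) (dob Y i) n\<^esub>)"
  "f \<oplus>\<^bsub>dghom L X Y n\<^esub> g = em (\<lambda>i\<in>I. dmor f i \<oplus>\<^bsub>dghom (A i) (dob X i) (dob Y i) n\<^esub> dmor g i)"
  "a \<odot>\<^bsub>dghom L X Y n\<^esub> f = em (\<lambda>i\<in>I. a \<odot>\<^bsub>dghom (A i) (dob X i) (dob Y i) n\<^esub> dmor f i)"
  "dgdiff L X Y n f = em (\<lambda>i\<in>I. dgdiff (A i) (dob X i) (dob Y i) n (dmor f i))"
  "dgcomp L X Y Z m n f g = em (\<lambda>i\<in>I.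
      dgcomp (A i) (dob X i) (dob Y i) (dob Z i) m n (dmor f i) (dmor g i))"
  "wuid L X = em (\<lambda>i\<in>I. wuid (A i) (dob X i))"
  "wup L Xs ds fs' = em (\<lambda>i\<in>I. wup (A i) (map (\<lambda>x. x i) (map dob Xs)) ds
      (eval_at i (map (map_prod dmor id) fs')))"
  by (simp_all add: L_def)

lemma dob_in: "X \<in> dgobj L \<Longrightarrow> dob X \<in> Ob"
  by (auto simp: L_simps)

lemma dmor_in:
  "\<lbrakk>X \<in> dgobj L; Y \<in> dgobj L; f \<in> carrier (dghom L X Y n)\<rbrakk> \<Longrightarrow> dmor f \<in> H (dob X) (dob Y) n"
  by (auto simp: L_simps(2) dmor_em[OF dob_in dob_in])

lemma em_in:
  "f \<in> H (dob X) (dob Y) n \<Longrightarrow> em f \<in> carrier (dghom L X Y n)"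
  by (simp add: L_simps)

lemma aug_string_L:
  assumes c: "composable (augment K L) Xs ds fs"
  shows "aug_string K Ob H (map dob Xs) ds (map (map_prod dmor id) fs)"
  unfolding aug_string_def
proof (intro conjI allI impI)
  fix j assume j: "j < length (map (map_prod dmor id) fs)"
  then have j': "j < length fs" by simp
  obtain f a where f: "fs ! j = (f, a)" by (meson surj_pair)
  have "Xs ! j \<in> dgobj L" "Xs ! Suc j \<in> dgobj L"
    using composable_nth(2)[OF c, of j] composable_nth(2)[OF c, of "Suc j"] j'
    by (auto simp: augment_simps)
  then show "fst (map (map_prod dmor id) fs ! j) \<in> H (map dob Xs ! Suc j) (map dob Xs ! j) (ds ! j)"
    "snd (map (map_prod dmor id) fs ! j) \<in> carrier K"
    "map dob Xs ! Suc j = map dob Xs ! j \<and> ds ! j = 0 \<or> snd (map (map_prod dmor id) fs ! j) = \<zero>"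
    using composable_nth(1)[OF c j'] j' composable_lengths[OF c] f
    by (auto simp: augment_simps aug_hom_simps intro: dmor_in)
qed (use c dob_in in \<open>auto simp: composable_def augment_simps\<close>)

lemma L_closed: "wudg_closed K L"
proof unfold_locales
  fix Xs ds fs assume c: "composable (augment K L) Xs ds fs"
  have "em (\<lambda>i\<in>I. wup (A i) (map (\<lambda>x. x i) (map dob Xs)) ds (eval_at i (map (map_prod dmor id) fs)))
      \<in> carrier (dghom L (last Xs) (hd Xs) (sum_list ds + 1 - int (length fs)))"
    using wup_H[OF aug_string_L[OF c]] composable_lengths[OF c]
    by (intro em_in) (simp add: last_map hd_map)
  then show "wup L Xs ds fs \<in> carrier (dghom L (last Xs) (hd Xs) (sum_list ds + 1 - int (length fs)))"
    by (simp only: L_simps(9))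
qed (simp_all only: L_simps(3-8), auto intro!: em_in zero_H add_H smult_H diff_H comp_H wuid_H dob_in dmor_in)

lemma project:
  assumes i: "i \<in> I"
  shows "dgwu_map K L (A i) (\<lambda>X. dob X i) (\<lambda>X Y n f. dmor f i)"
proof -
  interpret L: wudg_closed K L by (rule L_closed)
  interpret Ai: weakly_unital_dg_category K "A i" by (rule factors[OF i])
  note in_H = zero_H add_H smult_H diff_H comp_H wuid_H
  have d: "dmor (em f) i = f i" if "f \<in> H x y n" "x \<in> Ob" "y \<in> Ob" for f x y n
    using that by simp
  show ?thesis
  proof unfold_locales
    fix Xs ds fs assume c: "composable (augment K L) Xs ds fs"
    note s = aug_string_L[OF c]
    note ends = composable_ends[OF c, unfolded augment_simps] and lens = composable_lengths[OF c]
    have "dmor (wup L Xs ds fs) i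
        = wup (A i) (map (\<lambda>x. x i) (map dob Xs)) ds (eval_at i (map (map_prod dmor id) fs))"
      unfolding L_simps(9)
      by (subst d[OF wup_H[OF s]]) (use ends lens dob_in i in \<open>auto simp: hd_map last_map\<close>)
    moreover have "eval_at i (map (map_prod dmor id) fs) = map_string (\<lambda>X Y n f. dmor f i) Xs ds fs"
      by (intro nth_equalityI) (auto simp: map_prod_def split_beta)
    ultimately show "dmor (wup L Xs ds fs) i
        = wup (A i) (map (\<lambda>X. dob X i) Xs) ds (map_string (\<lambda>X Y n f. dmor f i) Xs ds fs)"
      by (simp add: comp_def)
  next
    show "dob X i \<in> dgobj (A i)" if "X \<in> dgobj L" for X
      using Ob[OF dob_in[OF that] i] .
    show "dmor f i \<in> carrier (dghom (A i) (dob X i) (dob Y i) n)"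
      if "X \<in> dgobj L" "Y \<in> dgobj L" "f \<in> carrier (dghom L X Y n)" for X Y n f
      using H[OF dob_in dob_in dmor_in i] that by blast
    show "dmor (wuid L X) i = wuid (A i) (dob X i)" if "X \<in> dgobj L" for X
      using d[OF wuid_H] dob_in[OF that] i by (simp add: L_simps(8))
    fix X Y assume o: "X \<in> dgobj L" "Y \<in> dgobj L"
    note o' = dob_in[OF o(1)] dob_in[OF o(2)]
    show "dmor \<zero>\<^bsub>dghom L X Y n\<^esub> i = \<zero>\<^bsub>dghom (A i) (dob X i) (dob Y i) n\<^esub>" for n
      using d[OF zero_H[OF o']] o' i by (simp add: L_simps(3))
    fix f n assume f: "f \<in> carrier (dghom L X Y n)"
    note f' = dmor_in[OF o f]
    show "dmor (f \<oplus>\<^bsub>dghom L X Y n\<^esub> g) i = dmor f i \<oplus>\<^bsub>dghom (A i) (dob X i) (dob Y i) n\<^esub> dmor g i"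
      if "g \<in> carrier (dghom L X Y n)" for g
      using d[OF add_H[OF o' f' dmor_in[OF o that]]] o' i by (simp add: L_simps(4))
    show "dmor (a \<odot>\<^bsub>dghom L X Y n\<^esub> f) i = a \<odot>\<^bsub>dghom (A i) (dob X i) (dob Y i) n\<^esub> dmor f i"
      if "a \<in> carrier K" for a
      using d[OF smult_H[OF o' that f']] o' i by (simp add: L_simps(5))
    show "dmor (dgdiff L X Y n f) i = dgdiff (A i) (dob X i) (dob Y i) n (dmor f i)"
      using d[OF diff_H[OF o' f']] o' i by (simp add: L_simps(6))
  next
    fix X Y Z m n f g
    assume o: "X \<in> dgobj L" "Y \<in> dgobj L" "Z \<in> dgobj L"
      and f: "f \<in> carrier (dghom L Y Z m)" and g: "g \<in> carrier (dghom L X Y n)"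
    show "dmor (dgcomp L X Y Z m n f g) i
        = dgcomp (A i) (dob X i) (dob Y i) (dob Z i) m n (dmor f i) (dmor g i)"
      using d[OF comp_H[OF dob_in[OF o(1)] dob_in[OF o(2)] dob_in[OF o(3)] dmor_in[OF o(2,3) f]
            dmor_in[OF o(1,2) g]]] dob_in o i by (simp add: L_simps(7))
  qed
qed

text \<open>Families that agree on \<open>I\<close> are equal, being extensional, and encoding loses
  nothing. From here on \<open>weakly_unital\<close> and \<open>lift_map\<close> hold for
  \<open>L\<close>.\<close>

sublocale jointly_faithful K L I A "\<lambda>i X. dob X i" "\<lambda>i X Y n f. dmor f i"
proof (intro jointly_faithful.intro jointly_faithful_axioms.intro L_closed project)
  fix X Y n f g
  assume o: "X \<in> dgobj L" "Y \<in> dgobj L"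
    and f: "f \<in> carrier (dghom L X Y n)" and g: "g \<in> carrier (dghom L X Y n)"
    and eq: "\<And>i. i \<in> I \<Longrightarrow> dmor f i = dmor g i"
  note o' = dob_in[OF o(1)] dob_in[OF o(2)]
  have "dmor f = dmor g"
    using H_ext[OF o' dmor_in[OF o f]] H_ext[OF o' dmor_in[OF o g]] eq by (rule extensionalityI)
  moreover have "em (dmor f) = f" "em (dmor g) = g"
    using f g o' by (auto simp: L_simps(2))
  ultimately show "f = g" by metis
qed

text \<open>A family of maps from \<open>B\<close> to the factors whose tuples stay inside
  \<open>Ob\<close> and \<open>H\<close> assembles to a map into \<open>L\<close>: its coordinates
  are the given maps.\<close>

lemma lift:
  assumes B: "wudg_closed K B"
    and G: "\<And>i. i \<in> I \<Longrightarrow> dgwu_map K B (A i) (Go i) (Gm i)"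
    and Go: "\<And>X. X \<in> dgobj B \<Longrightarrow> (\<lambda>i\<in>I. Go i X) \<in> Ob"
    and Gm: "\<And>X Y n f. \<lbrakk>X \<in> dgobj B; Y \<in> dgobj B; f \<in> carrier (dghom B X Y n)\<rbrakk>
      \<Longrightarrow> (\<lambda>i\<in>I. Gm i X Y n f) \<in> H (\<lambda>i\<in>I. Go i X) (\<lambda>i\<in>I. Go i Y) n"
  shows "dgwu_map K B L (\<lambda>X. eo (\<lambda>i\<in>I. Go i X)) (\<lambda>X Y n f. em (\<lambda>i\<in>I. Gm i X Y n f))"
proof (rule lift_map[OF B])
  fix i assume i: "i \<in> I"
  have m: "dmor (em (\<lambda>i\<in>I. Gm i X Y n f)) = (\<lambda>i\<in>I. Gm i X Y n f)"
    if "X \<in> dgobj B" "Y \<in> dgobj B" "f \<in> carrier (dghom B X Y n)" for X Y n f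
    using dmor_em[OF Go Go Gm] that by blast
  show "dgwu_map K B (A i) (\<lambda>X. dob (eo (\<lambda>i\<in>I. Go i X)) i) (\<lambda>X Y n f. dmor (em (\<lambda>i\<in>I. Gm i X Y n f)) i)"
    by (rule dgwu_map_cong[OF G[OF i]]) (use i in \<open>simp_all add: Go m\<close>)
qed (simp_all add: L_simps(1,2) Go Gm)

end

section \<open>Cardinality bounds\<close>

text \<open>The predicate \<open>small\<close> measures a set against its own element type. Families
  and lists of elements of \<open>'u\<close> have other types, so the bound is passed as a type
  token.\<close>

definition small_in :: "'u itself \<Rightarrow> 'a set \<Rightarrow> bool" where
  "small_in U A \<longleftrightarrow> |A| <o |UNIV :: 'u set|"

lemma small_in_image: "small_in U A \<Longrightarrow> small_in U (f ` A)"
  unfolding small_in_def by (rule ordLeq_ordLess_trans[OF card_of_image])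

lemma small_in_subset: "small_in U B \<Longrightarrow> A \<subseteq> B \<Longrightarrow> small_in U A"
  unfolding small_in_def by (rule ordLeq_ordLess_trans[OF card_of_mono1])

text \<open>The source of the encodings \<open>eo\<close> and \<open>em\<close> into
  \<open>'u\<close>.\<close>

lemma small_in_inj:
  assumes "small_in TYPE('u) A"
  obtains f :: "'a \<Rightarrow> 'u" where "inj_on f A"
proof -
  have "|A| \<le>o |UNIV :: 'u set|"
    using assms unfolding small_in_def by (rule ordLess_imp_ordLeq)
  then show ?thesis using that by (auto simp: card_of_ordLeq[symmetric])
qed

text \<open>Regularity absorbs unions over small index sets; uncountability absorbs countable ones,
  such as unions over all degrees, all lengths of strings or all stages of a closure.\<close>

locale regular_universe =
  fixes U :: "'u itself"
  assumes uncountable: "natLeq <o |UNIV :: 'u set|" and regular: "regularCard |UNIV :: 'u set|"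
begin

lemma infinite_univ: "infinite (UNIV :: 'u set)"
proof -
  have "natLeq \<le>o |UNIV :: 'u set|" using uncountable by (rule ordLess_imp_ordLeq)
  then show ?thesis using finite_iff_ordLess_natLeq not_ordLess_ordLeq by blast
qed

lemma stable_univ: "stable |UNIV :: 'u set|"
  by (rule regularCard_stable[OF card_of_Card_order _ regular])
    (simp add: infinite_univ Field_card_of)

lemma small_in_UN:
  assumes "small_in U I" "\<And>i. i \<in> I \<Longrightarrow> small_in U (B i)"
  shows "small_in U (\<Union>i\<in>I. B i)"
  using assms unfolding small_in_def
  by (intro card_of_UNION_ordLess_infinite[OF stable_univ]) auto

lemma small_in_finite: "finite A \<Longrightarrow> small_in U A"
  unfolding small_in_def
  by (rule finite_ordLess_infinite[OF card_of_Well_order card_of_Well_order])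
    (simp_all add: infinite_univ Field_card_of)

lemma small_in_countable:
  assumes "countable A"
  shows "small_in U A"
proof -
  have "|A| \<le>o |UNIV :: nat set|"
    using assms unfolding countable_def by (auto intro: card_of_ordLeqI)
  then have "|A| \<le>o natLeq"
    using card_of_nat ordLeq_ordIso_trans by blast
  then show ?thesis
    unfolding small_in_def using uncountable by (rule ordLeq_ordLess_trans)
qed

lemma small_in_Times:
  assumes "small_in U A" "small_in U B"
  shows "small_in U (A \<times> B)"
proof -
  have "small_in U (\<Union>a\<in>A. Pair a ` B)"
    by (rule small_in_UN[OF assms(1) small_in_image[OF assms(2)]])
  moreover have "A \<times> B = (\<Union>a\<in>A. Pair a ` B)" by auto
  ultimately show ?thesis by simp
qed

lemma small_in_insert:
  assumes "small_in U A"
  shows "small_in U (insert a A)"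
proof -
  have "small_in U (\<Union>C\<in>{{a}, A}. C)"
  proof (rule small_in_UN[OF small_in_finite])
    fix C assume "C \<in> {{a}, A}"
    then consider "C = {a}" | "C = A" by blast
    then show "small_in U C" by cases (simp_all only: assms small_in_finite finite.intros)
  qed simp
  then show ?thesis by simp
qed

text \<open>Lists of a fixed length embed in an iterated product, and there are countably many
  lengths.\<close>

lemma small_in_lists:
  assumes "small_in U A"
  shows "small_in U (lists A)"
proof -
  have "small_in U {xs \<in> lists A. length xs = n}" for n
  proof (induction n)
    case 0
    have "{xs \<in> lists A. length xs = 0} \<subseteq> {[]}" by auto
    then show ?case by (rule small_in_subset[rotated]) (simp add: small_in_finite)
  next
    case (Suc n)
    have "{xs \<in> lists A. length xs = Suc n} \<subseteq> (\<lambda>(x, xs). x # xs) ` (A \<times> {xs \<in> lists A. length xs = n})"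
    proof
      fix xs assume "xs \<in> {xs \<in> lists A. length xs = Suc n}"
      then show "xs \<in> (\<lambda>(x, xs). x # xs) ` (A \<times> {xs \<in> lists A. length xs = n})"
        by (cases xs) auto
    qed
    then show ?case
      by (rule small_in_subset[OF small_in_image[OF small_in_Times[OF assms Suc.IH]]])
  qed
  then have "small_in U (\<Union>n. {xs \<in> lists A. length xs = n})"
    by (rule small_in_UN[OF small_in_countable[OF countableI_type]])
  moreover have "lists A = (\<Union>n. {xs \<in> lists A. length xs = n})" by auto
  ultimately show ?thesis by simp
qed

text \<open>Finitary operations close up after countably many stages: the finitely many arguments of
  an operation already lie in one stage, so the value lies in the next. The parameter
  \<open>p\<close> carries the choice of operation together with its constants.\<close>

lemma small_in_closure:
  fixes op :: "'p \<Rightarrow> 'a list \<Rightarrow> 'a"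
  assumes "small_in U P"
  obtains S where "small_in U S" "\<And>p xs. p \<in> P \<Longrightarrow> set xs \<subseteq> S \<Longrightarrow> op p xs \<in> S"
proof
  \<comment> \<open>Stage 0 may be empty: the empty list is an argument list over it, so the
    constants enter at stage 1.\<close>
  define stage where "stage = rec_nat {} (\<lambda>_ T. (\<lambda>(p, xs). op p xs) ` (P \<times> lists T))"
  have stage: "stage 0 = {}" "stage (Suc k) = (\<lambda>(p, xs). op p xs) ` (P \<times> lists (stage k))" for k
    by (simp_all add: stage_def)
  have mono: "stage k \<subseteq> stage (Suc k)" for k
  proof (induction k)
    case (Suc k)
    then have "P \<times> lists (stage k) \<subseteq> P \<times> lists (stage (Suc k))"
      using lists_mono by blast
    then show ?case unfolding stage(2)[of k] stage(2)[of "Suc k"] by (rule image_mono)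
  qed (simp add: stage)
  then have mono': "i \<le> j \<Longrightarrow> stage i \<subseteq> stage j" for i j
    by (rule lift_Suc_mono_le)
  have small_stage: "small_in U (stage k)" for k
    by (induction k) (simp_all add: stage small_in_finite small_in_image small_in_Times assms small_in_lists)
  show "small_in U (\<Union>k. stage k)"
    by (rule small_in_UN[OF small_in_countable[OF countableI_type] small_stage])
  fix p and xs :: "'a list" assume p: "p \<in> P" and "set xs \<subseteq> (\<Union>k. stage k)"
  \<comment> \<open>The stages increase, so finitely many of them are contained in the
    largest.\<close>
  then have "\<exists>k. set xs \<subseteq> stage k"
  proof (induction xs)
    case (Cons x xs)
    then obtain k l where "set xs \<subseteq> stage k" "x \<in> stage l" by auto
    then have "set (x # xs) \<subseteq> stage (max k l)"
      using mono'[of k "max k l"] mono'[of l "max k l"] by auto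
    then show ?case ..
  qed simp
  then obtain k where "set xs \<subseteq> stage k" ..
  with p have "op p xs \<in> stage (Suc k)"
    unfolding stage by force
  then show "op p xs \<in> (\<Union>k. stage k)" by blast
qed

end

section \<open>Small substructures as objects\<close>

lemma composable_eval_at:
  assumes "aug_string K Ob H xs ds fs"
    and "\<And>x. x \<in> Ob \<Longrightarrow> x i \<in> dgobj A"
    and "\<And>x y n f. \<lbrakk>x \<in> Ob; y \<in> Ob; f \<in> H x y n\<rbrakk> \<Longrightarrow> f i \<in> carrier (dghom A (x i) (y i) n)"
  shows "composable (augment K A) (map (\<lambda>x. x i) xs) ds (eval_at i fs)"
  unfolding composable_def
proof (intro conjI allI impI)
  fix j assume "j < length (eval_at i fs)"
  then have j: "j < length fs" by simp
  have "xs ! j \<in> Ob" "xs ! Suc j \<in> Ob"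
    using assms(1) j by (auto simp: aug_string_def)
  moreover obtain f c where "fs ! j = (f, c)" by (meson surj_pair)
  moreover have "fst (fs ! j) \<in> H (xs ! Suc j) (xs ! j) (ds ! j)" "snd (fs ! j) \<in> carrier K"
      "xs ! Suc j = xs ! j \<and> ds ! j = 0 \<or> snd (fs ! j) = \<zero>\<^bsub>K\<^esub>" "length xs = Suc (length fs)"
    using assms(1) j by (auto simp: aug_string_def)
  ultimately show "eval_at i fs ! j \<in> carrier (dghom (augment K A) (map (\<lambda>x. x i) xs ! Suc j)
      (map (\<lambda>x. x i) xs ! j) (ds ! j))"
    using j by (auto simp: augment_simps aug_hom_simps assms(3))
qed (use assms(1,2) in \<open>auto simp: aug_string_def augment_simps eval_at_def subset_iff\<close>)

lemma Comp_eval: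
  "X \<in> dgobj A \<Longrightarrow> fst (Comp (Cat_dgwu K) A B C G F) X = fst G (fst F X)"
  "\<lbrakk>X \<in> dgobj A; Y \<in> dgobj A; f \<in> carrier (dghom A X Y n)\<rbrakk>
    \<Longrightarrow> snd (Comp (Cat_dgwu K) A B C G F) X Y n f = snd G (fst F X) (fst F Y) n (snd F X Y n f)"
  by (simp_all add: Cat_dgwu_simps dg_fun_restrict_simps)

text \<open>With encodings into \<open>'u\<close> and small carriers, \<open>L\<close> is an object
  of the category. Extensionality of the families in \<open>Ob\<close> lets equality of objects be
  tested coordinatewise, which uniqueness of mediating functors requires besides faithfulness on
  morphisms.\<close>

locale small_subproduct = subproduct K I A Ob H eo em
  for K :: "('k, 'r) ring_scheme" (structure)
    and I :: "'i set" and A :: "'i \<Rightarrow> ('u, 'u, 'k) wudg_data"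
    and Ob :: "('i \<Rightarrow> 'u) set" and H :: "('i \<Rightarrow> 'u) \<Rightarrow> ('i \<Rightarrow> 'u) \<Rightarrow> int \<Rightarrow> ('i \<Rightarrow> 'u) set"
    and eo :: "('i \<Rightarrow> 'u) \<Rightarrow> 'u" and em :: "('i \<Rightarrow> 'u) \<Rightarrow> 'u" +
  assumes Ob_ext: "x \<in> Ob \<Longrightarrow> x \<in> extensional I"
    and small_Ob: "small_in TYPE('u) Ob"
    and small_H: "\<lbrakk>x \<in> Ob; y \<in> Ob\<rbrakk> \<Longrightarrow> small_in TYPE('u) (H x y n)"
begin

lemma L_object: "L \<in> Obj (Cat_dgwu K)"
proof -
  have "small_in TYPE('u) (dgobj L)"
    unfolding L_simps by (rule small_in_image[OF small_Ob])
  moreover have "small_in TYPE('u) (carrier (dghom L X Y n))" if "X \<in> dgobj L" "Y \<in> dgobj L" for X Y n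
    unfolding L_simps by (intro small_in_image small_H dob_in that)
  ultimately show ?thesis
    by (simp add: Cat_dgwu_simps weakly_unital small_wudg_def small_def small_in_def)
qed

definition proj :: "'i \<Rightarrow> ('u, 'u) dg_fun" where
  "proj i = dg_fun_restrict L (\<lambda>X. dob X i, \<lambda>X Y n f. dmor f i)"

lemma proj_simps:
  "X \<in> dgobj L \<Longrightarrow> fst (proj i) X = dob X i"
  "\<lbrakk>X \<in> dgobj L; Y \<in> dgobj L; f \<in> carrier (dghom L X Y n)\<rbrakk> \<Longrightarrow> snd (proj i) X Y n f = dmor f i"
  by (simp_all add: proj_def dg_fun_restrict_simps)

lemma proj_functor: "i \<in> I \<Longrightarrow> weakly_unital_dg_functor K L (A i) (proj i)"
  unfolding proj_def by (intro dgwu_map_imp_functor project weakly_unital)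

definition mediate :: "('u, 'u, 'k) wudg_data \<Rightarrow> ('i \<Rightarrow> ('u, 'u) dg_fun) \<Rightarrow> ('u, 'u) dg_fun" where
  "mediate B \<xi> = dg_fun_restrict B
    (\<lambda>X. eo (\<lambda>i\<in>I. fst (\<xi> i) X), \<lambda>X Y n f. em (\<lambda>i\<in>I. snd (\<xi> i) X Y n f))"

lemma mediate_simps:
  "X \<in> dgobj B \<Longrightarrow> fst (mediate B \<xi>) X = eo (\<lambda>i\<in>I. fst (\<xi> i) X)"
  "\<lbrakk>X \<in> dgobj B; Y \<in> dgobj B; f \<in> carrier (dghom B X Y n)\<rbrakk>
    \<Longrightarrow> snd (mediate B \<xi>) X Y n f = em (\<lambda>i\<in>I. snd (\<xi> i) X Y n f)"
  by (simp_all add: mediate_def dg_fun_restrict_simps)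

context
  fixes B :: "('u, 'u, 'k) wudg_data" and \<xi> :: "'i \<Rightarrow> ('u, 'u) dg_fun"
  assumes B: "weakly_unital_dg_category K B"
    and \<xi>: "\<And>i. i \<in> I \<Longrightarrow> weakly_unital_dg_functor K B (A i) (\<xi> i)"
    and \<xi>_Ob: "\<And>X. X \<in> dgobj B \<Longrightarrow> (\<lambda>i\<in>I. fst (\<xi> i) X) \<in> Ob"
    and \<xi>_H: "\<And>X Y n f. \<lbrakk>X \<in> dgobj B; Y \<in> dgobj B; f \<in> carrier (dghom B X Y n)\<rbrakk>
      \<Longrightarrow> (\<lambda>i\<in>I. snd (\<xi> i) X Y n f) \<in> H (\<lambda>i\<in>I. fst (\<xi> i) X) (\<lambda>i\<in>I. fst (\<xi> i) Y) n"
begin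

lemma mediate_functor: "weakly_unital_dg_functor K B L (mediate B \<xi>)"
proof -
  interpret B: weakly_unital_dg_category K B by (rule B)
  show ?thesis
    unfolding mediate_def
    by (intro dgwu_map_imp_functor B lift B.wudg_closed_axioms functor_imp_dgwu_map \<xi> \<xi>_Ob \<xi>_H)
qed

lemma proj_mediate:
  assumes i: "i \<in> I"
  shows "Comp (Cat_dgwu K) B L (A i) (proj i) (mediate B \<xi>) = \<xi> i"
proof (rule functor_eqI)
  show "weakly_unital_dg_functor K B (A i) (Comp (Cat_dgwu K) B L (A i) (proj i) (mediate B \<xi>))"
    unfolding Cat_dgwu_simps by (rule functor_comp[OF mediate_functor proj_functor[OF i]])
  show "weakly_unital_dg_functor K B (A i) (\<xi> i)" by (rule \<xi>[OF i])
  interpret m: dgwu_map K B L "fst (mediate B \<xi>)" "snd (mediate B \<xi>)"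
    by (rule functor_imp_dgwu_map[OF mediate_functor])
  fix X assume X: "X \<in> dgobj B"
  then show "fst (Comp (Cat_dgwu K) B L (A i) (proj i) (mediate B \<xi>)) X = fst (\<xi> i) X"
    using i m.Fo_in[OF X] by (simp add: Comp_eval proj_simps mediate_simps \<xi>_Ob)
  fix Y n f assume Y: "Y \<in> dgobj B" and f: "f \<in> carrier (dghom B X Y n)"
  then show "snd (Comp (Cat_dgwu K) B L (A i) (proj i) (mediate B \<xi>)) X Y n f = snd (\<xi> i) X Y n f"
    using i m.Fo_in[OF X] m.Fo_in[OF Y] m.Fm_in[OF X Y f] dmor_em[OF \<xi>_Ob[OF X] \<xi>_Ob[OF Y] \<xi>_H[OF X Y f]]
    by (simp add: Comp_eval proj_simps X mediate_simps(2))
qed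

end

text \<open>Equality on objects has to come first: values on morphisms can be compared by
  faithfulness only once they lie in the same hom space of \<open>L\<close>.\<close>

lemma functor_into_L_eqI:
  assumes h: "weakly_unital_dg_functor K B L h" "weakly_unital_dg_functor K B L h'"
    and eq: "\<And>i. i \<in> I \<Longrightarrow> Comp (Cat_dgwu K) B L (A i) (proj i) h = Comp (Cat_dgwu K) B L (A i) (proj i) h'"
  shows "h = h'"
proof (rule functor_eqI[OF h])
  interpret h: dgwu_map K B L "fst h" "snd h" by (rule functor_imp_dgwu_map[OF h(1)])
  interpret h': dgwu_map K B L "fst h'" "snd h'" by (rule functor_imp_dgwu_map[OF h(2)])
  have eo_dob: "eo (dob X) = X" if "X \<in> dgobj L" for X
    using that by (auto simp: L_simps(1))
  show o: "fst h X = fst h' X" if X: "X \<in> dgobj B" for X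
  proof -
    have "dob (fst h X) i = dob (fst h' X) i" if "i \<in> I" for i
      using arg_cong[OF eq[OF that], of "\<lambda>F. fst F X"] X h.Fo_in h'.Fo_in
      by (simp add: Comp_eval proj_simps)
    then have "dob (fst h X) = dob (fst h' X)"
      using Ob_ext[OF dob_in[OF h.Fo_in[OF X]]] Ob_ext[OF dob_in[OF h'.Fo_in[OF X]]]
      by (intro extensionalityI) auto
    then show ?thesis using eo_dob h.Fo_in[OF X] h'.Fo_in[OF X] by metis
  qed
  fix X Y n f assume X: "X \<in> dgobj B" and Y: "Y \<in> dgobj B" and f: "f \<in> carrier (dghom B X Y n)"
  show "snd h X Y n f = snd h' X Y n f"
  proof (rule faithful[OF h.Fo_in[OF X] h.Fo_in[OF Y] h.Fm_in[OF X Y f]])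
    show f': "snd h' X Y n f \<in> carrier (dghom L (fst h X) (fst h Y) n)"
      using h'.Fm_in[OF X Y f] o X Y by simp
    fix i assume "i \<in> I"
    from arg_cong[OF eq[OF this], of "\<lambda>F. snd F X Y n f"]
    show "dmor (snd h X Y n f) i = dmor (snd h' X Y n f) i"
      using X Y f f' h.Fo_in h.Fm_in o by (simp add: Comp_eval proj_simps)
  qed
qed

end

section \<open>Limits\<close>

lemma universe_regular:
  assumes "universe TYPE('v) TYPE('u)"
  shows "regular_universe TYPE('u)"
  using assms by unfold_locales (auto simp: universe_def)

lemma universe_Func:
  fixes A :: "'u set" and B :: "'v set"
  assumes "universe TYPE('v) TYPE('u)" "small_in TYPE('u) A" "small B"
  shows "small_in TYPE('u) (Func B A)"
  using assms by (simp add: universe_def small_in_def small_def)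

text \<open>Smallness in \<open>'v\<close> has to be turned into smallness relative to
  \<open>'u\<close>, so that unions over the objects of \<open>J\<close> stay small;
  \<open>universe\<close> itself speaks only of sets of functions on \<open>B\<close>.\<close>

lemma universe_index:
  fixes B :: "'v set"
  assumes U: "universe TYPE('v) TYPE('u)" and B: "small B"
  shows "small_in TYPE('u) B"
proof -
  interpret regular_universe "TYPE('u)" by (rule universe_regular[OF U])
  \<comment> \<open>Embed \<open>B\<close> into its characteristic functions.\<close>
  obtain a b :: 'u where ab: "a \<noteq> b"
    using infinite_univ by (metis (full_types) finite.simps UNIV_eq_I insertI1 singletonD)
  let ?f = "\<lambda>x y. if y \<in> B then if y = x then a else b else undefined"
  have "inj_on ?f B"
  proof (rule inj_onI)
    fix x y assume "x \<in> B" "y \<in> B" "?f x = ?f y"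
    from fun_cong[OF this(3), of x] this(1,2) ab show "x = y" by (auto split: if_splits)
  qed
  moreover have "?f x \<in> Func B {a, b}" for x
    by (auto simp: Func_def)
  ultimately have "|B| \<le>o |Func B {a, b}|"
    by (rule card_of_ordLeqI)
  moreover have "small_in TYPE('u) (Func B {a, b})"
    by (rule universe_Func[OF U small_in_finite B]) simp
  ultimately show ?thesis
    unfolding small_in_def by (rule ordLeq_ordLess_trans)
qed

section \<open>Size bounds for a diagram and its compatible families\<close>

locale small_diagram = diagram J "Cat_dgwu K :: (('u, 'u, 'k) wudg_data, ('u, 'u) dg_fun) category_data" Do Dm
  for K :: "('k, 'r) ring_scheme" (structure) and J :: "('v, 'v) category_data" and Do Dm +
  assumes field: "field K" and universe: "universe TYPE('v) TYPE('u)" and small_J: "small_category J"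
begin

sublocale regular_universe "TYPE('u)" by (rule universe_regular[OF universe])

sublocale K: field K by (rule field)

lemma vertex: "j \<in> Obj J \<Longrightarrow> weakly_unital_dg_category K (Do j)"
  using Do_in by (simp add: Cat_dgwu_simps)

lemma arrow: "\<lbrakk>i \<in> Obj J; j \<in> Obj J; u \<in> Mor J i j\<rbrakk> \<Longrightarrow> weakly_unital_dg_functor K (Do i) (Do j) (Dm i j u)"
  using Dm_in by (simp add: Cat_dgwu_simps)

lemma small_objs: "j \<in> Obj J \<Longrightarrow> small_in TYPE('u) (dgobj (Do j))"
  using Do_in by (simp add: Cat_dgwu_simps small_wudg_def small_def small_in_def)

lemma small_homs: "\<lbrakk>j \<in> Obj J; X \<in> dgobj (Do j); Y \<in> dgobj (Do j)\<rbrakk>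
    \<Longrightarrow> small_in TYPE('u) (carrier (dghom (Do j) X Y n))"
  using Do_in by (simp add: Cat_dgwu_simps small_wudg_def small_def small_in_def)

lemma small_index: "small (Obj J)" "small_in TYPE('u) (Obj J)"
  using small_J universe_index[OF universe] by (simp_all add: small_category_def)

definition all_objs :: "'u set" where "all_objs = (\<Union>j\<in>Obj J. dgobj (Do j))"

definition all_homs :: "'u set" where
  "all_homs = (\<Union>j\<in>Obj J. \<Union>X\<in>dgobj (Do j). \<Union>Y\<in>dgobj (Do j). \<Union>n. carrier (dghom (Do j) X Y n))"

lemma small_all_objs: "small_in TYPE('u) all_objs"
  unfolding all_objs_def by (intro small_in_UN small_index small_objs)

lemma small_all_homs: "small_in TYPE('u) all_homs"
  unfolding all_homs_def
  by (intro small_in_UN small_index small_objs small_homs small_in_countable countableI_type)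

definition lim_obj :: "('v \<Rightarrow> 'u) set" where
  "lim_obj = {x \<in> extensional (Obj J). (\<forall>j\<in>Obj J. x j \<in> dgobj (Do j)) \<and>
    (\<forall>i\<in>Obj J. \<forall>j\<in>Obj J. \<forall>u\<in>Mor J i j. fst (Dm i j u) (x i) = x j)}"

definition lim_hom :: "('v \<Rightarrow> 'u) \<Rightarrow> ('v \<Rightarrow> 'u) \<Rightarrow> int \<Rightarrow> ('v \<Rightarrow> 'u) set" where
  "lim_hom x y n = {f \<in> extensional (Obj J). (\<forall>j\<in>Obj J. f j \<in> carrier (dghom (Do j) (x j) (y j) n)) \<and>
    (\<forall>i\<in>Obj J. \<forall>j\<in>Obj J. \<forall>u\<in>Mor J i j. snd (Dm i j u) (x i) (y i) n (f i) = f j)}"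

lemma lim_objD:
  assumes "x \<in> lim_obj"
  shows "x \<in> extensional (Obj J)" "j \<in> Obj J \<Longrightarrow> x j \<in> dgobj (Do j)"
    "\<lbrakk>i \<in> Obj J; j \<in> Obj J; u \<in> Mor J i j\<rbrakk> \<Longrightarrow> fst (Dm i j u) (x i) = x j"
  using assms by (simp_all add: lim_obj_def)

lemma lim_homD:
  assumes "f \<in> lim_hom x y n"
  shows "f \<in> extensional (Obj J)" "j \<in> Obj J \<Longrightarrow> f j \<in> carrier (dghom (Do j) (x j) (y j) n)"
    "\<lbrakk>i \<in> Obj J; j \<in> Obj J; u \<in> Mor J i j\<rbrakk> \<Longrightarrow> snd (Dm i j u) (x i) (y i) n (f i) = f j"
  using assms by (simp_all add: lim_hom_def)

lemma lim_homI:
  assumes "\<And>j. j \<in> Obj J \<Longrightarrow> f j \<in> carrier (dghom (Do j) (x j) (y j) n)"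
    and "\<And>i j u. \<lbrakk>i \<in> Obj J; j \<in> Obj J; u \<in> Mor J i j\<rbrakk> \<Longrightarrow> snd (Dm i j u) (x i) (y i) n (f i) = f j"
  shows "restrict f (Obj J) \<in> lim_hom x y n"
  using assms by (simp add: lim_hom_def)

text \<open>A compatible family is a function on \<open>Obj J\<close> with values in the union of
  all vertices. Regularity does not bound sets of functions; this is where closure of the small sets
  under products indexed by \<open>'v\<close> enters.\<close>

lemma small_lim_obj: "small_in TYPE('u) lim_obj"
proof (rule small_in_subset[OF universe_Func[OF universe small_all_objs small_index(1)]])
  show "lim_obj \<subseteq> Func (Obj J) all_objs"
    by (auto simp: lim_obj_def Func_def all_objs_def extensional_def)
qed

lemma lim_hom_Func: "\<lbrakk>x \<in> lim_obj; y \<in> lim_obj\<rbrakk> \<Longrightarrow> lim_hom x y n \<subseteq> Func (Obj J) all_homs"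
  by (auto simp: lim_hom_def lim_obj_def Func_def all_homs_def extensional_def) blast

lemma small_Func_homs: "small_in TYPE('u) (Func (Obj J) all_homs)"
  by (rule universe_Func[OF universe small_all_homs small_index(1)])

text \<open>Applying an operation to compatible families gives a compatible family because the
  functors \<open>Dm i j u\<close> preserve that operation; for \<open>wup\<close> this is exactly
  their compatibility with \<open>p\<close>. The encoding \<open>em\<close> is given on all
  functions into \<open>all_homs\<close>, a set that contains every
  \<open>lim_hom x y n\<close>.\<close>

lemma lim_subproduct:
  assumes eo: "inj_on eo lim_obj" and em: "inj_on em (Func (Obj J) all_homs)"
  shows "small_subproduct K (Obj J) Do lim_obj lim_hom (eo :: _ \<Rightarrow> 'u) (em :: _ \<Rightarrow> 'u)"
proof (intro small_subproduct.intro subproduct.intro subproduct_axioms.intro small_subproduct_axioms.intro)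
  note D = functor_imp_dgwu_map[OF arrow]
  note ops = dgwu_map.Fm_zero[OF D] dgwu_map.Fm_add[OF D] dgwu_map.Fm_smult[OF D]
    dgwu_map.Fm_diff[OF D] dgwu_map.Fm_comp[OF D] dgwu_map.Fm_id[OF D]
  have wc: "wudg_closed K (Do j)" if "j \<in> Obj J" for j
  proof -
    interpret weakly_unital_dg_category K "Do j" by (rule vertex[OF that])
    show ?thesis by (rule wudg_closed_axioms)
  qed
  note cl = wudg_closed.zero_in[OF wc] wudg_closed.add_in[OF wc] wudg_closed.smult_in[OF wc]
    wudg_closed.diff_in[OF wc] wudg_closed.comp_in[OF wc] wudg_closed.wuid_in[OF wc]
  show "weakly_unital_dg_category K (Do j)" if "j \<in> Obj J" for j by (rule vertex[OF that])
  show "x j \<in> dgobj (Do j)" if "x \<in> lim_obj" "j \<in> Obj J" for x j by (rule lim_objD(2)[OF that])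
  show "inj_on eo lim_obj" by (rule eo)
  show "inj_on em (\<Union>x\<in>lim_obj. \<Union>y\<in>lim_obj. \<Union>n. lim_hom x y n)"
    by (rule inj_on_subset[OF em]) (use lim_hom_Func in blast)
  show "x \<in> extensional (Obj J)" if "x \<in> lim_obj" for x by (rule lim_objD(1)[OF that])
  show "small_in TYPE('u) lim_obj" by (rule small_lim_obj)
  show "(\<lambda>j\<in>Obj J. wuid (Do j) (x j)) \<in> lim_hom x x 0" if x: "x \<in> lim_obj" for x
    by (rule lim_homI) (use x in \<open>simp_all add: ops cl lim_objD\<close>)
  fix x y n assume x: "x \<in> lim_obj" and y: "y \<in> lim_obj"
  note xy = lim_objD(2,3)[OF x] lim_objD(2,3)[OF y]
  show "small_in TYPE('u) (lim_hom x y n)"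
    by (rule small_in_subset[OF small_Func_homs lim_hom_Func[OF x y]])
  show "(\<lambda>j\<in>Obj J. \<zero>\<^bsub>dghom (Do j) (x j) (y j) n\<^esub>) \<in> lim_hom x y n"
    by (rule lim_homI) (simp_all add: ops cl xy)
  fix f assume f: "f \<in> lim_hom x y n"
  note f' = lim_homD(2,3)[OF f]
  show "f j \<in> carrier (dghom (Do j) (x j) (y j) n)" if "j \<in> Obj J" for j by (rule f'(1)[OF that])
  show "f \<in> extensional (Obj J)" by (rule lim_homD(1)[OF f])
  show "(\<lambda>j\<in>Obj J. f j \<oplus>\<^bsub>dghom (Do j) (x j) (y j) n\<^esub> g j) \<in> lim_hom x y n" if g: "g \<in> lim_hom x y n" for g
    by (rule lim_homI) (simp_all add: ops cl xy f' lim_homD(2,3)[OF g])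
  show "(\<lambda>j\<in>Obj J. a \<odot>\<^bsub>dghom (Do j) (x j) (y j) n\<^esub> f j) \<in> lim_hom x y n" if "a \<in> carrier K" for a
    by (rule lim_homI) (simp_all add: ops cl xy f' that)
  show "(\<lambda>j\<in>Obj J. dgdiff (Do j) (x j) (y j) n (f j)) \<in> lim_hom x y (n + 1)"
    by (rule lim_homI) (simp_all add: ops cl xy f')
next
  note D = functor_imp_dgwu_map[OF arrow]
  fix x y z m n f g
  assume x: "x \<in> lim_obj" and y: "y \<in> lim_obj" and z: "z \<in> lim_obj"
    and f: "f \<in> lim_hom y z m" and g: "g \<in> lim_hom x y n"
  show "(\<lambda>j\<in>Obj J. dgcomp (Do j) (x j) (y j) (z j) m n (f j) (g j)) \<in> lim_hom x z (m + n)"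
    by (rule lim_homI)
      (simp_all add: dgwu_map.Fm_comp[OF D] nonunital_dg_category.comp_closed[OF
        weakly_unital_dg_category.axioms(1)[OF vertex]]
        lim_objD(2,3)[OF x] lim_objD(2,3)[OF y] lim_objD(2,3)[OF z] lim_homD(2,3)[OF f] lim_homD(2,3)[OF g])
next
  fix xs ds and fs :: "(('v \<Rightarrow> 'u) \<times> 'k) list"
  assume s: "aug_string K lim_obj lim_hom xs ds fs"
  have lens: "length xs = Suc (length fs)" "length ds = length fs" "xs \<noteq> []" and xs: "set xs \<subseteq> lim_obj"
    using s by (auto simp: aug_string_def)
  have c: "composable (augment K (Do j)) (map (\<lambda>x. x j) xs) ds (eval_at j fs)" if "j \<in> Obj J" for j
    by (rule composable_eval_at[OF s]) (use that lim_objD lim_homD in auto)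
  show "(\<lambda>j\<in>Obj J. wup (Do j) (map (\<lambda>x. x j) xs) ds (eval_at j fs))
      \<in> lim_hom (last xs) (hd xs) (sum_list ds + 1 - int (length fs))"
  proof (rule lim_homI)
    fix j assume j: "j \<in> Obj J"
    show "wup (Do j) (map (\<lambda>x. x j) xs) ds (eval_at j fs)
        \<in> carrier (dghom (Do j) (last xs j) (hd xs j) (sum_list ds + 1 - int (length fs)))"
      using weakly_unital_dg_category.wup_closed[OF vertex[OF j] c[OF j]] lens
      by (simp add: hd_map last_map)
  next
    fix i j u assume i: "i \<in> Obj J" and j: "j \<in> Obj J" and u: "u \<in> Mor J i j"
    interpret D: dgwu_map K "Do i" "Do j" "fst (Dm i j u)" "snd (Dm i j u)"
      by (rule functor_imp_dgwu_map[OF arrow[OF i j u]])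
    \<comment> \<open>Entrywise this is compatibility of the families in the string: the transition
      functor carries coordinate \<open>i\<close> to coordinate \<open>j\<close>.\<close>
    have "map_string (snd (Dm i j u)) (map (\<lambda>x. x i) xs) ds (eval_at i fs) = eval_at j fs"
    proof (rule nth_equalityI)
      fix k assume "k < length (map_string (snd (Dm i j u)) (map (\<lambda>x. x i) xs) ds (eval_at i fs))"
      then have k: "k < length fs" by simp
      then have "fst (fs ! k) \<in> lim_hom (xs ! Suc k) (xs ! k) (ds ! k)"
        using s by (simp add: aug_string_def)
      from lim_homD(3)[OF this i j u]
      show "map_string (snd (Dm i j u)) (map (\<lambda>x. x i) xs) ds (eval_at i fs) ! k = eval_at j fs ! k"
        using k lens by (cases "fs ! k") simp
    qed simp
    moreover have "map (fst (Dm i j u)) (map (\<lambda>x. x i) xs) = map (\<lambda>x. x j) xs"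
      using xs lim_objD(3)[OF _ i j u] by auto
    ultimately show "snd (Dm i j u) (last xs i) (hd xs i) (sum_list ds + 1 - int (length fs))
          (wup (Do i) (map (\<lambda>x. x i) xs) ds (eval_at i fs))
        = wup (Do j) (map (\<lambda>x. x j) xs) ds (eval_at j fs)"
      using D.Fm_p[OF c[OF i]] lens by (simp add: hd_map last_map del: map_map)
  qed
qed (rule field)

theorem limit_exists: "\<exists>L \<pi>. is_limit J (Cat_dgwu K) Do Dm L \<pi>"
proof -
  obtain eo :: "('v \<Rightarrow> 'u) \<Rightarrow> 'u" where eo: "inj_on eo lim_obj"
    using small_in_inj[OF small_lim_obj] .
  obtain em :: "('v \<Rightarrow> 'u) \<Rightarrow> 'u" where em: "inj_on em (Func (Obj J) all_homs)"
    using small_in_inj[OF small_Func_homs] .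
  interpret S: small_subproduct K "Obj J" Do lim_obj lim_hom eo em
    by (rule lim_subproduct[OF eo em])
  have cone: "is_cone J (Cat_dgwu K) Do Dm S.L S.proj"
    unfolding is_cone_def
  proof (intro conjI ballI S.L_object)
    show "S.proj j \<in> Mor (Cat_dgwu K) S.L (Do j)" if "j \<in> Obj J" for j
      using S.proj_functor[OF that] by (simp add: Cat_dgwu_simps)
    fix i j u assume i: "i \<in> Obj J" and j: "j \<in> Obj J" and u: "u \<in> Mor J i j"
    show "Comp (Cat_dgwu K) S.L (Do i) (Do j) (Dm i j u) (S.proj i) = S.proj j"
    proof (rule functor_eqI)
      show "weakly_unital_dg_functor K S.L (Do j) (Comp (Cat_dgwu K) S.L (Do i) (Do j) (Dm i j u) (S.proj i))"
        unfolding Cat_dgwu_simps by (rule functor_comp[OF S.proj_functor[OF i] arrow[OF i j u]])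
      show "weakly_unital_dg_functor K S.L (Do j) (S.proj j)" by (rule S.proj_functor[OF j])
      fix X assume X: "X \<in> dgobj S.L"
      then show "fst (Comp (Cat_dgwu K) S.L (Do i) (Do j) (Dm i j u) (S.proj i)) X = fst (S.proj j) X"
        using lim_objD(3)[OF S.dob_in[OF X] i j u] by (simp add: Comp_eval S.proj_simps)
      fix Y n f assume "Y \<in> dgobj S.L" "f \<in> carrier (dghom S.L X Y n)"
      then show "snd (Comp (Cat_dgwu K) S.L (Do i) (Do j) (Dm i j u) (S.proj i)) X Y n f = snd (S.proj j) X Y n f"
        using lim_homD(3)[OF S.dmor_in[OF X] i j u] X by (simp add: Comp_eval S.proj_simps)
    qed
  qed
  have "\<exists>!h. h \<in> Mor (Cat_dgwu K) B S.L \<and> (\<forall>j\<in>Obj J. Comp (Cat_dgwu K) B S.L (Do j) (S.proj j) h = \<xi> j)"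
    if B: "is_cone J (Cat_dgwu K) Do Dm B \<xi>" for B \<xi>
  proof -
    have B_wu: "weakly_unital_dg_category K B"
      and \<xi>: "\<And>j. j \<in> Obj J \<Longrightarrow> weakly_unital_dg_functor K B (Do j) (\<xi> j)"
      and comm: "\<And>i j u. \<lbrakk>i \<in> Obj J; j \<in> Obj J; u \<in> Mor J i j\<rbrakk>
        \<Longrightarrow> Comp (Cat_dgwu K) B (Do i) (Do j) (Dm i j u) (\<xi> i) = \<xi> j"
      using B by (auto simp: is_cone_def Cat_dgwu_simps(1,2))
    note map = functor_imp_dgwu_map[OF \<xi>]
    \<comment> \<open>The cone equations, evaluated at one object, say that its images form a
      compatible family; \<open>\<xi>_hom\<close> is the same for a morphism. This is what places
      the tuples inside the substructure.\<close>
    have \<xi>_obj: "(\<lambda>j\<in>Obj J. fst (\<xi> j) X) \<in> lim_obj" if X: "X \<in> dgobj B" for X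
    proof -
      have "fst (Dm i j u) (fst (\<xi> i) X) = fst (\<xi> j) X" if "i \<in> Obj J" "j \<in> Obj J" "u \<in> Mor J i j" for i j u
        using arg_cong[OF comm[OF that], of "\<lambda>F. fst F X"] X by (simp add: Comp_eval)
      then show ?thesis
        using dgwu_map.Fo_in[OF map X] by (simp add: lim_obj_def)
    qed
    have \<xi>_hom: "(\<lambda>j\<in>Obj J. snd (\<xi> j) X Y n f) \<in> lim_hom (\<lambda>j\<in>Obj J. fst (\<xi> j) X) (\<lambda>j\<in>Obj J. fst (\<xi> j) Y) n"
      if X: "X \<in> dgobj B" and Y: "Y \<in> dgobj B" and f: "f \<in> carrier (dghom B X Y n)" for X Y n f
    proof (rule lim_homI)
      show "snd (\<xi> j) X Y n f \<in> carrier (dghom (Do j) ((\<lambda>j\<in>Obj J. fst (\<xi> j) X) j) ((\<lambda>j\<in>Obj J. fst (\<xi> j) Y) j) n)"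
        if "j \<in> Obj J" for j
        using dgwu_map.Fm_in[OF map[OF that] X Y f] that by simp
      show "snd (Dm i j u) ((\<lambda>j\<in>Obj J. fst (\<xi> j) X) i) ((\<lambda>j\<in>Obj J. fst (\<xi> j) Y) i) n (snd (\<xi> i) X Y n f)
          = snd (\<xi> j) X Y n f" if "i \<in> Obj J" "j \<in> Obj J" "u \<in> Mor J i j" for i j u
        using arg_cong[OF comm[OF that], of "\<lambda>F. snd F X Y n f"] X Y f that by (simp add: Comp_eval)
    qed
    note med = B_wu \<xi> \<xi>_obj \<xi>_hom
    show ?thesis
    proof (rule ex1I[of _ "S.mediate B \<xi>"], intro conjI ballI)
      show "S.mediate B \<xi> \<in> Mor (Cat_dgwu K) B S.L"
        unfolding Cat_dgwu_simps by (rule S.mediate_functor[OF med])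
      show "Comp (Cat_dgwu K) B S.L (Do j) (S.proj j) (S.mediate B \<xi>) = \<xi> j" if "j \<in> Obj J" for j
        by (rule S.proj_mediate[OF med that])
      fix h assume h: "h \<in> Mor (Cat_dgwu K) B S.L \<and> (\<forall>j\<in>Obj J. Comp (Cat_dgwu K) B S.L (Do j) (S.proj j) h = \<xi> j)"
      show "h = S.mediate B \<xi>"
      proof (rule S.functor_into_L_eqI)
        show "weakly_unital_dg_functor K B S.L h" using h by (simp add: Cat_dgwu_simps(2))
        show "weakly_unital_dg_functor K B S.L (S.mediate B \<xi>)" by (rule S.mediate_functor[OF med])
        show "Comp (Cat_dgwu K) B S.L (Do j) (S.proj j) h
            = Comp (Cat_dgwu K) B S.L (Do j) (S.proj j) (S.mediate B \<xi>)" if "j \<in> Obj J" for j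
          using S.proj_mediate[OF med that] h that by simp
      qed
    qed
  qed
  with cone show ?thesis unfolding is_limit_def by blast
qed

end

section \<open>Generated substructures of products\<close>

text \<open>No operation creates objects, so \<open>Ob\<close> stays fixed and only morphisms are
  generated. The premises of \<open>wup\<close> repeat \<open>aug_string\<close> with the recursive
  part separated, so that monotonicity is visible.\<close>

inductive gen ::
    "('k, 'r) ring_scheme \<Rightarrow> 'i set \<Rightarrow> ('i \<Rightarrow> ('p, 'n, 'k) wudg_data) \<Rightarrow> ('i \<Rightarrow> 'p) set
      \<Rightarrow> (('i \<Rightarrow> 'p) \<Rightarrow> ('i \<Rightarrow> 'p) \<Rightarrow> int \<Rightarrow> ('i \<Rightarrow> 'n) set)
      \<Rightarrow> ('i \<Rightarrow> 'p) \<Rightarrow> ('i \<Rightarrow> 'p) \<Rightarrow> int \<Rightarrow> ('i \<Rightarrow> 'n) \<Rightarrow> bool"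
  for K I A Ob G where
  base: "\<lbrakk>x \<in> Ob; y \<in> Ob; f \<in> G x y n\<rbrakk> \<Longrightarrow> gen K I A Ob G x y n f"
| zero: "\<lbrakk>x \<in> Ob; y \<in> Ob\<rbrakk> \<Longrightarrow> gen K I A Ob G x y n (\<lambda>i\<in>I. \<zero>\<^bsub>dghom (A i) (x i) (y i) n\<^esub>)"
| add: "\<lbrakk>x \<in> Ob; y \<in> Ob; gen K I A Ob G x y n f; gen K I A Ob G x y n g\<rbrakk>
    \<Longrightarrow> gen K I A Ob G x y n (\<lambda>i\<in>I. f i \<oplus>\<^bsub>dghom (A i) (x i) (y i) n\<^esub> g i)"
| smult: "\<lbrakk>x \<in> Ob; y \<in> Ob; a \<in> carrier K; gen K I A Ob G x y n f\<rbrakk>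
    \<Longrightarrow> gen K I A Ob G x y n (\<lambda>i\<in>I. a \<odot>\<^bsub>dghom (A i) (x i) (y i) n\<^esub> f i)"
| diff: "\<lbrakk>x \<in> Ob; y \<in> Ob; gen K I A Ob G x y n f\<rbrakk>
    \<Longrightarrow> gen K I A Ob G x y (n + 1) (\<lambda>i\<in>I. dgdiff (A i) (x i) (y i) n (f i))"
| comp: "\<lbrakk>x \<in> Ob; y \<in> Ob; z \<in> Ob; gen K I A Ob G y z m f; gen K I A Ob G x y n g\<rbrakk>
    \<Longrightarrow> gen K I A Ob G x z (m + n) (\<lambda>i\<in>I. dgcomp (A i) (x i) (y i) (z i) m n (f i) (g i))"
| wuid: "x \<in> Ob \<Longrightarrow> gen K I A Ob G x x 0 (\<lambda>i\<in>I. wuid (A i) (x i))"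
| wup: "\<lbrakk>fs \<noteq> []; length xs = Suc (length fs); length ds = length fs; set xs \<subseteq> Ob;
      \<forall>j<length fs. gen K I A Ob G (xs ! Suc j) (xs ! j) (ds ! j) (fst (fs ! j));
      \<forall>j<length fs. snd (fs ! j) \<in> carrier K \<and>
        (xs ! Suc j = xs ! j \<and> ds ! j = 0 \<or> snd (fs ! j) = \<zero>\<^bsub>K\<^esub>)\<rbrakk>
    \<Longrightarrow> gen K I A Ob G (last xs) (hd xs) (sum_list ds + 1 - int (length fs))
      (\<lambda>i\<in>I. wup (A i) (map (\<lambda>x. x i) xs) ds (eval_at i fs))"

lemma gen_Ob: "gen K I A Ob G x y n f \<Longrightarrow> x \<in> Ob \<and> y \<in> Ob"
proof (induction rule: gen.induct)
  case (wup fs xs ds)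
  then show ?case by (cases xs) auto
qed auto

text \<open>Every operation ends in a restriction to \<open>I\<close>, so only the generators need
  an assumption.\<close>

lemma gen_extensional:
  assumes "gen K I A Ob G x y n f"
    and "\<And>x y n f. \<lbrakk>x \<in> Ob; y \<in> Ob; f \<in> G x y n\<rbrakk> \<Longrightarrow> f \<in> extensional I"
  shows "f \<in> extensional I"
  using assms(1) by cases (auto intro: assms(2))

text \<open>At a fixed coordinate each rule of \<open>gen\<close> becomes an operation of the factor
  \<open>A i\<close>, under which the factor is closed.\<close>

lemma gen_carrier:
  assumes "gen K I A Ob G x y n f"
    and i: "weakly_unital_dg_category K (A i)" "i \<in> I"
    and Ob: "\<And>x. x \<in> Ob \<Longrightarrow> x i \<in> dgobj (A i)"
    and G: "\<And>x y n f. \<lbrakk>x \<in> Ob; y \<in> Ob; f \<in> G x y n\<rbrakk> \<Longrightarrow> f i \<in> carrier (dghom (A i) (x i) (y i) n)"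
  shows "f i \<in> carrier (dghom (A i) (x i) (y i) n)"
proof -
  interpret A: weakly_unital_dg_category K "A i" by (rule i)
  from assms(1) show ?thesis
  proof (induction rule: gen.induct)
    case (base x y f n)
    then show ?case by (rule G)
  next
    case (wup fs xs ds)
    have lens: "length xs = Suc (length fs)" "xs \<noteq> []" using wup by auto
    have "composable (augment K (A i)) (map (\<lambda>x. x i) xs) ds (eval_at i fs)"
      unfolding composable_def
    proof (intro conjI allI impI)
      fix j assume "j < length (eval_at i fs)"
      then have j: "j < length fs" by simp
      obtain f c where "fs ! j = (f, c)" by (meson surj_pair)
      then show "eval_at i fs ! j \<in> carrier (dghom (augment K (A i)) (map (\<lambda>x. x i) xs ! Suc j)
          (map (\<lambda>x. x i) xs ! j) (ds ! j))"
        using wup.IH wup.hyps(5) j lens by (auto simp: augment_simps aug_hom_simps)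
    qed (use wup.hyps Ob in \<open>auto simp: augment_simps eval_at_def subset_iff\<close>)
    from A.wup_closed[OF this] show ?case
      using lens i by (simp add: hd_map last_map)
  qed (use i Ob in \<open>simp_all add: A.zero_in A.add_in A.smult_in A.diff_in A.comp_in A.wuid_in\<close>)
qed

lemma gen_aug_string:
  assumes "aug_string K Ob (\<lambda>x y n. Collect (gen K I A Ob G x y n)) xs ds fs"
  shows "gen K I A Ob G (last xs) (hd xs) (sum_list ds + 1 - int (length fs))
      (\<lambda>i\<in>I. wup (A i) (map (\<lambda>x. x i) xs) ds (eval_at i fs))"
  using assms by (intro gen.wup) (simp_all add: aug_string_def)

section \<open>Counting the families generated by a small set\<close>

context regular_universe
begin

text \<open>A generated family is named by a finite term built from generators, objects, degrees and
  scalars, all taken from small sets. The number of such terms does not depend on the size of the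
  index set \<open>I\<close> on which the families live.\<close>

lemma small_gen:
  assumes Ob: "small_in U Ob" and G: "\<And>x y n. \<lbrakk>x \<in> Ob; y \<in> Ob\<rbrakk> \<Longrightarrow> G x y n \<subseteq> GG" "small_in U GG"
    and K: "small_in U (carrier K)"
  shows "small_in U {f. \<exists>x y n. gen K I A Ob G x y n f}"
proof -
  \<comment> \<open>The operations are numbered by \<open>t\<close>; degrees, endpoints and scalars are parameters, so that
    only the morphism arguments remain.\<close>
  define op where "op = (\<lambda>(t :: nat, xs, ds :: int list, cs, g) fs.
    if t = 0 then g
    else if t = 1 then (\<lambda>i\<in>I. \<zero>\<^bsub>dghom (A i) ((xs ! 0) i) ((xs ! 1) i) (ds ! 0)\<^esub>)
    else if t = 2 then (\<lambda>i\<in>I. (fs ! 0) i \<oplus>\<^bsub>dghom (A i) ((xs ! 0) i) ((xs ! 1) i) (ds ! 0)\<^esub> (fs ! 1) i)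
    else if t = 3 then (\<lambda>i\<in>I. (cs ! 0) \<odot>\<^bsub>dghom (A i) ((xs ! 0) i) ((xs ! 1) i) (ds ! 0)\<^esub> (fs ! 0) i)
    else if t = 4 then (\<lambda>i\<in>I. dgdiff (A i) ((xs ! 0) i) ((xs ! 1) i) (ds ! 0) ((fs ! 0) i))
    else if t = 5 then (\<lambda>i\<in>I. dgcomp (A i) ((xs ! 0) i) ((xs ! 1) i) ((xs ! 2) i) (ds ! 0) (ds ! 1)
      ((fs ! 0) i) ((fs ! 1) i))
    else if t = 6 then (\<lambda>i\<in>I. wuid (A i) ((xs ! 0) i))
    else (\<lambda>i\<in>I. wup (A i) (map (\<lambda>x. x i) xs) ds (eval_at i (zip fs cs))))"
  \<comment> \<open>The last component holds a generator and is read only for \<open>t = 0\<close>;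
    \<open>undefined\<close> fills it for the other operations.\<close>
  define P where "P = (UNIV :: nat set) \<times> lists Ob \<times> (UNIV :: int list set) \<times> lists (carrier K)
    \<times> insert undefined GG"
  have "small_in U P"
    unfolding P_def
    by (intro small_in_Times small_in_lists small_in_insert small_in_countable countableI_type Ob G(2) K)
  then obtain S where S: "small_in U S" and op: "\<And>p fs. p \<in> P \<Longrightarrow> set fs \<subseteq> S \<Longrightarrow> op p fs \<in> S"
    by (rule small_in_closure[of P op]) blast
  \<comment> \<open>The set \<open>S\<close> is closed under \<open>op\<close> applied to arbitrary
    argument lists, ill-typed ones included. It only has to contain the generated families, by
    induction on their generation.\<close>
  have "f \<in> S" if "gen K I A Ob G x y n f" for x y n f
    using that
  proof (induction rule: gen.induct)
    case (base x y f n)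
    then have "(0, [], [], [], f) \<in> P" using G(1) by (auto simp: P_def)
    from op[OF this, of "[]"] show ?case by (simp add: op_def restrict_def cong: if_cong)
  next
    case (zero x y n)
    then have "(1, [x, y], [n], [], undefined) \<in> P" by (auto simp: P_def)
    from op[OF this, of "[]"] show ?case by (simp add: op_def restrict_def cong: if_cong)
  next
    case (add x y n f g)
    then have "(2, [x, y], [n], [], undefined) \<in> P" by (auto simp: P_def)
    from op[OF this, of "[f, g]"] show ?case using add.IH by (simp add: op_def restrict_def cong: if_cong)
  next
    case (smult x y a n f)
    then have "(3, [x, y], [n], [a], undefined) \<in> P" by (auto simp: P_def)
    from op[OF this, of "[f]"] show ?case using smult.IH by (simp add: op_def restrict_def cong: if_cong)
  next
    case (diff x y n f)
    then have "(4, [x, y], [n], [], undefined) \<in> P" by (auto simp: P_def)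
    from op[OF this, of "[f]"] show ?case using diff.IH by (simp add: op_def restrict_def cong: if_cong)
  next
    case (comp x y z m f n g)
    then have "(5, [x, y, z], [m, n], [], undefined) \<in> P" by (auto simp: P_def)
    from op[OF this, of "[f, g]"] show ?case using comp.IH by (simp add: op_def restrict_def numeral_2_eq_2 cong: if_cong)
  next
    case (wuid x)
    then have "(6, [x], [], [], undefined) \<in> P" by (auto simp: P_def)
    from op[OF this, of "[]"] show ?case by (simp add: op_def restrict_def cong: if_cong)
  next
    case (wup fs xs ds)
    have "\<forall>u\<in>set fs. snd u \<in> carrier K"
      using wup.hyps(5) by (simp add: all_set_conv_all_nth)
    \<comment> \<open>A string is split into its scalar parts, which are parameters, and its
      morphism parts, which are arguments lying in \<open>S\<close>; \<open>zip\<close> puts it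
      together again.\<close>
    then have "(7, xs, ds, map snd fs, undefined) \<in> P"
      using wup.hyps(4) by (auto simp: P_def)
    moreover have "\<forall>u\<in>set fs. fst u \<in> S"
      using wup.IH by (simp add: all_set_conv_all_nth)
    then have "set (map fst fs) \<subseteq> S" by auto
    ultimately have "op (7, xs, ds, map snd fs, undefined) (map fst fs) \<in> S" by (rule op)
    then show ?case by (simp add: op_def restrict_def zip_map_fst_snd cong: if_cong)
  qed
  then show ?thesis by (intro small_in_subset[OF S]) blast
qed

end

section \<open>Colimits\<close>

context small_diagram
begin

text \<open>All vertices are records over the same type \<open>'u\<close>, so the cocones form a set
  and may index a family. Legs are not normalised outside \<open>Obj J\<close>, so one cocone can
  appear under several indices; this does no harm.\<close>

abbreviation cocones :: "(('u, 'u, 'k) wudg_data \<times> ('v \<Rightarrow> ('u, 'u) dg_fun)) set" where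
  "cocones \<equiv> {(Z, \<xi>). is_cocone J (Cat_dgwu K) Do Dm Z \<xi>}"

lemma coconeD:
  assumes "p \<in> cocones"
  shows "weakly_unital_dg_category K (fst p)"
    "j \<in> Obj J \<Longrightarrow> weakly_unital_dg_functor K (Do j) (fst p) (snd p j)"
    "\<lbrakk>i \<in> Obj J; j \<in> Obj J; u \<in> Mor J i j\<rbrakk>
      \<Longrightarrow> Comp (Cat_dgwu K) (Do i) (Do j) (fst p) (snd p j) (Dm i j u) = snd p i"
  using assms by (auto simp: is_cocone_def Cat_dgwu_simps(1,2))

text \<open>The object \<open>X\<close> of vertex \<open>j\<close>, represented by the tuple of its
  images under all cocones. Two objects get the same tuple exactly when every cocone identifies
  them, which is the identification a colimit has to make.\<close>

definition gob :: "'v \<Rightarrow> 'u \<Rightarrow> ('u, 'u, 'k) wudg_data \<times> ('v \<Rightarrow> ('u, 'u) dg_fun) \<Rightarrow> 'u" where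
  "gob j X = (\<lambda>p\<in>cocones. fst (snd p j) X)"

definition gmor :: "'v \<Rightarrow> 'u \<Rightarrow> 'u \<Rightarrow> int \<Rightarrow> 'u
    \<Rightarrow> ('u, 'u, 'k) wudg_data \<times> ('v \<Rightarrow> ('u, 'u) dg_fun) \<Rightarrow> 'u" where
  "gmor j X Y n f = (\<lambda>p\<in>cocones. snd (snd p j) X Y n f)"

definition colim_obj where "colim_obj = (\<Union>j\<in>Obj J. gob j ` dgobj (Do j))"

text \<open>Endpoints are families matched by equations, because several vertices, or several
  objects of one vertex, can give the same family. Morphisms from different vertices can therefore
  become composable.\<close>

definition colim_base where
  "colim_base x y n = {gmor j X Y n f | j X Y f. j \<in> Obj J \<and> X \<in> dgobj (Do j) \<and> Y \<in> dgobj (Do j) \<and>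
    f \<in> carrier (dghom (Do j) X Y n) \<and> x = gob j X \<and> y = gob j Y}"

definition colim_hom where
  "colim_hom x y n = Collect (gen K cocones fst colim_obj colim_base x y n)"

lemma gob_in: "\<lbrakk>j \<in> Obj J; X \<in> dgobj (Do j)\<rbrakk> \<Longrightarrow> gob j X \<in> colim_obj"
  by (auto simp: colim_obj_def)

lemma gmor_in:
  "\<lbrakk>j \<in> Obj J; X \<in> dgobj (Do j); Y \<in> dgobj (Do j); f \<in> carrier (dghom (Do j) X Y n)\<rbrakk>
    \<Longrightarrow> gmor j X Y n f \<in> colim_hom (gob j X) (gob j Y) n"
  unfolding colim_hom_def mem_Collect_eq
  by (rule gen.base) (auto simp: gob_in colim_base_def)

lemma colim_obj_carrier: "\<lbrakk>x \<in> colim_obj; p \<in> cocones\<rbrakk> \<Longrightarrow> x p \<in> dgobj (fst p)"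
  using dgwu_map.Fo_in[OF functor_imp_dgwu_map[OF coconeD(2)]]
  by (auto simp: colim_obj_def gob_def)

lemma colim_base_carrier:
  assumes "f \<in> colim_base x y n" "p \<in> cocones"
  shows "f p \<in> carrier (dghom (fst p) (x p) (y p) n)"
proof -
  obtain j X Y g where j: "j \<in> Obj J" and g: "X \<in> dgobj (Do j)" "Y \<in> dgobj (Do j)"
      "g \<in> carrier (dghom (Do j) X Y n)" and eq: "f = gmor j X Y n g" "x = gob j X" "y = gob j Y"
    using assms(1) by (auto simp: colim_base_def)
  show ?thesis
    using dgwu_map.Fm_in[OF functor_imp_dgwu_map[OF coconeD(2)[OF assms(2) j]] g] assms(2)
    by (simp add: eq gob_def gmor_def)
qed

lemma small_colim_obj: "small_in TYPE('u) colim_obj"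
  unfolding colim_obj_def by (intro small_in_UN small_index small_in_image small_objs)

lemma small_colim_homs:
  assumes "small_in TYPE('u) (carrier K)"
  shows "small_in TYPE('u) {f. \<exists>x y n. gen K cocones fst colim_obj colim_base x y n f}"
proof (rule small_gen[OF small_colim_obj _ _ assms])
  let ?GG = "\<Union>j\<in>Obj J. \<Union>X\<in>dgobj (Do j). \<Union>Y\<in>dgobj (Do j). \<Union>n. gmor j X Y n ` carrier (dghom (Do j) X Y n)"
  show "small_in TYPE('u) ?GG"
    by (intro small_in_UN small_index small_objs small_homs small_in_image small_in_countable countableI_type)
  show "colim_base x y n \<subseteq> ?GG" for x y n
    by (auto simp: colim_base_def) blast
qed

lemma colim_subproduct:
  assumes K: "small_in TYPE('u) (carrier K)" and eo: "inj_on eo colim_obj"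
    and em: "inj_on em {f. \<exists>x y n. gen K cocones fst colim_obj colim_base x y n f}"
  shows "small_subproduct K cocones fst colim_obj colim_hom (eo :: _ \<Rightarrow> 'u) (em :: _ \<Rightarrow> 'u)"
proof (intro small_subproduct.intro subproduct.intro subproduct_axioms.intro small_subproduct_axioms.intro)
  show "weakly_unital_dg_category K (fst p)" if "p \<in> cocones" for p by (rule coconeD(1)[OF that])
  show "x p \<in> dgobj (fst p)" if "x \<in> colim_obj" "p \<in> cocones" for x p by (rule colim_obj_carrier[OF that])
  show "inj_on eo colim_obj" by (rule eo)
  show "inj_on em (\<Union>x\<in>colim_obj. \<Union>y\<in>colim_obj. \<Union>n. colim_hom x y n)"
    by (rule inj_on_subset[OF em]) (auto simp: colim_hom_def)
  show "x \<in> extensional cocones" if "x \<in> colim_obj" for x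
    using that by (auto simp: colim_obj_def gob_def)
  show "small_in TYPE('u) colim_obj" by (rule small_colim_obj)
  show "small_in TYPE('u) (colim_hom x y n)" for x y n
    by (rule small_in_subset[OF small_colim_homs[OF K]]) (auto simp: colim_hom_def)
  show "f p \<in> carrier (dghom (fst p) (x p) (y p) n)" if "f \<in> colim_hom x y n" "p \<in> cocones" for x y n f p
    using that(1) unfolding colim_hom_def mem_Collect_eq
    by (rule gen_carrier[where A = fst and i = p, OF _ coconeD(1)[OF that(2)] that(2)])
      (use colim_obj_carrier colim_base_carrier that(2) in auto)
  show "f \<in> extensional cocones" if "f \<in> colim_hom x y n" for x y n f
    using that unfolding colim_hom_def mem_Collect_eq
    by (rule gen_extensional) (auto simp: colim_base_def gmor_def)
  show "(\<lambda>i\<in>cocones. wup (fst i) (map (\<lambda>x. x i) xs) ds (eval_at i fs))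
      \<in> colim_hom (last xs) (hd xs) (sum_list ds + 1 - int (length fs))"
    if "aug_string K colim_obj colim_hom xs ds fs" for xs ds fs
    using gen_aug_string[of K colim_obj cocones fst colim_base xs ds fs] that
    unfolding colim_hom_def by simp
\<comment> \<open>The remaining closure conditions are introduction rules of
  \<open>gen\<close>.\<close>
qed (unfold colim_hom_def mem_Collect_eq, (rule field gen.intros; assumption)+)

theorem colimit_exists:
  assumes K: "small_in TYPE('u) (carrier K)"
  shows "\<exists>L \<iota>. is_colimit J (Cat_dgwu K) Do Dm L \<iota>"
proof -
  obtain eo :: "_ \<Rightarrow> 'u" where eo: "inj_on eo colim_obj"
    using small_in_inj[OF small_colim_obj] .
  obtain em :: "_ \<Rightarrow> 'u" where em: "inj_on em {f. \<exists>x y n. gen K cocones fst colim_obj colim_base x y n f}"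
    using small_in_inj[OF small_colim_homs[OF K]] .
  interpret S: small_subproduct K cocones fst colim_obj colim_hom eo em
    by (rule colim_subproduct[OF K eo em])
  \<comment> \<open>Fixing \<open>j\<close>, the legs at \<open>j\<close> of all cocones form a
    family of functors out of \<open>Do j\<close>; its mediating functor is the colimit leg.\<close>
  define \<iota> where "\<iota> j = S.mediate (Do j) (\<lambda>p. snd p j)" for j
  have \<iota>_functor: "weakly_unital_dg_functor K (Do j) S.L (\<iota> j)"
    and proj_\<iota>: "\<And>p. p \<in> cocones \<Longrightarrow> Comp (Cat_dgwu K) (Do j) S.L (fst p) (S.proj p) (\<iota> j) = snd p j"
    if j: "j \<in> Obj J" for j
  proof -
    have \<xi>: "weakly_unital_dg_functor K (Do j) (fst p) (snd p j)" if "p \<in> cocones" for p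
      by (rule coconeD(2)[OF that j])
    have o: "(\<lambda>p\<in>cocones. fst (snd p j) X) \<in> colim_obj" if "X \<in> dgobj (Do j)" for X
      using gob_in[OF j that] by (simp add: gob_def)
    have m: "(\<lambda>p\<in>cocones. snd (snd p j) X Y n f)
        \<in> colim_hom (\<lambda>p\<in>cocones. fst (snd p j) X) (\<lambda>p\<in>cocones. fst (snd p j) Y) n"
      if "X \<in> dgobj (Do j)" "Y \<in> dgobj (Do j)" "f \<in> carrier (dghom (Do j) X Y n)" for X Y n f
      using gmor_in[OF j that] by (simp add: gob_def gmor_def)
    note med = vertex[OF j] \<xi> o m
    show "weakly_unital_dg_functor K (Do j) S.L (\<iota> j)"
      unfolding \<iota>_def by (rule S.mediate_functor[OF med])
    show "\<And>p. p \<in> cocones \<Longrightarrow> Comp (Cat_dgwu K) (Do j) S.L (fst p) (S.proj p) (\<iota> j) = snd p j"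
      unfolding \<iota>_def by (rule S.proj_mediate[OF med])
  qed
  have \<iota>_obj: "fst (\<iota> j) X = eo (gob j X)" if "j \<in> Obj J" "X \<in> dgobj (Do j)" for j X
    using that by (simp add: \<iota>_def S.mediate_simps gob_def)
  have \<iota>_mor: "snd (\<iota> j) X Y n f = em (gmor j X Y n f)"
    if "X \<in> dgobj (Do j)" "Y \<in> dgobj (Do j)" "f \<in> carrier (dghom (Do j) X Y n)" for j X Y n f
    using that by (simp add: \<iota>_def S.mediate_simps gmor_def)
  have cocone: "is_cocone J (Cat_dgwu K) Do Dm S.L \<iota>"
  proof (rule is_cocone_def[THEN iffD2], intro conjI ballI S.L_object)
    show "\<iota> j \<in> Mor (Cat_dgwu K) (Do j) S.L" if "j \<in> Obj J" for j
      using \<iota>_functor[OF that] by (simp add: Cat_dgwu_simps)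
    fix i j u assume i: "i \<in> Obj J" and j: "j \<in> Obj J" and u: "u \<in> Mor J i j"
    interpret D: dgwu_map K "Do i" "Do j" "fst (Dm i j u)" "snd (Dm i j u)"
      by (rule functor_imp_dgwu_map[OF arrow[OF i j u]])
    show "Comp (Cat_dgwu K) (Do i) (Do j) S.L (\<iota> j) (Dm i j u) = \<iota> i"
    proof (rule functor_eqI)
      show "weakly_unital_dg_functor K (Do i) S.L (Comp (Cat_dgwu K) (Do i) (Do j) S.L (\<iota> j) (Dm i j u))"
        unfolding Cat_dgwu_simps by (rule functor_comp[OF arrow[OF i j u] \<iota>_functor[OF j]])
      show "weakly_unital_dg_functor K (Do i) S.L (\<iota> i)" by (rule \<iota>_functor[OF i])
      fix X assume X: "X \<in> dgobj (Do i)"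
      \<comment> \<open>Each coordinate is the cocone equation of the cocone indexing it, so the
        legs into the colimit are compatible because every cocone is.\<close>
      have "gob j (fst (Dm i j u) X) = gob i X"
        unfolding gob_def
        using arg_cong[OF coconeD(3)[OF _ i j u], of _ "\<lambda>F. fst F X"] X
        by (intro restrict_ext) (simp add: Comp_eval)
      then show "fst (Comp (Cat_dgwu K) (Do i) (Do j) S.L (\<iota> j) (Dm i j u)) X = fst (\<iota> i) X"
        using X D.Fo_in[OF X] i j by (simp add: Comp_eval \<iota>_obj)
      fix Y n f assume Y: "Y \<in> dgobj (Do i)" and f: "f \<in> carrier (dghom (Do i) X Y n)"
      have "gmor j (fst (Dm i j u) X) (fst (Dm i j u) Y) n (snd (Dm i j u) X Y n f) = gmor i X Y n f"
        unfolding gmor_def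
        using arg_cong[OF coconeD(3)[OF _ i j u], of _ "\<lambda>F. snd F X Y n f"] X Y f
        by (intro restrict_ext) (simp add: Comp_eval)
      then show "snd (Comp (Cat_dgwu K) (Do i) (Do j) S.L (\<iota> j) (Dm i j u)) X Y n f = snd (\<iota> i) X Y n f"
        using X Y f D.Fo_in[OF X] D.Fo_in[OF Y] D.Fm_in[OF X Y f] i j by (simp add: Comp_eval \<iota>_mor)
    qed
  qed
  \<comment> \<open>The factorisation through the colimit is the projection indexed by the cocone itself.\<close>
  have unique: "h = S.proj (Z, \<xi>)"
    if p: "(Z, \<xi>) \<in> cocones" and h: "weakly_unital_dg_functor K S.L Z h"
      and h\<iota>: "\<And>j. j \<in> Obj J \<Longrightarrow> Comp (Cat_dgwu K) (Do j) S.L Z h (\<iota> j) = \<xi> j" for Z \<xi> h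
  proof -
    interpret h: dgwu_map K S.L Z "fst h" "snd h" by (rule functor_imp_dgwu_map[OF h])
    \<comment> \<open>Objects need no induction: each one comes from a vertex, where
      \<open>h\<close> is prescribed by the cocone.\<close>
    have obj: "fst h (eo x) = x (Z, \<xi>)" if x: "x \<in> colim_obj" for x
    proof -
      obtain j X where j: "j \<in> Obj J" and X: "X \<in> dgobj (Do j)" and x: "x = gob j X"
        using x by (auto simp: colim_obj_def)
      from arg_cong[OF h\<iota>[OF j], of "\<lambda>F. fst F X"] show ?thesis
        using X j p by (simp add: Comp_eval \<iota>_obj x gob_def)
    qed
    have eo_in: "eo x \<in> dgobj S.L" if "x \<in> colim_obj" for x
      using that by (simp add: S.L_simps)
    have em_in: "em f \<in> carrier (dghom S.L (eo x) (eo y) n)"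
      if "gen K cocones fst colim_obj colim_base x y n f" for x y n f
      using gen_Ob[OF that] that by (intro S.em_in) (simp add: colim_hom_def)
    have dmor_em: "S.dmor (em f) = f" if "gen K cocones fst colim_obj colim_base x y n f" for x y n f
      using gen_Ob[OF that] that by (intro S.dmor_em[of x y _ n]) (auto simp: colim_hom_def)
    \<comment> \<open>Induction on generation: \<open>h\<close> and evaluation at the coordinate
      \<open>(Z, \<xi>)\<close> agree on the images of the vertices and both preserve every
      operation.\<close>
    have mor: "snd h (eo x) (eo y) n (em f) = f (Z, \<xi>)"
      if "gen K cocones fst colim_obj colim_base x y n f" for x y n f
      using that
    proof (induction rule: gen.induct)
      case (base x y f n)
      obtain j X Y g where j: "j \<in> Obj J" and g: "X \<in> dgobj (Do j)" "Y \<in> dgobj (Do j)"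
          "g \<in> carrier (dghom (Do j) X Y n)" and eq: "f = gmor j X Y n g" "x = gob j X" "y = gob j Y"
        using base(3) by (auto simp: colim_base_def)
      from arg_cong[OF h\<iota>[OF j], of "\<lambda>F. snd F X Y n g"] show ?case
        using g j p by (simp add: Comp_eval \<iota>_obj \<iota>_mor eq gmor_def restrict_def)
    next
      case (zero x y n)
      then show ?case
        using h.Fm_zero[OF eo_in eo_in, of x y n] p by (simp add: S.L_simps obj restrict_def)
    next
      case (add x y n f g)
      then show ?case
        using h.Fm_add[OF eo_in eo_in em_in em_in, of x y n f g] p
        by (simp add: S.L_simps obj dmor_em restrict_def)
    next
      case (smult x y a n f)
      then show ?case
        using h.Fm_smult[OF eo_in eo_in _ em_in, of x y a n f] p
        by (simp add: S.L_simps obj dmor_em restrict_def)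
    next
      case (diff x y n f)
      then show ?case
        using h.Fm_diff[OF eo_in eo_in em_in, of x y n f] p
        by (simp add: S.L_simps obj dmor_em restrict_def)
    next
      case (comp x y z m f n g)
      then show ?case
        using h.Fm_comp[OF eo_in eo_in eo_in em_in em_in, of x y z m f n g] p
        by (simp add: S.L_simps obj dmor_em restrict_def)
    next
      case (wuid x)
      then show ?case
        using h.Fm_id[OF eo_in, of x] p by (simp add: S.L_simps obj restrict_def)
    next
      case (wup fs xs ds)
      have lens: "length xs = Suc (length fs)" "xs \<noteq> []" using wup by auto
      \<comment> \<open>The encoded string inside the colimit. Decoding it returns
        \<open>fs\<close>, so its value under \<open>wup\<close> encodes the generated family, and
        \<open>Fm_p\<close> for \<open>h\<close> computes the image from the entries.\<close>
      let ?fs = "map (map_prod em id) fs"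
      have gen: "gen K cocones fst colim_obj colim_base (xs ! Suc j) (xs ! j) (ds ! j) (fst (fs ! j))"
        and IH: "snd h (eo (xs ! Suc j)) (eo (xs ! j)) (ds ! j) (em (fst (fs ! j))) = fst (fs ! j) (Z, \<xi>)"
        if "j < length fs" for j
        using wup.IH that by auto
      have c: "composable (augment K S.L) (map eo xs) ds ?fs"
        unfolding composable_def
      proof (intro conjI allI impI)
        fix j assume "j < length ?fs"
        then have j: "j < length fs" by simp
        obtain f a where "fs ! j = (f, a)" by (meson surj_pair)
        then show "?fs ! j \<in> carrier (dghom (augment K S.L) (map eo xs ! Suc j) (map eo xs ! j) (ds ! j))"
          using em_in[OF gen[OF j]] wup.hyps(5) j lens by (auto simp: augment_simps aug_hom_simps)
      qed (use wup.hyps eo_in in \<open>auto simp: augment_simps subset_iff\<close>)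
      have xs: "map S.dob (map eo xs) = xs"
        using wup.hyps(4) by (simp add: map_idI subset_iff)
      have fs: "map (map_prod S.dmor id) ?fs = fs"
        using dmor_em[OF gen] by (intro nth_equalityI) (auto simp: prod_eq_iff)
      have "wup S.L (map eo xs) ds ?fs
          = em (\<lambda>i\<in>cocones. wup (fst i) (map (\<lambda>x. x i) xs) ds (eval_at i fs))"
        unfolding S.L_simps(9) xs fs ..
      moreover have "map_string (snd h) (map eo xs) ds ?fs = eval_at (Z, \<xi>) fs"
        using IH lens by (intro nth_equalityI) (auto simp: prod_eq_iff)
      moreover have "map (fst h) (map eo xs) = map (\<lambda>x. x (Z, \<xi>)) xs"
        using obj wup.hyps(4) by auto
      ultimately show ?case
        using h.Fm_p[OF c] p lens by (simp add: hd_map last_map restrict_def del: map_map)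
    qed
    have eo_dob: "eo (S.dob X) = X" if "X \<in> dgobj S.L" for X
      using that by (auto simp: S.L_simps(1))
    show ?thesis
    proof (rule functor_eqI[OF h])
      show "weakly_unital_dg_functor K S.L Z (S.proj (Z, \<xi>))"
        using S.proj_functor[OF p] by simp
      fix X assume X: "X \<in> dgobj S.L"
      show "fst h X = fst (S.proj (Z, \<xi>)) X"
        using obj[OF S.dob_in[OF X]] X by (simp add: S.proj_simps eo_dob)
      fix Y n f assume Y: "Y \<in> dgobj S.L" and f: "f \<in> carrier (dghom S.L X Y n)"
      obtain f' where f': "f = em f'" "f' \<in> colim_hom (S.dob X) (S.dob Y) n"
        using f by (auto simp: S.L_simps(2))
      then have g: "gen K cocones fst colim_obj colim_base (S.dob X) (S.dob Y) n f'"
        by (simp add: colim_hom_def)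
      show "snd h X Y n f = snd (S.proj (Z, \<xi>)) X Y n f"
        using mor[OF g] dmor_em[OF g] X Y f by (simp add: S.proj_simps eo_dob f'(1))
    qed
  qed
  have "\<exists>!h. h \<in> Mor (Cat_dgwu K) S.L Z \<and> (\<forall>j\<in>Obj J. Comp (Cat_dgwu K) (Do j) S.L Z h (\<iota> j) = \<xi> j)"
    if "is_cocone J (Cat_dgwu K) Do Dm Z \<xi>" for Z \<xi>
  proof -
    have p: "(Z, \<xi>) \<in> cocones" using that by simp
    show ?thesis
    proof (rule ex1I[of _ "S.proj (Z, \<xi>)"], intro conjI ballI)
      show "S.proj (Z, \<xi>) \<in> Mor (Cat_dgwu K) S.L Z"
        using S.proj_functor[OF p] by (simp add: Cat_dgwu_simps)
      show "Comp (Cat_dgwu K) (Do j) S.L Z (S.proj (Z, \<xi>)) (\<iota> j) = \<xi> j" if "j \<in> Obj J" for j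
        using proj_\<iota>[OF that p] by simp
      fix h assume "h \<in> Mor (Cat_dgwu K) S.L Z \<and> (\<forall>j\<in>Obj J. Comp (Cat_dgwu K) (Do j) S.L Z h (\<iota> j) = \<xi> j)"
      then show "h = S.proj (Z, \<xi>)"
        by (intro unique[OF p]) (simp_all add: Cat_dgwu_simps(2))
    qed
  qed
  with cocone show ?thesis unfolding is_colimit_def by blast
qed

end

text \<open>The bound on the field enters through the colimit, where scalars are among the
  parameters of the generating operations and so contribute to the size of the hom spaces.\<close>

theorem theorem1p19:
  fixes K :: "('k, 'r) ring_scheme"
  assumes "universe TYPE('v) TYPE('u)"
    and "field K"
    and "|carrier K| <o |UNIV :: 'u set|"
  shows "small_complete TYPE('v)
      (Cat_dgwu K :: (('u, 'u, 'k) wudg_data, ('u, 'u) dg_fun) category_data)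
    \<and> small_cocomplete TYPE('v)
      (Cat_dgwu K :: (('u, 'u, 'k) wudg_data, ('u, 'u) dg_fun) category_data)"
proof -
  have "small_diagram K J Do Dm"
    if "small_category J \<and> diagram J (Cat_dgwu K :: (('u, 'u, 'k) wudg_data, ('u, 'u) dg_fun) category_data) Do Dm"
    for J :: "('v, 'v) category_data" and Do Dm
    using that assms by (intro small_diagram.intro small_diagram_axioms.intro) auto
  moreover have "small_in TYPE('u) (carrier K)"
    using assms(3) by (simp add: small_in_def)
  ultimately show ?thesis
    unfolding small_complete_def small_cocomplete_def
    using Cat_dgwu_category small_diagram.limit_exists small_diagram.colimit_exists by blast
qed

end
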